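(* Assume access to an initial state preparation oracle $U_0$ satisfying $U_0|0\rangle=|\psi_+(0)\rangle$ or $U_0|0\rangle=|\psi_-(0)\rangle$ and to its inverse $U_0^\dagger$. Then there exists a deterministic, fully coherent, ancilla-free algorithm $\mathcal A$, based on iterating the implemented one-step map $\widetilde\Phi^{({\rm GP})}_\tau$ (i.e. on the recursive circuits $U_{k+1}=V_{\rm NLSE}(\rho_k,\tau)U_k$ with $\rho_k=U_k|0\rangle\langle0|U_k^\dagger$, starting from the given $U_0$, with step size and number of steps depending only on $g,\xi,T,\epsilon$), that solves the single-qubit Gross--Pitaevskii simulation problem (defined in the context) for all $g>0$, $T>0$, $0<\xi<1$ and $0<\epsilon<1$. Its worst-case initial state preparation oracle query count satisfies $$Q_{\mathcal A}^{\rm wc}(g,T,\epsilon)\le\exp\left[O\left(1+gT+\frac{(gT)^2}{\epsilon^2}\right)\right],$$ where the implied constant is independent of $g,T,\xi$ and $\epsilon$.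
   Context: $X,Y,Z$ are the Pauli matrices, $\|A\|_1=\operatorname{Tr}\sqrt{A^\dagger A}$. The single-qubit discrete Gross--Pitaevskii equation with nonlinearity strength $g>0$ is $$i\frac{d}{dt}|\psi(t)\rangle=\left[\frac g4X+\frac g2\left(\rho(t)+Z\rho(t)Z\right)\right]|\psi(t)\rangle,\qquad \rho(t)=|\psi(t)\rangle\langle\psi(t)|.$$ For $0<\xi<1$, the two candidate initial states are the pure states $\rho_\pm(0)=|\psi_\pm(0)\rangle\langle\psi_\pm(0)|$ with Bloch vectors (for $\rho=\frac12(\mathbb I+xX+yY+zZ)$, the Bloch vector is $(x,y,z)$) $$r_\pm(0)=\left(1-\xi,\ \pm\sqrt{\xi(1-\xi)},\ \pm\sqrt\xi\right)$$ (same sign in the last two components; global phases of $|\psi_\pm(0)\rangle$ fixed arbitrarily). $\rho_\pm(t)$ denotes the corresponding exact solution; its Bloch vector is $r_\pm(t)=\left(\tanh^2a(t),\ \pm\frac{\tanh a(t)}{\cosh a(t)},\ \pm\frac1{\cosh a(t)}\right)$ with $a(t)=\operatorname{artanh}\sqrt{1-\xi}-gt/2$. One-step map: for a pure single-qubit state $\rho$ and $\tau>0$, with $R_\rho=\mathbb I-2\rho$, $$A_H(\rho,\pm\tau/2)=e^{\pm i(g\tau/8)X}e^{\pm i(g\tau/4)\rho}Ze^{\pm i(g\tau/4)\rho}Z,\quad V_{\rm NLSE}(\rho,\tau)=A_H(\rho,-\tau/2)R_\rho A_H(\rho,\tau/2)R_\rho,$$ $$\widetilde\Phi^{({\rm GP})}_\tau(\rho)=V_{\rm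 NLSE}(\rho,\tau)\,\rho\,V_{\rm NLSE}(\rho,\tau)^\dagger.$$ When $\rho=U|0\rangle\langle0|U^\dagger$, the factors $e^{i\theta\rho}=Ue^{i\theta|0\rangle\langle0|}U^\dagger$ and $R_\rho=U(\mathbb I-2|0\rangle\langle0|)U^\dagger$ are each implemented with one call to $U$ and one to $U^\dagger$. Simulation problem: the parameters $g>0$, $0<\xi<1$, $T>0$ and accuracy $0<\epsilon<1$ are known when the circuit is designed ($\xi$ and $T$ are specified independently). A unitary oracle $U_0$ on one qubit is given with $U_0|0\rangle=|\psi_+(0)\rangle$ or $U_0|0\rangle=|\psi_-(0)\rangle$; which of the two holds, and the action of $U_0$ on $|1\rangle$, are not known. The algorithm must output, for every such $U_0$, a state $\widetilde\rho$ with $\|\widetilde\rho-\rho_\pm(T)\|_1\le\epsilon$ for the sign matching $U_0$. For fixed $(g,\xi,T,\epsilon)$ the non-query gates and their parameters, the number and placement of oracle queries, and whether each query is $U_0$ or $U_0^\dagger$, are the same for both candidates and for all allowed oracles; they may depend on $(g,\xi,T,\epsilon)$. A deterministic, fully coherent, ancilla-free algorithm is, for each $(g,\xi,T,\epsilon)$, a product $W_qO_qW_{q-1}\cdots O_1W_0$ applied to $|0\rangle$, with $O_j\in\{U_0,U_0^\dagger\}$ (the queries) and $W_j$ fixed single-qubit unitaries (non-query gates). $Q_{\mathcal A}(g,T,\xi,\epsilon)$ is the number of queries to $U_0$ and $U_0^\dagger$ (maximized over all allowed oracles), and $Q^{\rm wc}_{\mathcal A}(g,T,\epsilon)=\sup_{0<\xi<1}Q_{\mathcal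 A}(g,T,\xi,\epsilon)$. *)

theory Defs
  imports "HOL-Analysis.Analysis"
begin

section \<open>Complex matrices\<close>

text \<open>
  Square matrices are elements of \<open>complex^'n^'n\<close> with product \<open>**\<close>. The operator \<open>*\<close> on this
  type is componentwise, so the library function \<open>exp\<close> is not the matrix exponential.
\<close>

type_synonym qmat = "complex^2^2"
type_synonym qvec = "complex^2"

definition mscale :: "complex \<Rightarrow> complex^'n^'m \<Rightarrow> complex^'n^'m" (infixr "*\<^sub>m" 75) where
  "c *\<^sub>m A = (\<chi> i j. c * A $ i $ j)"

definition madj :: "complex^'n^'m \<Rightarrow> complex^'m^'n" where
  "madj A = (\<chi> i j. cnj (A $ j $ i))"

definition unitary_mat :: "complex^'n^'n \<Rightarrow> bool" where
  "unitary_mat U \<longleftrightarrow> madj U ** U = mat 1 \<and> U ** madj U = mat 1"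

primrec mpow :: "complex^'n^'n \<Rightarrow> nat \<Rightarrow> complex^'n^'n" where
  "mpow A 0 = mat 1"
| "mpow A (Suc k) = A ** mpow A k"

definition mexp :: "complex^'n^'n \<Rightarrow> complex^'n^'n" where
  "mexp A = (\<Sum>k. (1 / fact k) *\<^sub>R mpow A k)"

definition psd_mat :: "complex^'n^'n \<Rightarrow> bool" where
  "psd_mat B \<longleftrightarrow> madj B = B \<and> (\<forall>v. 0 \<le> Re (\<Sum>i\<in>UNIV. cnj (v $ i) * (B *v v) $ i))"

text \<open>Only meaningful for positive semidefinite arguments, whose positive root is unique.\<close>

definition msqrt :: "complex^'n^'n \<Rightarrow> complex^'n^'n" where
  "msqrt A = (THE B. psd_mat B \<and> B ** B = A)"

definition trace_norm :: "complex^'n^'n \<Rightarrow> real" where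
  "trace_norm A = Re (trace (msqrt (madj A ** A)))"

section \<open>Single-qubit states\<close>

definition pauli_X :: qmat where "pauli_X = vector [vector [0, 1], vector [1, 0]]"
definition pauli_Y :: qmat where "pauli_Y = vector [vector [0, - \<i>], vector [\<i>, 0]]"
definition pauli_Z :: qmat where "pauli_Z = vector [vector [1, 0], vector [0, - 1]]"

definition ket0 :: qvec where "ket0 = vector [1, 0]"

definition dyad :: "complex^'n \<Rightarrow> complex^'n^'n" where
  "dyad \<psi> = (\<chi> i j. \<psi> $ i * cnj (\<psi> $ j))"

definition bloch_state :: "real \<Rightarrow> real \<Rightarrow> real \<Rightarrow> qmat" where
  "bloch_state x y z = (1/2) *\<^sub>R (mat 1 + x *\<^sub>R pauli_X + y *\<^sub>R pauli_Y + z *\<^sub>R pauli_Z)"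

definition prepared_state :: "qmat \<Rightarrow> qmat" where
  "prepared_state U = U ** dyad ket0 ** madj U"

text \<open>The sign \<open>s\<close> is \<open>1\<close> or \<open>- 1\<close> and selects one of the two candidates.\<close>

definition initial_state :: "real \<Rightarrow> real \<Rightarrow> qmat" where
  "initial_state \<xi> s = bloch_state (1 - \<xi>) (s * sqrt (\<xi> * (1 - \<xi>))) (s * sqrt \<xi>)"

section \<open>The discrete Gross--Pitaevskii equation\<close>

definition gp_hamiltonian :: "real \<Rightarrow> qmat \<Rightarrow> qmat" where
  "gp_hamiltonian g \<rho> = (g/4) *\<^sub>R pauli_X + (g/2) *\<^sub>R (\<rho> + pauli_Z ** \<rho> ** pauli_Z)"

definition gp_solution :: "real \<Rightarrow> real \<Rightarrow> (real \<Rightarrow> qvec) \<Rightarrow> bool" where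
  "gp_solution g T \<psi> \<longleftrightarrow>
     (\<forall>t\<in>{0..T}. \<exists>D. (\<psi> has_vector_derivative D) (at t within {0..T}) \<and>
                     \<i> *s D = gp_hamiltonian g (dyad (\<psi> t)) *v \<psi> t)"

section \<open>The one-step map\<close>

definition reflection :: "qmat \<Rightarrow> qmat" where
  "reflection \<rho> = mat 1 - 2 *\<^sub>R \<rho>"

text \<open>This unitary is only used at \<open>t = \<tau>/2\<close> and \<open>t = - \<tau>/2\<close>.\<close>

definition A_H :: "real \<Rightarrow> qmat \<Rightarrow> real \<Rightarrow> qmat" where
  "A_H g \<rho> t =
     mexp ((\<i> * complex_of_real (g * t / 4)) *\<^sub>m pauli_X) **
     mexp ((\<i> * complex_of_real (g * t / 2)) *\<^sub>m \<rho>) ** pauli_Z **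
     mexp ((\<i> * complex_of_real (g * t / 2)) *\<^sub>m \<rho>) ** pauli_Z"

definition V_NLSE :: "real \<Rightarrow> qmat \<Rightarrow> real \<Rightarrow> qmat" where
  "V_NLSE g \<rho> \<tau> = A_H g \<rho> (- \<tau> / 2) ** reflection \<rho> ** A_H g \<rho> (\<tau> / 2) ** reflection \<rho>"

definition gp_map :: "real \<Rightarrow> real \<Rightarrow> qmat \<Rightarrow> qmat" where
  "gp_map g \<tau> \<rho> = V_NLSE g \<rho> \<tau> ** \<rho> ** madj (V_NLSE g \<rho> \<tau>)"

primrec gp_unitary :: "real \<Rightarrow> real \<Rightarrow> qmat \<Rightarrow> nat \<Rightarrow> qmat" where
  "gp_unitary g \<tau> U\<^sub>0 0 = U\<^sub>0"
| "gp_unitary g \<tau> U\<^sub>0 (Suc k) =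
     V_NLSE g (prepared_state (gp_unitary g \<tau> U\<^sub>0 k)) \<tau> ** gp_unitary g \<tau> U\<^sub>0 k"

section \<open>Coherent ancilla-free query circuits\<close>

text \<open>
  \<open>Call W\<^sub>0 O\<^sub>1 (Call W\<^sub>1 O\<^sub>2 (\<dots> (Final W\<^sub>q)))\<close> stands for the product
  \<open>W\<^sub>q O\<^sub>q \<dots> W\<^sub>1 O\<^sub>1 W\<^sub>0\<close>; the gate \<open>W\<^sub>0\<close> is applied first. Since a circuit is a fixed list of gates
  and query slots, the number of its queries is the same for all oracles.
\<close>

datatype oracle_query = Forward | Backward

datatype circuit = Final qmat | Call qmat oracle_query circuit

primrec query_op :: "qmat \<Rightarrow> oracle_query \<Rightarrow> qmat" where
  "query_op U Forward = U"
| "query_op U Backward = madj U"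

primrec flip_query :: "oracle_query \<Rightarrow> oracle_query" where
  "flip_query Forward = Backward"
| "flip_query Backward = Forward"

primrec circuit_op :: "circuit \<Rightarrow> qmat \<Rightarrow> qmat" where
  "circuit_op (Final W) U = W"
| "circuit_op (Call W d C) U = circuit_op C U ** query_op U d ** W"

primrec unitary_gates :: "circuit \<Rightarrow> bool" where
  "unitary_gates (Final W) \<longleftrightarrow> unitary_mat W"
| "unitary_gates (Call W d C) \<longleftrightarrow> unitary_mat W \<and> unitary_gates C"

primrec query_count :: "circuit \<Rightarrow> nat" where
  "query_count (Final W) = 0"
| "query_count (Call W d C) = Suc (query_count C)"

primrec after_gate :: "qmat \<Rightarrow> circuit \<Rightarrow> circuit" where
  "after_gate V (Final W) = Final (W ** V)"
| "after_gate V (Call W d C) = Call (W ** V) d C"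

text \<open>In \<open>C \<then> D\<close> the circuit \<open>C\<close> is run first; the two adjacent gates are merged into one.\<close>

primrec circuit_seq :: "circuit \<Rightarrow> circuit \<Rightarrow> circuit" (infixr "\<then>" 65) where
  "Final W \<then> D = after_gate W D"
| "Call W d C \<then> D = Call W d (C \<then> D)"

primrec circuit_inv :: "circuit \<Rightarrow> circuit" where
  "circuit_inv (Final W) = Final (madj W)"
| "circuit_inv (Call W d C) = circuit_inv C \<then> Call (mat 1) (flip_query d) (Final (madj W))"

section \<open>The recursive circuits\<close>

text \<open>
  If \<open>C\<close> implements \<open>U\<close> and \<open>\<rho> = U |0><0| U\<^sup>\<dagger>\<close>, then \<open>conj_circuit G C\<close> implements \<open>U G U\<^sup>\<dagger>\<close> with one
  call to \<open>U\<close> and one to \<open>U\<^sup>\<dagger>\<close>. This is used for \<open>exp(i \<theta> \<rho>)\<close> and for \<open>reflection \<rho>\<close>.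
\<close>

definition conj_circuit :: "qmat \<Rightarrow> circuit \<Rightarrow> circuit" where
  "conj_circuit G C = circuit_inv C \<then> Final G \<then> C"

definition exp_circuit :: "real \<Rightarrow> circuit \<Rightarrow> circuit" where
  "exp_circuit \<theta> C = conj_circuit (mexp ((\<i> * complex_of_real \<theta>) *\<^sub>m dyad ket0)) C"

definition reflection_circuit :: "circuit \<Rightarrow> circuit" where
  "reflection_circuit C = conj_circuit (reflection (dyad ket0)) C"

definition A_H_circuit :: "real \<Rightarrow> real \<Rightarrow> circuit \<Rightarrow> circuit" where
  "A_H_circuit g t C =
     Final pauli_Z \<then> exp_circuit (g * t / 2) C \<then> Final pauli_Z \<then> exp_circuit (g * t / 2) C \<then>
     Final (mexp ((\<i> * complex_of_real (g * t / 4)) *\<^sub>m pauli_X))"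

definition gp_step_circuit :: "real \<Rightarrow> real \<Rightarrow> circuit \<Rightarrow> circuit" where
  "gp_step_circuit g \<tau> C =
     C \<then> reflection_circuit C \<then> A_H_circuit g (\<tau> / 2) C \<then>
     reflection_circuit C \<then> A_H_circuit g (- \<tau> / 2) C"

definition gp_circuit :: "real \<Rightarrow> real \<Rightarrow> nat \<Rightarrow> circuit" where
  "gp_circuit g \<tau> n = (gp_step_circuit g \<tau> ^^ n) (Call (mat 1) Forward (Final (mat 1)))"

definition implements_gp_iteration :: "real \<Rightarrow> real \<Rightarrow> nat \<Rightarrow> circuit \<Rightarrow> bool" where
  "implements_gp_iteration g \<tau> n C \<longleftrightarrow>
     C = gp_circuit g \<tau> n \<and>
     (\<forall>U\<^sub>0. unitary_mat U\<^sub>0 \<longrightarrow>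
        circuit_op C U\<^sub>0 = gp_unitary g \<tau> U\<^sub>0 n \<and>
        prepared_state (circuit_op C U\<^sub>0) = (gp_map g \<tau> ^^ n) (prepared_state U\<^sub>0))"

section \<open>The simulation problem\<close>

text \<open>An algorithm assigns a circuit to the known parameters \<open>g, \<xi>, T, \<epsilon>\<close>, in this order.\<close>

type_synonym algorithm = "real \<Rightarrow> real \<Rightarrow> real \<Rightarrow> real \<Rightarrow> circuit"

text \<open>
  The candidate initial vector is \<open>U\<^sub>0 |0>\<close> itself, which leaves its global phase arbitrary; the
  action of \<open>U\<^sub>0\<close> on the other basis vector is unconstrained.
\<close>

definition solves_gp_problem :: "real \<Rightarrow> real \<Rightarrow> real \<Rightarrow> real \<Rightarrow> circuit \<Rightarrow> bool" where
  "solves_gp_problem g \<xi> T \<epsilon> C \<longleftrightarrow>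
     (\<forall>U\<^sub>0. \<forall>s\<in>{1, - 1}. \<forall>\<psi>.
        unitary_mat U\<^sub>0 \<and> dyad (U\<^sub>0 *v ket0) = initial_state \<xi> s \<and>
        gp_solution g T \<psi> \<and> \<psi> 0 = U\<^sub>0 *v ket0 \<longrightarrow>
        trace_norm (prepared_state (circuit_op C U\<^sub>0) - dyad (\<psi> T)) \<le> \<epsilon>)"

definition worst_case_queries :: "algorithm \<Rightarrow> real \<Rightarrow> real \<Rightarrow> real \<Rightarrow> ereal" where
  "worst_case_queries \<A> g T \<epsilon> = (SUP \<xi>\<in>{0<..<1}. ereal (real (query_count (\<A> g \<xi> T \<epsilon>))))"

end

theory Submission
  imports Defs
begin

text \<open>
  Write \<open>r = (x, y, z)\<close> for the Bloch vector and \<open>h = g \<tau>\<close>. On the unit sphere the energy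
  \<open>x + z\<^sup>2\<close> is conserved by the exact flow, and both candidates start on the separatrix \<open>x + z\<^sup>2 = 1\<close>
  of the saddle \<open>(1, 0, 0)\<close>. With \<open>q = y / z\<close> the quantity \<open>p = z / (1 + q) = (1 - q) / z\<close> is a clock on
  this curve: it grows exactly like \<open>exp (g t / 2)\<close>, and the exact solution is a rational function of it.

  One step of the map is an Euler step whose error is even in \<open>(y, z)\<close> in the first component and odd in
  the others, so it vanishes at the saddle and the energy error per step is \<open>O(h\<^sup>2 z\<^sup>2)\<close>. While \<open>p \<le> 1\<close>
  the energy error therefore stays \<open>O(h p\<^sup>2)\<close>, which is small relative to \<open>z\<^sup>2\<close> no matter how
  small \<open>\<xi>\<close> is; once \<open>p > 1\<close> it grows by a geometric series only and stays \<open>O(h)\<close>. In both phases the clock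
  is multiplied by a factor between \<open>1 + h/4\<close> and \<open>1 + h\<close> in each step.

  The number of steps is not \<open>T / \<tau>\<close>: it is the first time at which the discrete clock passes its exact
  value at time \<open>T\<close>, or the value \<open>24 / \<epsilon>\<close> beyond which the exact solution stays within \<open>O(\<epsilon>)\<close> of the
  saddle. This removes the phase error, and the state is accurate as soon as \<open>h p\<close> is \<open>O(\<epsilon>)\<close> there. So
  \<open>h\<close> of order \<open>\<epsilon>\<^sup>2\<close> suffices for \<open>g T \<ge> 1\<close>, and of order \<open>\<epsilon>\<close> for \<open>g T < 1\<close>. The stopping index is
  the same for both candidates because the map commutes with \<open>(x, y, z) \<mapsto> (x, - y, - z)\<close>, and each step
  multiplies the number of queries by 13.
\<close>

section \<open>Clocks on the separatrix\<close>

text \<open>With p = e^(-a) these are tanh a and 1 / cosh a, so (q^2, q z, z) is the exact Bloch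
  vector in rational form, and time evolution multiplies p by exp (g t / 2).\<close>

definition curve_q :: "real \<Rightarrow> real" where "curve_q p = (1 - p\<^sup>2) / (1 + p\<^sup>2)"
definition curve_z :: "real \<Rightarrow> real" where "curve_z p = 2 * p / (1 + p\<^sup>2)"

text \<open>Errors are weighted by d = sqrt (y^2 + z^2), the distance from the x-axis: d^2 in x, and
  d in y and z. Dividing by z later turns the latter into relative errors O(h^2) that stay uniform
  up to the saddle.\<close>

definition euler_step :: "real \<Rightarrow> real \<Rightarrow> real \<Rightarrow> real \<Rightarrow> real \<Rightarrow> real \<Rightarrow> real \<Rightarrow> real \<Rightarrow> bool" where
  "euler_step K h x y z x' y' z' \<longleftrightarrow>
     \<bar>x' - (x - h * (y * z))\<bar> \<le> K * h\<^sup>2 * (y\<^sup>2 + z\<^sup>2) \<and>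
     \<bar>y' - (y + h * (z * (x - 1/2)))\<bar> \<le> K * h\<^sup>2 * sqrt (y\<^sup>2 + z\<^sup>2) \<and>
     \<bar>z' - (z + h * (y / 2))\<bar> \<le> K * h\<^sup>2 * sqrt (y\<^sup>2 + z\<^sup>2)"

text \<open>On the sphere y^2 - x z^2 = - (1 + x) (x + z^2 - 1). Division by z^2 shows that a defect
  of relative size \<eta> moves q = y / z off the curve relations q^2 = x and q^2 + z^2 = 1 by
  O(\<eta>) only, however small z is.\<close>

lemma sphere_relations:
  fixes x y z \<eta> :: real
  assumes "x\<^sup>2 + y\<^sup>2 + z\<^sup>2 = 1" "0 < z" "\<bar>x + z\<^sup>2 - 1\<bar> \<le> \<eta> * z\<^sup>2" "\<eta> \<le> 1/100"
  shows "\<bar>(y/z)\<^sup>2 - x\<bar> \<le> 2 * \<eta>" "\<bar>(y/z)\<^sup>2 + z\<^sup>2 - 1\<bar> \<le> 3 * \<eta>" "\<bar>y/z\<bar> \<le> 51/50" "0 \<le> \<eta>"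
    "\<bar>x\<bar> \<le> 1" "z \<le> 1"
proof -
  have x2: "x\<^sup>2 \<le> 1" and z2: "z\<^sup>2 \<le> 1" using assms(1) by (smt (verit) zero_le_power2)+
  show x1: "\<bar>x\<bar> \<le> 1" using x2 by (simp add: abs_square_le_1)
  show "z \<le> 1" using z2 assms(2) by (simp add: abs_square_le_1)
  have zp: "0 < z\<^sup>2" using assms(2) by simp
  show \<eta>: "0 \<le> \<eta>" using assms(3) zp by (smt (verit) mult_neg_pos)
  let ?d = "x + z\<^sup>2 - 1"
  have "y\<^sup>2 - x * z\<^sup>2 = - ((1 + x) * ?d)" using assms(1) by algebra
  hence e: "(y/z)\<^sup>2 - x = - ((1 + x) * (?d / z\<^sup>2))" using zp by (simp add: field_simps)
  have d: "\<bar>?d / z\<^sup>2\<bar> \<le> \<eta>" using assms(3) zp by (simp add: abs_mult pos_divide_le_eq)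
  have "\<bar>(1 + x) * (?d / z\<^sup>2)\<bar> \<le> 2 * \<eta>"
    unfolding abs_mult using d x1 by (intro mult_mono) auto
  thus 1: "\<bar>(y/z)\<^sup>2 - x\<bar> \<le> 2 * \<eta>" using e by simp
  have "\<eta> * z\<^sup>2 \<le> \<eta>" using z2 \<eta> by (simp add: mult_left_le)
  hence "\<bar>?d\<bar> \<le> \<eta>" using assms(3) by simp
  thus "\<bar>(y/z)\<^sup>2 + z\<^sup>2 - 1\<bar> \<le> 3 * \<eta>" using 1 by linarith
  have "(y/z)\<^sup>2 \<le> (51/50)\<^sup>2" using 1 x1 assms(4) by (simp add: power2_eq_square[of "51/50"])
  thus "\<bar>y/z\<bar> \<le> 51/50" by (metis abs_le_square_iff abs_of_nonneg divide_nonneg_nonneg zero_le_numeral)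
qed

text \<open>Since |y / z| is at most 51/50, sqrt (y^2 + z^2) is at most 2 z, and every error can be
  expressed in units of z.\<close>

lemma euler_step_relative:
  fixes x y z \<eta> K h :: real
  assumes st: "euler_step K h x y z x' y' z'" and "1 \<le> K" "0 < h" "K * h \<le> 1/1000"
    and sph: "x\<^sup>2 + y\<^sup>2 + z\<^sup>2 = 1" "0 < z" "\<bar>x + z\<^sup>2 - 1\<bar> \<le> \<eta> * z\<^sup>2" "\<eta> \<le> 1/100"
  obtains e2 e3 where "z' = z * (1 + h * (y/z/2 + e3))" "y' = z * (y/z + h * (x - 1/2 + e2))"
    "\<bar>e2\<bar> \<le> 2 * (K * h)" "\<bar>e3\<bar> \<le> 2 * (K * h)"
    "\<bar>(x' + z'\<^sup>2 - 1) - (x + z\<^sup>2 - 1)\<bar> \<le> 12 * K * h\<^sup>2 * z\<^sup>2"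
proof -
  note sr = sphere_relations[OF sph]
  let ?d = "sqrt (y\<^sup>2 + z\<^sup>2)"
  have "(y/z)\<^sup>2 \<le> (51/50)\<^sup>2" using sr(3) by (metis abs_le_square_iff abs_of_nonneg divide_nonneg_nonneg zero_le_numeral)
  hence "y\<^sup>2 \<le> (51/50)\<^sup>2 * z\<^sup>2" using sph(2) by (simp add: power_divide pos_divide_le_eq)
  also have "\<dots> \<le> 2 * z\<^sup>2" by (intro mult_right_mono) (auto simp: power2_eq_square)
  finally have y2: "y\<^sup>2 + z\<^sup>2 \<le> 3 * z\<^sup>2" by simp
  also have "\<dots> \<le> (2*z)\<^sup>2" by (simp add: power_mult_distrib)
  finally have d2: "?d \<le> 2 * z" using sph(2) by (simp add: real_le_lsqrt)
  define E3 where "E3 = z' - (z + h * (y / 2))"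
  define E2 where "E2 = y' - (y + h * (z * (x - 1/2)))"
  define E1 where "E1 = x' - (x - h * (y * z))"
  have E: "\<bar>E1\<bar> \<le> K * h\<^sup>2 * (y\<^sup>2 + z\<^sup>2)" "\<bar>E2\<bar> \<le> K * h\<^sup>2 * ?d" "\<bar>E3\<bar> \<le> K * h\<^sup>2 * ?d"
    using st unfolding euler_step_def E1_def E2_def E3_def by auto
  have hz: "0 < h * z" using assms by simp
  have "K * h\<^sup>2 * ?d \<le> K * h\<^sup>2 * (2 * z)" using d2 assms by (intro mult_left_mono) auto
  also have "\<dots> = 2 * (K * h) * (h * z)" by (simp add: power2_eq_square)
  finally have b: "K * h\<^sup>2 * ?d \<le> 2 * (K * h) * (h * z)" .
  have e3: "\<bar>E3 / (h * z)\<bar> \<le> 2 * (K * h)" using E(3) b hz unfolding abs_divide abs_of_pos[OF hz] by (simp add: pos_divide_le_eq)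
  have e2: "\<bar>E2 / (h * z)\<bar> \<le> 2 * (K * h)" using E(2) b hz unfolding abs_divide abs_of_pos[OF hz] by (simp add: pos_divide_le_eq)
  have z': "z' = z * (1 + h * (y/z/2 + E3 / (h * z)))"
    using assms(3) sph(2) by (simp add: E3_def field_simps)
  have y': "y' = z * (y/z + h * (x - 1/2 + E2 / (h * z)))"
    using assms(3) sph(2) by (simp add: E2_def field_simps)
  \<comment> \<open>The first-order terms - h y z and 2 z (h y / 2) cancel, which is energy
    conservation of the flow; only terms of second order in h remain.\<close>
  have dd: "(x' + z'\<^sup>2 - 1) - (x + z\<^sup>2 - 1) = E1 + 2 * (z * E3) + (h * (y/2) + E3)\<^sup>2"
    unfolding E1_def E3_def by (simp add: power2_eq_square algebra_simps)
  have d0: "0 \<le> ?d" "\<bar>y\<bar> \<le> ?d" "\<bar>z\<bar> \<le> ?d" "?d\<^sup>2 = y\<^sup>2 + z\<^sup>2"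
    by (auto simp: real_le_rsqrt)
  have "\<bar>z * E3\<bar> \<le> ?d * (K * h\<^sup>2 * ?d)" unfolding abs_mult using E(3) d0 by (intro mult_mono) auto
  also have "\<dots> = K * h\<^sup>2 * (y\<^sup>2 + z\<^sup>2)" using d0(4) by (simp add: power2_eq_square)
  finally have t2: "\<bar>z * E3\<bar> \<le> K * h\<^sup>2 * (y\<^sup>2 + z\<^sup>2)" .
  have "K * h\<^sup>2 * ?d = (K * h) * (h * ?d)" by (simp add: power2_eq_square)
  also have "\<dots> \<le> 1/2 * (h * ?d)" using assms d0 by (intro mult_right_mono) auto
  finally have "\<bar>E3\<bar> \<le> 1/2 * (h * ?d)" using E by linarith
  moreover have "\<bar>h * (y/2)\<bar> \<le> 1/2 * (h * ?d)" using assms(3) d0 by (simp add: abs_mult)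
  ultimately have "\<bar>h * (y/2) + E3\<bar> \<le> h * ?d" by linarith
  hence "(h * (y/2) + E3)\<^sup>2 \<le> (h * ?d)\<^sup>2" using d0(1) assms(3) by (metis abs_ge_zero power2_abs power_mono)
  also have "\<dots> = 1 * h\<^sup>2 * (y\<^sup>2 + z\<^sup>2)" using d0(4) by (simp add: power_mult_distrib)
  also have "\<dots> \<le> K * h\<^sup>2 * (y\<^sup>2 + z\<^sup>2)" using assms(2) by (intro mult_right_mono) auto
  finally have t3: "(h * (y/2) + E3)\<^sup>2 \<le> K * h\<^sup>2 * (y\<^sup>2 + z\<^sup>2)" .
  have "\<bar>E1 + 2 * (z * E3) + (h * (y/2) + E3)\<^sup>2\<bar> \<le> 4 * (K * h\<^sup>2 * (y\<^sup>2 + z\<^sup>2))"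
    using E(1) t2 t3 zero_le_power2[of "h * (y/2) + E3"] by linarith
  also have "\<dots> \<le> 4 * (K * h\<^sup>2 * (3 * z\<^sup>2))" using y2 assms by (intro mult_left_mono) auto
  finally have "\<bar>(x' + z'\<^sup>2 - 1) - (x + z\<^sup>2 - 1)\<bar> \<le> 12 * K * h\<^sup>2 * z\<^sup>2" using dd by simp
  thus thesis using that[OF z' y' e2 e3] by blast
qed

text \<open>The quotients compared are the one-step growth factors of the two clocks. Their rate is
  h (1/2 + 2 e3 - \<beta>) to first order, and h (1/2 + \<beta> - 2 e3) for the incoming clock, so
  the small errors leave it between h/4 and h.\<close>

lemma clock_ratio:
  fixes q h \<beta> e3 :: real
  assumes "\<bar>q\<bar> \<le> 51/50" "\<bar>e3\<bar> \<le> 1/100" "\<bar>\<beta>\<bar> \<le> 1/10" "0 < h" "h \<le> 1/100"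
  shows "(1 + h/4) * (1 + h * (q - 1/2 + \<beta>)) \<le> (1 + h * (q/2 + e3))\<^sup>2" (is ?A)
    and "(1 + h * (q/2 + e3))\<^sup>2 \<le> (1 + h) * (1 + h * (q - 1/2 + \<beta>))" (is ?B)
    and "(1 + h/4) * (1 + h * (q/2 + e3))\<^sup>2 \<le> 1 + h * (q + 1/2 + \<beta>)" (is ?C)
    and "1 + h * (q + 1/2 + \<beta>) \<le> (1 + h) * (1 + h * (q/2 + e3))\<^sup>2" (is ?D)
proof -
  define a where "a = q/2 + e3"
  have a: "\<bar>a\<bar> \<le> 1" using assms unfolding a_def by linarith
  hence a2: "0 \<le> a\<^sup>2" "a\<^sup>2 \<le> 1" by (auto simp: abs_square_le_1)
  have hh: "- (1/100 * c) \<le> h * t \<and> h * t \<le> 1/100 * c" if "\<bar>t\<bar> \<le> c" for t c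
  proof -
    have "\<bar>h * t\<bar> \<le> 1/100 * c" unfolding abs_mult using that assms by (intro mult_mono) auto
    thus ?thesis by linarith
  qed
  define b where "b = q - 1/2 + \<beta>"
  have b: "\<bar>b\<bar> \<le> 2" "b = q - 1/2 + \<beta>" using assms unfolding b_def by linarith+
  have sq: "(1 + h * a)\<^sup>2 = 1 + h * (2 * a + h * a\<^sup>2)" by (simp add: power2_eq_square algebra_simps)
  have ha: "0 \<le> h * a\<^sup>2" "h * a\<^sup>2 \<le> 1/100" using assms a2 hh[of "a\<^sup>2" 1] by auto
  have a_eq: "2 * a = q + 2 * e3" by (simp add: a_def)
  have "1/4 + b + h * b / 4 \<le> 2 * a + h * a\<^sup>2"
    using hh[OF b(1)] b(2) assms ha a_eq by linarith
  from mult_left_mono[OF this, of h] assms(4)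
  show ?A unfolding a_def[symmetric] sq b_def[symmetric] by (simp add: algebra_simps add_divide_distrib)
  have "2 * a + h * a\<^sup>2 \<le> 1 + b + h * b"
    using hh[OF b(1)] b(2) assms ha a_eq by linarith
  from mult_left_mono[OF this, of h] assms(4)
  show ?B unfolding a_def[symmetric] sq b_def[symmetric] by (simp add: algebra_simps add_divide_distrib)
  define w where "w = 2 * a + h * a\<^sup>2"
  have "\<bar>w\<bar> \<le> 3" using a ha unfolding w_def by linarith
  note t = hh[OF this]
  have "1/4 + w + h * w / 4 \<le> q + 1/2 + \<beta>"
    using t assms ha a_eq w_def by linarith
  from mult_left_mono[OF this, of h] assms(4)
  show ?C unfolding a_def[symmetric] sq w_def[symmetric] by (simp add: algebra_simps add_divide_distrib)
  have "q + 1/2 + \<beta> \<le> 1 + w + h * w"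
    using t assms ha a_eq w_def by linarith
  from mult_left_mono[OF this, of h] assms(4)
  show ?D unfolding a_def[symmetric] sq w_def[symmetric] by (simp add: algebra_simps add_divide_distrib)
qed

text \<open>Here u stands for q or - q. The circle u^2 + z^2 = 1 meets the line z = (10/9) (1 + u)
  at u = - 1 and at u = - 19/181. The hypotheses exclude a neighbourhood of the first point, and the
  bound - 1/5 leaves room for the defect.\<close>

lemma q_lower_bound:
  fixes u z :: real
  assumes "1/2 \<le> 1 + u" "0 < z" "9/10 * z \<le> 1 + u" "97/100 \<le> u\<^sup>2 + z\<^sup>2"
  shows "- (1/5) \<le> u"
proof (rule ccontr)
  assume "\<not> - (1/5) \<le> u"
  hence u: "- (1/2) \<le> u" "u \<le> - (1/5)" using assms by auto
  have "(9/10 * z)\<^sup>2 \<le> (1 + u)\<^sup>2" using assms by (intro power_mono) auto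
  hence "z\<^sup>2 \<le> 100/81 * (1 + u)\<^sup>2" by (simp add: power2_eq_square)
  hence "97/100 \<le> u\<^sup>2 + 100/81 * (1 + u)\<^sup>2" using assms(4) by simp
  also have "(1 + u)\<^sup>2 = 1 + 2 * u + u\<^sup>2" by (simp add: power2_eq_square algebra_simps)
  finally have 1: "97/100 \<le> u\<^sup>2 + 100/81 + 200/81 * u + 100/81 * u\<^sup>2" by (simp add: add_divide_distrib)
  \<comment> \<open>This chord bound replaces u^2 by a linear function on the interval, which makes
    the contradiction linear.\<close>
  have "(u + 1/2) * (u + 1/5) \<le> 0" using u by (intro mult_nonneg_nonpos) auto
  moreover have "(u + 1/2) * (u + 1/5) = u\<^sup>2 + 7/10 * u + 1/10" by (simp add: power2_eq_square algebra_simps)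
  ultimately show False using u 1 by linarith
qed

text \<open>The sign \<sigma> = 1 treats the way out of the saddle and \<sigma> = - 1 the way back,
  where the clock is the reciprocal of z / (1 + \<sigma> q). One step multiplies z by A = 1 + h (q/2
  + e3) and z + \<sigma> y by D = 1 + h (q - \<sigma>/2 + \<beta>), so z / (1 + \<sigma> q) = z^2 /
  (z + \<sigma> y) is multiplied by A^2 / D.\<close>

lemma clock_step:
  fixes x y z \<eta> K h \<sigma> :: real
  assumes st: "euler_step K h x y z x' y' z'" and K: "1 \<le> K" "0 < h" "K * h \<le> 1/1000"
    and sph: "x\<^sup>2 + y\<^sup>2 + z\<^sup>2 = 1" "0 < z" "\<bar>x + z\<^sup>2 - 1\<bar> \<le> \<eta> * z\<^sup>2" "\<eta> \<le> 1/100"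
    and \<sigma>: "\<sigma> = 1 \<or> \<sigma> = - 1"
    and q: "1/2 \<le> 1 + \<sigma> * (y/z)" "9/10 * z \<le> 1 + \<sigma> * (y/z)"
  shows "0 < z'" "1/2 \<le> 1 + \<sigma> * (y'/z')"
    "\<bar>(x' + z'\<^sup>2 - 1) - (x + z\<^sup>2 - 1)\<bar> \<le> 12 * K * h\<^sup>2 * z\<^sup>2"
    "\<sigma> = 1 \<Longrightarrow> z / (1 + y/z) * (1 + h/4) \<le> z' / (1 + y'/z')"
    "\<sigma> = 1 \<Longrightarrow> z' / (1 + y'/z') \<le> z / (1 + y/z) * (1 + h)"
    "\<sigma> = - 1 \<Longrightarrow> (1 - y/z) / z * (1 + h/4) \<le> (1 - y'/z') / z'"
    "\<sigma> = - 1 \<Longrightarrow> (1 - y'/z') / z' \<le> (1 - y/z) / z * (1 + h)"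
proof -
  note sr = sphere_relations[OF sph]
  obtain e2 e3 where e: "z' = z * (1 + h * (y/z/2 + e3))" "y' = z * (y/z + h * (x - 1/2 + e2))"
    "\<bar>e2\<bar> \<le> 2 * (K * h)" "\<bar>e3\<bar> \<le> 2 * (K * h)"
    "\<bar>(x' + z'\<^sup>2 - 1) - (x + z\<^sup>2 - 1)\<bar> \<le> 12 * K * h\<^sup>2 * z\<^sup>2"
    by (rule euler_step_relative[OF st K sph])
  show "\<bar>(x' + z'\<^sup>2 - 1) - (x + z\<^sup>2 - 1)\<bar> \<le> 12 * K * h\<^sup>2 * z\<^sup>2" by (rule e(5))
  have h1: "h \<le> 1/1000" using K by (smt (verit) mult_le_cancel_right1)
  have e23: "\<bar>e2\<bar> \<le> 1/500" "\<bar>e3\<bar> \<le> 1/500" using e(3,4) K(3) by linarith+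
  define q where "q = y/z"
  define a where "a = q/2 + e3"
  define u where "u = \<sigma> * q"
  have uq: "\<bar>u\<bar> = \<bar>q\<bar>" "u\<^sup>2 = q\<^sup>2" using \<sigma> by (auto simp: u_def)
  have qb: "\<bar>q\<bar> \<le> 51/50" "\<bar>q\<^sup>2 - x\<bar> \<le> 2 * \<eta>" "\<bar>q\<^sup>2 + z\<^sup>2 - 1\<bar> \<le> 3 * \<eta>" using sr by (auto simp: q_def)
  have u: "1/2 \<le> 1 + u" "9/10 * z \<le> 1 + u" using assms(10,11) by (auto simp: u_def q_def)
  have z': "z' = z * (1 + h * a)" and y': "y' = z * (q + h * (x - 1/2 + e2))"
    using e by (auto simp: a_def q_def)
  have a1: "\<bar>a\<bar> \<le> 1" using qb e23 unfolding a_def by linarith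
  have hle: "\<bar>h * t\<bar> \<le> 1/1000 * c" if "\<bar>t\<bar> \<le> c" for t c
    unfolding abs_mult using that K h1 by (intro mult_mono) auto
  have pa: "1/2 \<le> 1 + h * a" using hle[OF a1] by linarith
  show zp: "0 < z'" using z' pa sph(2) by simp
  have "97/100 \<le> u\<^sup>2 + z\<^sup>2" using qb sph(4) uq by linarith
  from q_lower_bound[OF u(1) sph(2) u(2) this] have u5: "- (1/5) \<le> u" .
  define s where "s = x - 1/2 + e2"
  have s: "\<bar>s\<bar> \<le> 2" using sr(5) e23 unfolding s_def by linarith
  have "\<bar>\<sigma> * s\<bar> \<le> 2" using s \<sigma> by auto
  hence hs: "\<bar>h * (\<sigma> * s)\<bar> \<le> 1/500" using hle[of "\<sigma> * s" 2] by simp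
  \<comment> \<open>After clearing denominators the claim for the new ratio is z' + 2 \<sigma> y' >=
    0. The margin comes from u >= - 1/5, which is stronger than the inherited u >= - 1/2.\<close>
  have "0 \<le> 1 + h * a + 2 * u + 2 * (h * (\<sigma> * s))" using pa u5 abs_le_D2[OF hs] by linarith
  hence "0 \<le> z * (1 + h * a + 2 * u + 2 * (h * (\<sigma> * s)))" using sph(2) by simp
  hence "0 \<le> z' + 2 * (\<sigma> * y')" unfolding z' y' u_def s_def by (simp add: algebra_simps add_divide_distrib)
  hence "0 \<le> (z' + 2 * (\<sigma> * y')) / z'" using zp by simp
  thus "1/2 \<le> 1 + \<sigma> * (y'/z')" using zp by (simp add: add_divide_distrib mult.commute)
  \<comment> \<open>On the exact curve x = q^2, and the error-free update of z + \<sigma> y factors.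
    The term \<beta> absorbs the deviation x - q^2 and the step errors; dividing by 1 + u at most
    doubles them.\<close>
  define \<beta> where "\<beta> = (\<sigma> * (x - q\<^sup>2) + e3 + \<sigma> * e2) / (1 + u)"
  have "\<bar>\<sigma> * (x - q\<^sup>2) + e3 + \<sigma> * e2\<bar> \<le> 1/40"
  proof -
    have "\<bar>x - q\<^sup>2\<bar> \<le> 1/50" using qb(2) sph(4) by linarith
    hence "\<bar>\<sigma> * (x - q\<^sup>2)\<bar> \<le> 1/50" "\<bar>\<sigma> * e2\<bar> \<le> 1/500" using \<sigma> e23(1) by (auto simp only: abs_mult abs_one abs_minus_cancel mult_1)
    moreover have "\<bar>a + b + c\<bar> \<le> 1/40" if "\<bar>a\<bar> \<le> 1/50" "\<bar>b\<bar> \<le> 1/500" "\<bar>c\<bar> \<le> 1/500" for a b c :: real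
      using that by linarith
    ultimately show ?thesis using e23 by blast
  qed
  hence \<beta>: "\<bar>\<beta>\<bar> \<le> 1/10" unfolding \<beta>_def using u(1)
    by (simp add: abs_mult pos_divide_le_eq)
  have b: "(1 + h * a) + \<sigma> * (q + h * s) = (1 + u) * (1 + h * (q - \<sigma>/2 + \<beta>))"
  proof -
    have "(1 + u) * \<beta> = \<sigma> * (x - q\<^sup>2) + e3 + \<sigma> * e2" using u(1) unfolding \<beta>_def by simp
    moreover have "(1 + u) * (1 + h * (q - \<sigma>/2 + \<beta>)) = (1 + u) + h * ((1 + u) * (q - \<sigma>/2)) + h * ((1 + u) * \<beta>)"
      by (simp add: algebra_simps)
    ultimately have "(1 + u) * (1 + h * (q - \<sigma>/2 + \<beta>)) =
        (1 + u) + h * ((1 + u) * (q - \<sigma>/2)) + h * (\<sigma> * (x - q\<^sup>2) + e3 + \<sigma> * e2)" by simp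
    moreover have "(1 + h * (q/2 + e3)) + \<sigma> * (q + h * (x - 1/2 + e2)) =
        (1 + \<sigma> * q) + h * ((1 + \<sigma> * q) * (q - \<sigma>/2)) + h * (\<sigma> * (x - q\<^sup>2) + e3 + \<sigma> * e2)"
      using \<sigma> by (elim disjE) (simp_all only:, simp_all add: power2_eq_square algebra_simps add_divide_distrib diff_divide_distrib)
    ultimately show ?thesis unfolding u_def a_def s_def by simp
  qed
  have c: "0 < 1 + h * (q - \<sigma>/2 + \<beta>)"
  proof -
    have "\<bar>q - \<sigma>/2 + \<beta>\<bar> \<le> 2" using qb(1) \<beta> \<sigma> by linarith
    from hle[OF this] show ?thesis by linarith
  qed
  define A where "A = 1 + h * a"
  define D where "D = 1 + h * (q - \<sigma>/2 + \<beta>)"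
  have AD: "0 < A" "0 < D" "0 < 1 + u" using pa c u(1) by (auto simp: A_def D_def)
  have yz: "y'/z' = (q + h * s) / A" using sph(2) by (simp add: y' z' s_def A_def)
  have "1 + \<sigma> * (y'/z') = (A + \<sigma> * (q + h * s)) / A" unfolding yz using AD(1) by (simp add: field_simps)
  hence d: "1 + \<sigma> * (y'/z') = (1 + u) * D / A" using b by (simp only: A_def D_def)
  define p where "p = z / (1 + u)"
  have p: "0 < p" using sph(2) u(1) by (simp add: p_def)
  have zA: "z' = z * A" by (simp add: z' A_def)
  have p': "z' / (1 + \<sigma> * (y'/z')) = p * ((1 + h * a)\<^sup>2 / (1 + h * (q - \<sigma>/2 + \<beta>)))"
    unfolding d p_def A_def[symmetric] D_def[symmetric] using AD by (simp add: zA power2_eq_square)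
  have P': "(1 + \<sigma> * (y'/z')) / z' = 1/p * ((1 + h * (q - \<sigma>/2 + \<beta>)) / (1 + h * a)\<^sup>2)"
    unfolding d p_def A_def[symmetric] D_def[symmetric] using AD sph(2) by (simp add: zA power2_eq_square)
  have e31: "\<bar>e3\<bar> \<le> 1/100" and h2: "h \<le> 1/100" using e23 h1 by auto
  note R = clock_ratio[OF qb(1) e31 \<beta> K(2) h2, folded a_def]
  have pa2: "0 < (1 + h * a)\<^sup>2" using pa by auto
  have p1: "0 \<le> 1/p" using p by simp
  { assume s1: "\<sigma> = 1"
    have 1: "1 + h/4 \<le> (1 + h * a)\<^sup>2 / (1 + h * (q - \<sigma>/2 + \<beta>))" using R(1) c s1 by (simp add: pos_le_divide_eq)
    have 2: "(1 + h * a)\<^sup>2 / (1 + h * (q - \<sigma>/2 + \<beta>)) \<le> 1 + h" using R(2) c s1 by (simp add: pos_divide_le_eq)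
    show "z / (1 + y/z) * (1 + h/4) \<le> z' / (1 + y'/z')"
      using mult_left_mono[OF 1, of p] p p' s1 by (simp add: p_def u_def q_def)
    show "z' / (1 + y'/z') \<le> z / (1 + y/z) * (1 + h)"
      using mult_left_mono[OF 2, of p] p p' s1 by (simp add: p_def u_def q_def) }
  { assume s1: "\<sigma> = - 1"
    have 1: "1 + h/4 \<le> (1 + h * (q - \<sigma>/2 + \<beta>)) / (1 + h * a)\<^sup>2" using R(3) pa2 s1 by (simp add: pos_le_divide_eq)
    have 2: "(1 + h * (q - \<sigma>/2 + \<beta>)) / (1 + h * a)\<^sup>2 \<le> 1 + h" using R(4) pa2 s1 by (simp add: pos_divide_le_eq)
    show "(1 - y/z) / z * (1 + h/4) \<le> (1 - y'/z') / z'"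
      using mult_left_mono[OF 1 p1] P' s1 by (simp add: p_def u_def q_def)
    show "(1 - y'/z') / z' \<le> (1 - y/z) / z * (1 + h)"
      using mult_left_mono[OF 2 p1] P' s1 by (simp add: p_def u_def q_def) }
qed

text \<open>Growth by at least 1 + r forces the clock past m, and growth by at most 1 + c limits the
  overshoot of the crossing step. The last conclusion later bounds the number of steps. The start
  may already lie above m, within the same overshoot; then k = 0 serves.\<close>

lemma first_passage:
  fixes p :: "nat \<Rightarrow> real" and m c r :: real
  assumes start: "I 0" "0 < p 0" "p 0 \<le> m * (1 + c)" and "0 < r" "0 \<le> c"
    and step: "\<And>k. I k \<Longrightarrow> 0 < p k \<Longrightarrow> p 0 \<le> p k \<Longrightarrow> p k < m \<Longrightarrow>
      I (Suc k) \<and> p k * (1 + r) \<le> p (Suc k) \<and> p (Suc k) \<le> p k * (1 + c)"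
  shows "\<exists>k. I k \<and> m \<le> p k \<and> p k \<le> m * (1 + c) \<and> p 0 * (1 + r) ^ k \<le> p k"
proof -
  define Q where "Q k \<longleftrightarrow> I k \<and> p k \<le> m * (1 + c) \<and> p 0 * (1 + r) ^ k \<le> p k" for k
  have pos: "p 0 \<le> p k \<and> 0 < p k" if "Q k" for k
  proof -
    have "p 0 * 1 \<le> p 0 * (1 + r) ^ k" using start assms(4) by (intro mult_left_mono) auto
    thus ?thesis using that start unfolding Q_def by linarith
  qed
  have Q_step: "Q (Suc k)" if "Q k" "p k < m" for k
  proof -
    have s: "I (Suc k)" "p k * (1 + r) \<le> p (Suc k)" "p (Suc k) \<le> p k * (1 + c)"
      using step[of k] that pos[OF that(1)] by (auto simp: Q_def)
    have "p 0 * (1 + r) ^ Suc k = (p 0 * (1 + r) ^ k) * (1 + r)" by simp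
    also have "\<dots> \<le> p k * (1 + r)" using that assms(4) by (intro mult_right_mono) (auto simp: Q_def)
    also note s(2)
    finally have "p 0 * (1 + r) ^ Suc k \<le> p (Suc k)" .
    moreover have "p k * (1 + c) \<le> m * (1 + c)" using that assms(5) by (intro mult_right_mono) auto
    ultimately show ?thesis using s by (auto simp: Q_def)
  qed
  have "\<exists>k. Q k \<and> m \<le> p k"
  proof (rule ccontr)
    assume "\<not> ?thesis"
    hence lt: "p k < m" if "Q k" for k using that by force
    have "Q k" for k
    proof (induction k)
      case 0 show ?case using start by (simp add: Q_def)
    next
      case (Suc k) thus ?case using Q_step lt by blast
    qed
    hence "p 0 * (1 + r) ^ k < m" for k using lt[of k] unfolding Q_def by (meson le_less_trans)
    moreover obtain k where "m / p 0 < (1 + r) ^ k"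
      using real_arch_pow[of "1 + r" "m / p 0"] assms(4) by auto
    ultimately show False using start(2) by (metis less_asym mult.commute pos_divide_less_eq)
  qed
  thus ?thesis unfolding Q_def by blast
qed

section \<open>Geometry of the exact curve in terms of its clock\<close>

lemma curve_bounds:
  assumes "0 < p" shows "\<bar>curve_q p\<bar> \<le> 1" "0 \<le> curve_z p" "curve_z p \<le> 1" "(curve_q p)\<^sup>2 + (curve_z p)\<^sup>2 = 1"
proof -
  have p: "0 < 1 + p\<^sup>2" by (smt (verit) zero_le_power2)
  show e: "(curve_q p)\<^sup>2 + (curve_z p)\<^sup>2 = 1"
    unfolding curve_q_def curve_z_def power_divide add_divide_distrib[symmetric]
    using p by (simp add: divide_eq_eq) algebra
  have "(curve_q p)\<^sup>2 \<le> 1" using e zero_le_power2[of "curve_z p"] by linarith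
  thus "\<bar>curve_q p\<bar> \<le> 1" by (simp add: abs_square_le_1)
  show "0 \<le> curve_z p" using assms p by (simp add: curve_z_def)
  have "(curve_z p)\<^sup>2 \<le> 1" using e zero_le_power2[of "curve_q p"] by linarith
  thus "curve_z p \<le> 1" by (simp add: abs_square_le_1)
qed

definition curve_dist :: "real \<Rightarrow> real \<Rightarrow> real \<Rightarrow> real \<Rightarrow> real" where
  "curve_dist p x y z = \<bar>x - (curve_q p)\<^sup>2\<bar> + \<bar>y - curve_q p * curve_z p\<bar> + \<bar>z - curve_z p\<bar>"

text \<open>The comparison point has the same clock p as the given point. Inserting z = p (1 + u)
  into u^2 + z^2 = 1 + \<nu> gives (u - \<open>curve_q p\<close>) (1 + p^2) = \<nu> / (1 + u), and z
  - \<open>curve_z p\<close> is p times u - \<open>curve_q p\<close>. For \<sigma> = - 1 this p is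
  the reciprocal of the incoming clock.\<close>

lemma close_to_curve:
  fixes x y z \<eta> \<sigma> :: real
  assumes sph: "x\<^sup>2 + y\<^sup>2 + z\<^sup>2 = 1" "0 < z" "\<bar>x + z\<^sup>2 - 1\<bar> \<le> \<eta> * z\<^sup>2" "\<eta> \<le> 1/100"
    and \<sigma>: "\<sigma> = 1 \<or> \<sigma> = - 1" and q: "1/2 \<le> 1 + \<sigma> * (y/z)"
    and p: "p = z / (1 + \<sigma> * (y/z))"
  shows "\<bar>x - (curve_q p)\<^sup>2\<bar> + \<bar>y - \<sigma> * (curve_q p * curve_z p)\<bar> + \<bar>z - curve_z p\<bar> \<le> 50 * (\<eta> * p)"
    "z \<le> 2.1 * p" "p \<le> 2 * z" "0 < p"
proof -
  note sr = sphere_relations[OF sph]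
  define u where "u = \<sigma> * (y/z)"
  have u2: "u\<^sup>2 = (y/z)\<^sup>2" "\<bar>u\<bar> = \<bar>y/z\<bar>" using \<sigma> by (auto simp: u_def)
  define \<nu> where "\<nu> = u\<^sup>2 + z\<^sup>2 - 1"
  have \<nu>: "\<bar>\<nu>\<bar> \<le> 3 * \<eta>" using sr u2 by (simp add: \<nu>_def)
  have u: "1/2 \<le> 1 + u" "\<bar>u\<bar> \<le> 51/50" using q u2(2) sr(3) by (simp_all only: u_def)
  have pu: "p = z / (1 + u)" using p by (simp only: u_def)
  have zp: "z = p * (1 + u)" using pu u by simp
  show p0: "0 < p" using pu u sph by simp
  have "p * (1 + u) \<le> p * 2.1" using p0 u by (intro mult_left_mono) auto
  thus z1: "z \<le> 2.1 * p" using zp by simp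
  have "p * (1/2) \<le> p * (1 + u)" using p0 u by (intro mult_left_mono) auto
  thus "p \<le> 2 * z" using zp by simp
  have pp: "1 \<le> 1 + p\<^sup>2" "0 < 1 + p\<^sup>2" by (auto simp: add_pos_nonneg)
  have "(1 + u) * (p\<^sup>2 * (1 + u) + u - 1) = \<nu>" unfolding \<nu>_def zp by (simp add: power2_eq_square algebra_simps)
  hence "p\<^sup>2 * (1 + u) + u - 1 = \<nu> / (1 + u)" using u by (simp add: eq_divide_eq mult.commute)
  moreover have cq: "curve_q p * (1 + p\<^sup>2) = 1 - p\<^sup>2" using pp by (simp add: curve_q_def)
  ultimately have "(u - curve_q p) * (1 + p\<^sup>2) = \<nu> / (1 + u)"
    using cq by (simp add: algebra_simps)
  hence du: "u - curve_q p = (\<nu> / (1 + u)) / (1 + p\<^sup>2)"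
    by (subst nonzero_eq_divide_eq) (use pp in auto)
  have "\<bar>\<nu> / (1 + u)\<bar> = \<bar>\<nu>\<bar> / (1 + u)" using u(1) by simp
  also have "\<dots> \<le> 3 * \<eta> / (1/2)" using \<nu> u(1) sr(4) by (intro frac_le) auto
  finally have "\<bar>\<nu> / (1 + u)\<bar> \<le> 6 * \<eta>" by simp
  moreover have "\<bar>u - curve_q p\<bar> = \<bar>\<nu> / (1 + u)\<bar> / (1 + p\<^sup>2)"
    by (simp only: du abs_divide abs_of_pos[OF pp(2)])
  moreover have "\<bar>\<nu> / (1 + u)\<bar> / (1 + p\<^sup>2) \<le> \<bar>\<nu> / (1 + u)\<bar> / 1" using pp by (intro frac_le) auto
  ultimately have du: "\<bar>u - curve_q p\<bar> \<le> 6 * \<eta>" by linarith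
  have cz: "curve_z p = p * (1 + curve_q p)" unfolding curve_q_def curve_z_def using pp by (simp add: field_simps)
  have dz': "z - curve_z p = p * (u - curve_q p)" unfolding cz by (subst zp) (simp add: algebra_simps)
  have dz: "\<bar>z - curve_z p\<bar> \<le> p * (6 * \<eta>)" unfolding dz' abs_mult using p0 du by (intro mult_mono) auto
  note cb = curve_bounds[OF p0]
  have ep: "0 \<le> \<eta> * p" using sr p0 by simp
  have y: "\<sigma> * y = z * u" using sph(2) by (simp add: u_def)
  have "\<bar>y - \<sigma> * (curve_q p * curve_z p)\<bar> = \<bar>\<sigma> * y - curve_q p * curve_z p\<bar>" using \<sigma> by auto
  also have "\<dots> = \<bar>z * (u - curve_q p) + curve_q p * (z - curve_z p)\<bar>" unfolding y by (simp add: algebra_simps)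
  also have "\<dots> \<le> \<bar>z * (u - curve_q p)\<bar> + \<bar>curve_q p * (z - curve_z p)\<bar>" by (rule abs_triangle_ineq)
  also have "\<dots> \<le> (2.1 * p) * (6 * \<eta>) + 1 * (p * (6 * \<eta>))"
    unfolding abs_mult using z1 du dz cb(1) sph(2) sr(4) p0 by (intro add_mono mult_mono) auto
  finally have dy: "\<bar>y - \<sigma> * (curve_q p * curve_z p)\<bar> \<le> 18.6 * (\<eta> * p)" by (simp add: algebra_simps)
  have "x - (curve_q p)\<^sup>2 = (x + z\<^sup>2 - 1) - (z - curve_z p) * (z + curve_z p)"
    using cb(4) by algebra
  also have "\<bar>\<dots>\<bar> \<le> \<bar>x + z\<^sup>2 - 1\<bar> + \<bar>z - curve_z p\<bar> * \<bar>z + curve_z p\<bar>"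
    unfolding abs_mult[symmetric] by (rule abs_triangle_ineq4)
  also have "\<dots> \<le> \<eta> * z\<^sup>2 + (p * (6 * \<eta>)) * 2"
    using sph(2,3) dz cb(2,3) sr(4,6) p0 by (intro add_mono mult_mono) auto
  also have "\<eta> * z\<^sup>2 \<le> \<eta> * (2.1 * p)"
  proof (rule mult_left_mono)
    have "z * z \<le> z * 1" using sph(2) sr(6) by (intro mult_left_mono) auto
    thus "z\<^sup>2 \<le> 2.1 * p" using z1 by (simp add: power2_eq_square)
  qed (rule sr(4))
  finally have dx: "\<bar>x - (curve_q p)\<^sup>2\<bar> \<le> 14.1 * (\<eta> * p)" by (simp add: algebra_simps)
  show "\<bar>x - (curve_q p)\<^sup>2\<bar> + \<bar>y - \<sigma> * (curve_q p * curve_z p)\<bar> + \<bar>z - curve_z p\<bar> \<le> 50 * (\<eta> * p)"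
    using dx dy dz ep by (simp add: algebra_simps)
qed

text \<open>Exchanging p and 1/p reflects the curve in y; this carries \<open>close_to_curve\<close>
  for \<sigma> = - 1 over to the incoming clock.\<close>

lemma curve_inverse: 
  assumes "0 < p" shows "curve_q (1 / p) = - curve_q p" "curve_z (1 / p) = curve_z p"
proof -
  note p = assms
  have pp: "0 < p\<^sup>2" "0 < 1 + p\<^sup>2" using p by (auto simp: add_pos_nonneg)
  have "curve_q (1 / p) = ((1 - 1 / p\<^sup>2) * p\<^sup>2) / ((1 + 1 / p\<^sup>2) * p\<^sup>2)"
    using pp by (simp add: curve_q_def power_divide)
  also have "\<dots> = (p\<^sup>2 - 1) / (p\<^sup>2 + 1)" using pp by (simp add: algebra_simps)
  also have "\<dots> = - curve_q p" by (simp add: curve_q_def minus_divide_left add.commute)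
  finally show "curve_q (1 / p) = - curve_q p" .
  have "curve_z (1 / p) = (2 * (1 / p) * p\<^sup>2) / ((1 + 1 / p\<^sup>2) * p\<^sup>2)"
    using pp by (simp add: curve_z_def power_divide)
  also have "\<dots> = curve_z p" using pp p by (simp add: curve_z_def algebra_simps power2_eq_square)
  finally show "curve_z (1 / p) = curve_z p" .
qed

text \<open>The differences of \<open>curve_q\<close> and \<open>curve_z\<close> are 2 (p - p')
  times p + p' or p p' - 1, divided by (1 + p^2) (1 + p'^2), and this denominator dominates either
  factor.\<close>

lemma curve_lipschitz:
  assumes "0 < p" "0 < p'"
  shows "curve_dist p ((curve_q p')\<^sup>2) (curve_q p' * curve_z p') (curve_z p') \<le> 16 * \<bar>p - p'\<bar>"
proof -
  note c = curve_bounds[OF assms(1)] note c' = curve_bounds[OF assms(2)]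
  have pp: "0 < 1 + p\<^sup>2" "0 < 1 + p'\<^sup>2" by (auto simp: add_pos_nonneg)
  have h: "\<bar>a / (1 + p\<^sup>2) / (1 + p'\<^sup>2)\<bar> \<le> \<bar>b\<bar>" if "\<bar>a\<bar> \<le> \<bar>b\<bar> * ((1 + p\<^sup>2) * (1 + p'\<^sup>2))" for a b
    using that mult_pos_pos[OF pp] unfolding divide_divide_eq_left abs_divide
    by (simp only: abs_of_pos pos_divide_le_eq)
  have "curve_q p' - curve_q p = (2 * (p - p') * (p + p')) / (1 + p\<^sup>2) / (1 + p'\<^sup>2)"
    unfolding curve_q_def using pp by (simp add: field_simps power2_eq_square)
  also have "\<bar>\<dots>\<bar> \<le> \<bar>2 * (p - p')\<bar>"
  proof (rule h)
    have "p + p' \<le> (1 + p\<^sup>2) * (1 + p'\<^sup>2)"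
    proof -
      have "0 \<le> (p - 1)\<^sup>2 + p\<^sup>2" "0 \<le> (p' - 1)\<^sup>2 + p'\<^sup>2" by auto
      hence "2 * p \<le> 1 + 2 * p\<^sup>2" "2 * p' \<le> 1 + 2 * p'\<^sup>2" by (auto simp: power2_eq_square algebra_simps)
      moreover have "0 \<le> p\<^sup>2 * p'\<^sup>2" by simp
      moreover have "(1 + p\<^sup>2) * (1 + p'\<^sup>2) = 1 + p\<^sup>2 + p'\<^sup>2 + p\<^sup>2 * p'\<^sup>2" by (simp add: algebra_simps)
      ultimately show ?thesis by linarith
    qed
    thus "\<bar>2 * (p - p') * (p + p')\<bar> \<le> \<bar>2 * (p - p')\<bar> * ((1 + p\<^sup>2) * (1 + p'\<^sup>2))"
      unfolding abs_mult[of _ "p + p'"] using assms by (intro mult_left_mono) auto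
  qed
  finally have dq: "\<bar>curve_q p' - curve_q p\<bar> \<le> 2 * \<bar>p - p'\<bar>" by (simp only: abs_mult abs_numeral)
  have "curve_z p' - curve_z p = (2 * (p - p') * (p * p' - 1)) / (1 + p\<^sup>2) / (1 + p'\<^sup>2)"
    unfolding curve_z_def using pp by (simp add: field_simps power2_eq_square)
  also have "\<bar>\<dots>\<bar> \<le> \<bar>2 * (p - p')\<bar>"
  proof (rule h)
    have "\<bar>p * p' - 1\<bar> \<le> (1 + p\<^sup>2) * (1 + p'\<^sup>2)"
    proof -
      have "0 \<le> (p - p')\<^sup>2" by simp
      hence "2 * (p * p') \<le> p\<^sup>2 + p'\<^sup>2" by (simp add: power2_eq_square algebra_simps)
      moreover have "0 \<le> p\<^sup>2 * p'\<^sup>2" "0 < p * p'" using assms by auto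
      moreover have "(1 + p\<^sup>2) * (1 + p'\<^sup>2) = 1 + p\<^sup>2 + p'\<^sup>2 + p\<^sup>2 * p'\<^sup>2" by (simp add: algebra_simps)
      ultimately show ?thesis by linarith
    qed
    thus "\<bar>2 * (p - p') * (p * p' - 1)\<bar> \<le> \<bar>2 * (p - p')\<bar> * ((1 + p\<^sup>2) * (1 + p'\<^sup>2))"
      unfolding abs_mult[of _ "p * p' - 1"] by (intro mult_left_mono) auto
  qed
  finally have dz: "\<bar>curve_z p' - curve_z p\<bar> \<le> 2 * \<bar>p - p'\<bar>" by (simp only: abs_mult abs_numeral)
  have "(curve_q p')\<^sup>2 - (curve_q p)\<^sup>2 = (curve_q p' - curve_q p) * (curve_q p' + curve_q p)"
    by (simp add: power2_eq_square algebra_simps)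
  also have "\<bar>\<dots>\<bar> \<le> (2 * \<bar>p - p'\<bar>) * 2"
    unfolding abs_mult using dq c(1) c'(1) by (intro mult_mono) linarith+
  finally have 1: "\<bar>(curve_q p')\<^sup>2 - (curve_q p)\<^sup>2\<bar> \<le> 4 * \<bar>p - p'\<bar>" by simp
  have "curve_q p' * curve_z p' - curve_q p * curve_z p =
      (curve_q p' - curve_q p) * curve_z p' + curve_q p * (curve_z p' - curve_z p)"
    by (simp add: algebra_simps)
  also have "\<bar>\<dots>\<bar> \<le> \<bar>(curve_q p' - curve_q p) * curve_z p'\<bar> + \<bar>curve_q p * (curve_z p' - curve_z p)\<bar>"
    by (rule abs_triangle_ineq)
  also have "\<dots> \<le> (2 * \<bar>p - p'\<bar>) * 1 + 1 * (2 * \<bar>p - p'\<bar>)"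
    unfolding abs_mult using dq dz c(1) c'(2,3) by (intro add_mono mult_mono) auto
  finally have "\<bar>curve_q p' * curve_z p' - curve_q p * curve_z p\<bar> \<le> 4 * \<bar>p - p'\<bar>" by simp
  from add_mono[OF add_mono[OF 1 this] dz] show ?thesis unfolding curve_dist_def by simp
qed

lemma curve_dist_triangle:
  "curve_dist p x y z \<le> curve_dist p' x y z + curve_dist p ((curve_q p')\<^sup>2) (curve_q p' * curve_z p') (curve_z p')"
proof -
  have *: "\<bar>a - c\<bar> \<le> \<bar>a - b\<bar> + \<bar>b - c\<bar>" for a b c :: real by linarith
  show ?thesis unfolding curve_dist_def
    using add_mono[OF add_mono[OF *[of x "(curve_q p)\<^sup>2" "(curve_q p')\<^sup>2"]
      *[of y "curve_q p * curve_z p" "curve_q p' * curve_z p'"]] *[of z "curve_z p" "curve_z p'"]]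
    by (simp only: ac_simps)
qed

text \<open>Beyond the clock value m both points lie within O(1/m) of the saddle, because
  \<open>curve_z\<close> decays like 2 / p. This permits stopping at a bounded clock when T is
  large.\<close>

lemma curve_dist_far:
  assumes "0 < m" "m \<le> p" "m \<le> p'"
  shows "curve_dist p ((curve_q p')\<^sup>2) (curve_q p' * curve_z p') (curve_z p') \<le> 12 / m"
proof -
  have *: "curve_z a \<le> 2 / m" "(curve_q a)\<^sup>2 = 1 - (curve_z a)\<^sup>2" "\<bar>curve_q a * curve_z a\<bar> \<le> 2 / m"
     "(curve_z a)\<^sup>2 \<le> 2 / m" "0 \<le> curve_z a" "0 \<le> (curve_z a)\<^sup>2" if "m \<le> a" for a
  proof -
    have a: "0 < a" using that assms by simp
    note c = curve_bounds[OF a]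
    have "curve_z a \<le> 2 / a" unfolding curve_z_def using a
      by (simp add: divide_simps add_pos_nonneg power2_eq_square)
    also have "\<dots> \<le> 2 / m" using that assms by (intro divide_left_mono) auto
    finally show 1: "curve_z a \<le> 2 / m" .
    show "(curve_q a)\<^sup>2 = 1 - (curve_z a)\<^sup>2" using c by simp
    have "\<bar>curve_q a\<bar> * \<bar>curve_z a\<bar> \<le> 1 * (2 / m)" using c 1 by (intro mult_mono) auto
    thus "\<bar>curve_q a * curve_z a\<bar> \<le> 2 / m" by (simp add: abs_mult)
    have "curve_z a * curve_z a \<le> 1 * (2 / m)" using c 1 by (intro mult_mono) auto
    thus "(curve_z a)\<^sup>2 \<le> 2 / m" by (simp add: power2_eq_square)
    show "0 \<le> curve_z a" "0 \<le> (curve_z a)\<^sup>2" using c by auto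
  qed
  have d: "\<bar>a - b\<bar> \<le> 4 / m" if "\<bar>a\<bar> \<le> 2 / m" "\<bar>b\<bar> \<le> 2 / m" for a b
    using abs_triangle_ineq4[of a b] that by linarith
  have "\<bar>(curve_q p')\<^sup>2 - (curve_q p)\<^sup>2\<bar> = \<bar>(curve_z p)\<^sup>2 - (curve_z p')\<^sup>2\<bar>"
    unfolding *(2)[OF assms(2)] *(2)[OF assms(3)] by simp
  also have "\<dots> \<le> 4 / m" using *[OF assms(2)] *[OF assms(3)] by (intro d) auto
  finally have "\<bar>(curve_q p')\<^sup>2 - (curve_q p)\<^sup>2\<bar> \<le> 4 / m" .
  moreover have "\<bar>curve_q p' * curve_z p' - curve_q p * curve_z p\<bar> \<le> 4 / m"
    using *(3)[OF assms(2)] *(3)[OF assms(3)] by (intro d) auto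
  moreover have "\<bar>curve_z p' - curve_z p\<bar> \<le> 4 / m"
    using *(1,5)[OF assms(2)] *(1,5)[OF assms(3)] by (intro d) auto
  ultimately show ?thesis unfolding curve_dist_def by simp
qed

section \<open>Orbits of perturbed Euler steps\<close>

locale euler_orbit =
  fixes K h :: real and X Y Z :: "nat \<Rightarrow> real"
  assumes K: "1 \<le> K" and h: "0 < h" and Kh: "K * h \<le> 1/10^8"
    and sphere: "(X k)\<^sup>2 + (Y k)\<^sup>2 + (Z k)\<^sup>2 = 1"
    and step: "euler_step K h (X k) (Y k) (Z k) (X (Suc k)) (Y (Suc k)) (Z (Suc k))"
begin

definition defect :: "nat \<Rightarrow> real" where "defect k = X k + (Z k)\<^sup>2 - 1"
text \<open>On the exact curve both expressions equal p. They differ in where they are stable: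
  \<open>clock_out\<close> while 1 + q is bounded away from 0, \<open>clock_in\<close> while 1 - q
  is.\<close>

definition clock_out :: "nat \<Rightarrow> real" where "clock_out k = Z k / (1 + Y k / Z k)"
definition clock_in :: "nat \<Rightarrow> real" where "clock_in k = (1 - Y k / Z k) / Z k"

text \<open>The defect budget is proportional to the squared clock: as the clock grows
  geometrically, increments of size O(h^2 p^2) add up to O(h p^2).\<close>

definition outgoing :: "nat \<Rightarrow> bool" where
  "outgoing k \<longleftrightarrow> 0 < Z k \<and> 1/2 \<le> 1 + Y k / Z k \<and> \<bar>defect k\<bar> \<le> 120 * (K * h) * (clock_out k)\<^sup>2"
text \<open>The factor 2 - 1 / \<open>clock_in\<close>^2 stays bounded and rises in each step by
  enough to pay for a new defect of order h^2 / \<open>clock_in\<close>^2. It encodes the partial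
  sums of a geometric series.\<close>

definition incoming :: "nat \<Rightarrow> bool" where
  "incoming k \<longleftrightarrow> 0 < Z k \<and> 1/2 \<le> 1 - Y k / Z k \<and> \<bar>defect k\<bar> \<le> 480 * (K * h) * (2 - 1 / (clock_in k)\<^sup>2)"

lemma h_le: "h \<le> K * h" "h \<le> 1/10^8" "0 < K * h" "K * h \<le> 1/1000"
proof -
  show 1: "h \<le> K * h" using K h by simp
  thus "h \<le> 1/10^8" using Kh by linarith
  show "0 < K * h" "K * h \<le> 1/1000" using K h Kh by auto
qed

text \<open>From 1 + q >= 1/2 the clock is at most 2 z, which converts the budget into a defect
  relative to z^2 with \<eta> = 480 K h, however close to the saddle the orbit is.\<close>

lemma outgoing_defect:
  assumes "outgoing k"
  shows "0 < Z k" "1/2 \<le> 1 + 1 * (Y k / Z k)" "\<bar>X k + (Z k)\<^sup>2 - 1\<bar> \<le> 480 * (K * h) * (Z k)\<^sup>2"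
    "480 * (K * h) \<le> 1/100" "Z k = clock_out k * (1 + Y k / Z k)"
proof -
  show o: "0 < Z k" "1/2 \<le> 1 + 1 * (Y k / Z k)" using assms by (auto simp: outgoing_def)
  show "480 * (K * h) \<le> 1/100" using Kh by simp
  have pz: "0 < 1 + Y k / Z k" using o(2) by linarith
  thus z: "Z k = clock_out k * (1 + Y k / Z k)" unfolding clock_out_def by simp
  have "0 < clock_out k" unfolding clock_out_def using o(1) pz by (rule divide_pos_pos)
  hence "clock_out k * (1/2) \<le> clock_out k * (1 + Y k / Z k)" using o by (intro mult_left_mono) auto
  hence "clock_out k \<le> 2 * Z k" using z by simp
  hence "(clock_out k)\<^sup>2 \<le> (2 * Z k)\<^sup>2" using \<open>0 < clock_out k\<close> by (intro power_mono) auto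
  hence "120 * (K * h) * (clock_out k)\<^sup>2 \<le> 120 * (K * h) * (2 * Z k)\<^sup>2" using h_le(3) by (intro mult_left_mono) auto
  thus "\<bar>X k + (Z k)\<^sup>2 - 1\<bar> \<le> 480 * (K * h) * (Z k)\<^sup>2"
    using assms unfolding outgoing_def defect_def by (simp add: power_mult_distrib)
qed

lemma outgoing_step:
  assumes o: "outgoing k" and p1: "clock_out k \<le> 1"
  shows "outgoing (Suc k)" "clock_out k * (1 + h/4) \<le> clock_out (Suc k)"
    "clock_out (Suc k) \<le> clock_out k * (1 + h)"
proof -
  note od = outgoing_defect[OF o]
  note cl = close_to_curve[OF sphere od(1) od(3) od(4) disjI1[OF refl] od(2) , unfolded mult_1, OF clock_out_def]
  have "0 \<le> 1 + Y k / Z k" using od(2) by linarith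
  hence "clock_out k * (1 + Y k / Z k) \<le> 1 * (1 + Y k / Z k)" using p1 by (intro mult_right_mono) auto
  hence "Z k \<le> 1 + 1 * (Y k / Z k)" unfolding od(5)[symmetric] by (simp only: mult_1)
  hence z: "9/10 * Z k \<le> 1 + 1 * (Y k / Z k)" using od(1) by linarith
  note cs = clock_step[OF step K h h_le(4) sphere od(1) od(3) od(4) disjI1[OF refl] od(2) z]
  show 1: "clock_out k * (1 + h/4) \<le> clock_out (Suc k)" "clock_out (Suc k) \<le> clock_out k * (1 + h)"
    using cs(4,5) by (auto simp: clock_out_def)
  have "(Z k)\<^sup>2 \<le> (2.1 * clock_out k)\<^sup>2" using cl(2) od(1) by (intro power_mono) auto
  also have "\<dots> \<le> 5 * (clock_out k)\<^sup>2" by (simp add: power_mult_distrib power2_eq_square)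
  finally have "12 * K * h\<^sup>2 * (Z k)\<^sup>2 \<le> 12 * K * h\<^sup>2 * (5 * (clock_out k)\<^sup>2)" using K by (intro mult_left_mono) auto
  hence "\<bar>defect (Suc k)\<bar> \<le> 120 * (K * h) * (clock_out k)\<^sup>2 + 12 * K * h\<^sup>2 * (5 * (clock_out k)\<^sup>2)"
    using cs(3) o unfolding outgoing_def defect_def by linarith
  \<comment> \<open>The constant 120 is balanced here: the increment 60 K h^2 p^2 is 120 K h p^2
    times h/2, and (1 + h/4)^2 covers 1 + h/2.\<close>
  also have "\<dots> = 120 * (K * h) * ((clock_out k)\<^sup>2 * (1 + h/2))" by (simp add: algebra_simps power2_eq_square)
  also have "\<dots> \<le> 120 * (K * h) * (clock_out k * (1 + h/4))\<^sup>2"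
  proof -
    have "1 + h/2 \<le> (1 + h/4)\<^sup>2" by (simp add: power2_eq_square algebra_simps)
    thus ?thesis unfolding power_mult_distrib using h_le(3) by (intro mult_left_mono) auto
  qed
  also have "\<dots> \<le> 120 * (K * h) * (clock_out (Suc k))\<^sup>2"
    using 1 cl(4) h h_le(3) by (intro mult_left_mono power_mono) auto
  finally show "outgoing (Suc k)" using cs(1,2) unfolding outgoing_def by auto
qed

lemma outgoing_passage:
  assumes "outgoing 0" "0 < clock_out 0" "clock_out 0 \<le> m" "m \<le> 1"
  shows "\<exists>k. outgoing k \<and> m \<le> clock_out k \<and> clock_out k \<le> m * (1 + h) \<and> clock_out 0 * (1 + h/4) ^ k \<le> clock_out k"
proof (rule first_passage)
  have "m * 1 \<le> m * (1 + h)" using assms h by (intro mult_left_mono) auto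
  thus "clock_out 0 \<le> m * (1 + h)" using assms(3) by linarith
qed (use assms h outgoing_step in auto)

text \<open>Since z is at least of order 1 / P with P = \<open>clock_in k\<close>, the bounded
  absolute defect becomes a relative one with \<eta> = 3840 K h P^2. It grows with P, which is why h
  P^2 has to remain small.\<close>

lemma incoming_defect:
  assumes "incoming k"
  shows "0 < Z k" "1/2 \<le> 1 + (- 1) * (Y k / Z k)"
    "\<bar>X k + (Z k)\<^sup>2 - 1\<bar> \<le> 3840 * (K * h) * (clock_in k)\<^sup>2 * (Z k)\<^sup>2"
    "Z k * clock_in k = 1 - Y k / Z k" "0 < clock_in k"
proof -
  show o: "0 < Z k" "1/2 \<le> 1 + (- 1) * (Y k / Z k)" using assms by (auto simp: incoming_def)
  show z: "Z k * clock_in k = 1 - Y k / Z k" unfolding clock_in_def using o by simp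
  show "0 < clock_in k" unfolding clock_in_def using o by (intro divide_pos_pos) auto
  have "(1/2)\<^sup>2 \<le> (Z k * clock_in k)\<^sup>2" using z o by (intro power_mono) auto
  hence 1: "1 \<le> 4 * ((clock_in k)\<^sup>2 * (Z k)\<^sup>2)" by (simp add: power_mult_distrib power2_eq_square ac_simps)
  have "\<bar>defect k\<bar> \<le> 480 * (K * h) * (2 - 1 / (clock_in k)\<^sup>2)" using assms by (auto simp: incoming_def)
  also have "\<dots> \<le> 480 * (K * h) * 2" using h_le(3) by (intro mult_left_mono) auto
  also have "\<dots> = 960 * (K * h) * 1" by simp
  also have "\<dots> \<le> 960 * (K * h) * (4 * ((clock_in k)\<^sup>2 * (Z k)\<^sup>2))" using h_le(3) 1 by (intro mult_left_mono) auto
  finally show "\<bar>X k + (Z k)\<^sup>2 - 1\<bar> \<le> 3840 * (K * h) * (clock_in k)\<^sup>2 * (Z k)\<^sup>2" by (simp add: defect_def mult.assoc)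
qed

text \<open>This is \<open>close_to_curve\<close> at clock 1 / P with \<eta> = 3840 K h P^2, so the
  error is of order K h P.\<close>

lemma incoming_close:
  assumes o: "incoming k" and b: "3840 * (K * h) * (clock_in k)\<^sup>2 \<le> 1/100"
  shows "curve_dist (clock_in k) (X k) (Y k) (Z k) \<le> 192000 * (K * h) * clock_in k"
    "Z k \<le> 2.1 / clock_in k"
proof -
  note od = incoming_defect[OF o]
  have *: "1 / clock_in k = Z k / (1 + (- 1) * (Y k / Z k))" unfolding clock_in_def by simp
  note cl = close_to_curve[OF sphere od(1) od(3) b disjI2[OF refl] od(2) *]
  show "curve_dist (clock_in k) (X k) (Y k) (Z k) \<le> 192000 * (K * h) * clock_in k"
    using cl(1) od(5) unfolding curve_dist_def curve_inverse[OF od(5)] by (simp add: power2_eq_square)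
  show "Z k \<le> 2.1 / clock_in k" using cl(2) by simp
qed

lemma incoming_step:
  assumes o: "incoming k" and b: "3840 * (K * h) * (clock_in k)\<^sup>2 \<le> 1/100" and P: "9/10 \<le> clock_in k"
  shows "incoming (Suc k)" "clock_in k * (1 + h/4) \<le> clock_in (Suc k)"
    "clock_in (Suc k) \<le> clock_in k * (1 + h)"
proof -
  note od = incoming_defect[OF o]
  have "Z k * (9/10) \<le> Z k * clock_in k" using P od(1) by (intro mult_left_mono) auto
  hence z: "9/10 * Z k \<le> 1 + (- 1) * (Y k / Z k)" using od by linarith
  note cs = clock_step[OF step K h h_le(4) sphere od(1) od(3) b disjI2[OF refl] od(2) z]
  show 1: "clock_in k * (1 + h/4) \<le> clock_in (Suc k)" "clock_in (Suc k) \<le> clock_in k * (1 + h)"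
    using cs(6,7) by (auto simp: clock_in_def)
  define a where "a = 1 / (clock_in k)\<^sup>2"
  have a: "0 < a" using od(5) by (simp add: a_def)
  have "(Z k)\<^sup>2 \<le> (2.1 / clock_in k)\<^sup>2" using incoming_close(2)[OF o b] od(1) by (intro power_mono) auto
  also have "\<dots> = 4.41 * a" by (simp add: power_divide a_def power2_eq_square)
  also have "\<dots> \<le> 5 * a" using a by simp
  finally have "12 * K * h\<^sup>2 * (Z k)\<^sup>2 \<le> 12 * K * h\<^sup>2 * (5 * a)" using K by (intro mult_left_mono) auto
  hence "\<bar>defect (Suc k)\<bar> \<le> 480 * (K * h) * (2 - a) + 12 * K * h\<^sup>2 * (5 * a)"
    using cs(3) o unfolding incoming_def defect_def a_def by linarith
  \<comment> \<open>The constant 480 is balanced here: the increment 60 K h^2 a is 480 K h times a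
    h/8, and the growth of the clock lowers a = 1 / P^2 at least by the factor 1 - h/8.\<close>
  also have "\<dots> = 480 * (K * h) * (2 - a * (1 - h/8))" by (simp add: algebra_simps power2_eq_square)
  also have "\<dots> \<le> 480 * (K * h) * (2 - 1 / (clock_in (Suc k))\<^sup>2)"
  proof -
    have "(clock_in k * (1 + h/4))\<^sup>2 \<le> (clock_in (Suc k))\<^sup>2" using 1 od(5) h by (intro power_mono) auto
    hence "1 / (clock_in (Suc k))\<^sup>2 \<le> 1 / (clock_in k * (1 + h/4))\<^sup>2"
      using od(5) h by (intro divide_left_mono mult_pos_pos) auto
    also have "\<dots> = a * (1 / (1 + h/4)\<^sup>2)" by (simp add: a_def power_mult_distrib)
    also have "\<dots> \<le> a * (1 - h/8)"
    proof (rule mult_left_mono)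
      have "1 + h/2 \<le> (1 + h/4)\<^sup>2" by (simp add: power2_eq_square algebra_simps)
      hence "1 / (1 + h/4)\<^sup>2 \<le> 1 / (1 + h/2)" using h by (intro divide_left_mono mult_pos_pos) auto
      also have "\<dots> \<le> 1 - h/8"
      proof -
        have "h * h \<le> h * 1" using h h_le by (intro mult_left_mono) auto
        hence "1 \<le> (1 - h/8) * (1 + h/2)" using h by (simp add: algebra_simps)
        thus ?thesis using h by (subst pos_divide_le_eq) auto
      qed
      finally show "1 / (1 + h/4)\<^sup>2 \<le> 1 - h/8" .
    qed (use a in simp)
    finally show ?thesis using h_le(3) by (intro mult_left_mono) auto
  qed
  finally show "incoming (Suc k)" using cs(1,2) unfolding incoming_def by auto
qed

text \<open>The phases are joined at clock 1, where z is at least 1/2 and both clocks are stable.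
  Their quotient is 1 - \<nu> / z^2 with \<nu> = q^2 + z^2 - 1 of size O(K h), so switching clocks
  costs a factor 1 + O(K h) only once.\<close>

lemma turning_point:
  assumes o: "outgoing k" and p: "1 \<le> clock_out k" "clock_out k \<le> 1 + h"
  shows "incoming k" "1 - 5760 * (K * h) \<le> clock_in k" "clock_in k \<le> 1 + 6000 * (K * h)"
proof -
  note od = outgoing_defect[OF o]
  note sr = sphere_relations[OF sphere od(1,3,4)]
  define q where "q = Y k / Z k"
  define \<nu> where "\<nu> = q\<^sup>2 + (Z k)\<^sup>2 - 1"
  have \<nu>: "\<bar>\<nu>\<bar> \<le> 1440 * (K * h)" using sr(2) by (simp add: \<nu>_def q_def)
  have q: "1/2 \<le> 1 + q" using od by (simp add: q_def)
  have z: "Z k = clock_out k * (1 + q)" using od by (simp add: q_def)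
  have "1 * (1 + q) \<le> Z k" unfolding z using p q by (intro mult_right_mono) auto
  hence zq: "1 + q \<le> Z k" by simp
  hence "(1 + q)\<^sup>2 \<le> (Z k)\<^sup>2" using q by (intro power_mono) auto
  moreover have "(1 + q)\<^sup>2 = 1 + 2 * q + q\<^sup>2" "\<nu> \<le> 1/100"
    using \<nu> Kh by (auto simp: power2_eq_square algebra_simps)
  ultimately have "2 * q + 2 * q\<^sup>2 \<le> 1/100" unfolding \<nu>_def by linarith
  hence q2: "q \<le> 1/2" using zero_le_power2[of q] by linarith
  have z2: "1/4 \<le> (Z k)\<^sup>2" using power_mono[of "1/2" "Z k" 2] zq q by (simp add: power2_eq_square)
  have "\<bar>\<nu> / (Z k)\<^sup>2\<bar> = \<bar>\<nu>\<bar> / (Z k)\<^sup>2" by simp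
  also have "\<dots> \<le> 1440 * (K * h) / (1/4)" using \<nu> z2 h_le by (intro frac_le) auto
  finally have r: "\<bar>\<nu> / (Z k)\<^sup>2\<bar> \<le> 5760 * (K * h)" by simp
  have c: "clock_in k = clock_out k * (1 - \<nu> / (Z k)\<^sup>2)"
  proof -
    have "1 - \<nu> / (Z k)\<^sup>2 = (1 - q) * (1 + q) / (Z k)\<^sup>2" unfolding \<nu>_def using od(1)
      by (simp add: diff_divide_distrib add_divide_distrib power2_eq_square algebra_simps)
    thus ?thesis unfolding clock_in_def clock_out_def q_def[symmetric] using q od(1) by (simp add: power2_eq_square)
  qed
  have r': "1 - 5760 * (K * h) \<le> 1 - \<nu> / (Z k)\<^sup>2" "1 - \<nu> / (Z k)\<^sup>2 \<le> 1 + 5760 * (K * h)" using r by linarith+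
  have "1 * (1 - 5760 * (K * h)) \<le> clock_out k * (1 - \<nu> / (Z k)\<^sup>2)"
    using r' p Kh by (intro mult_mono) auto
  thus lo: "1 - 5760 * (K * h) \<le> clock_in k" using c by simp
  have "clock_out k * (1 - \<nu> / (Z k)\<^sup>2) \<le> (1 + h) * (1 + 5760 * (K * h))"
    using r' p Kh h h_le by (intro mult_mono) auto
  also have "\<dots> = 1 + 5760 * (K * h) + h + h * (5760 * (K * h))" by (simp add: algebra_simps)
  also have "h * (5760 * (K * h)) \<le> 1 * (5760 * (K * h) / 5760)"
    using mult_right_mono[of h "1/5760" "5760 * (K * h)"] h_le by simp
  finally show "clock_in k \<le> 1 + 6000 * (K * h)" using c h_le by simp
  have "(9/10)\<^sup>2 \<le> (clock_in k)\<^sup>2" using lo Kh by (intro power_mono) auto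
  hence "1 / (clock_in k)\<^sup>2 \<le> 1 / (9/10)\<^sup>2" by (intro divide_left_mono mult_pos_pos) (auto simp: power2_eq_square)
  hence "1/2 \<le> 2 - 1 / (clock_in k)\<^sup>2" by (simp add: power2_eq_square)
  \<comment> \<open>The incoming budget starts at 240 K h or more, which covers the outgoing budget
    120 K h p^2 because p^2 is at most 2.\<close>
  hence "480 * (K * h) * (1/2) \<le> 480 * (K * h) * (2 - 1 / (clock_in k)\<^sup>2)" using h_le by (intro mult_left_mono) auto
  moreover have "120 * (K * h) * (clock_out k)\<^sup>2 \<le> 120 * (K * h) * 2"
  proof (rule mult_left_mono)
    have "clock_out k * clock_out k \<le> (1 + h) * (1 + h)" using p by (intro mult_mono) auto
    also have "\<dots> \<le> 1.1 * 1.1" using h h_le by (intro mult_mono) auto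
    finally show "(clock_out k)\<^sup>2 \<le> 2" by (simp add: power2_eq_square)
  qed (use h_le in simp)
  ultimately show "incoming k" using o q2 unfolding incoming_def outgoing_def q_def by linarith
qed

end

text \<open>The overshoot allowance is 6000 K h rather than h, because m may be close to 1 and the
  clock may start above it after the switch.\<close>

lemma (in euler_orbit) incoming_passage:
  assumes i: "incoming k" and P: "9/10 \<le> clock_in k" "clock_in k \<le> 1 + 6000 * (K * h)"
    and m: "1 \<le> m" "3840 * (K * h) * m\<^sup>2 \<le> 1/200"
  shows "\<exists>j. incoming (k + j) \<and> m \<le> clock_in (k + j) \<and> clock_in (k + j) \<le> m * (1 + 6000 * (K * h)) \<and>
    clock_in k * (1 + h/4) ^ j \<le> clock_in (k + j)"
proof -
  have "\<exists>j. incoming (k + j) \<and> m \<le> clock_in (k + j) \<and> clock_in (k + j) \<le> m * (1 + 6000 * (K * h)) \<and>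
    clock_in (k + 0) * (1 + h/4) ^ j \<le> clock_in (k + j)"
  proof (rule first_passage)
    have "1 * (1 + 6000 * (K * h)) \<le> m * (1 + 6000 * (K * h))" using m(1) h_le(3) by (intro mult_right_mono) auto
    hence "1 + 6000 * (K * h) \<le> m * (1 + 6000 * (K * h))" by (simp only: mult_1)
    thus "clock_in (k + 0) \<le> m * (1 + 6000 * (K * h))" using P(2) unfolding add_0_right by (rule order_trans[rotated])
    fix j assume a: "incoming (k + j)" "0 < clock_in (k + j)" "clock_in (k + 0) \<le> clock_in (k + j)" "clock_in (k + j) < m"
    have "3840 * (K * h) * (clock_in (k + j))\<^sup>2 \<le> 3840 * (K * h) * m\<^sup>2"
      using a h_le by (intro mult_left_mono power_mono) auto
    hence b: "3840 * (K * h) * (clock_in (k + j))\<^sup>2 \<le> 1/100" using m by simp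
    have P': "9/10 \<le> clock_in (k + j)" using a P by simp
    note s = incoming_step[OF a(1) b P']
    have "clock_in (k + j) * (1 + h) \<le> clock_in (k + j) * (1 + 6000 * (K * h))"
      using a h_le by (intro mult_left_mono) auto
    thus "incoming (k + Suc j) \<and> clock_in (k + j) * (1 + h/4) \<le> clock_in (k + Suc j) \<and>
      clock_in (k + Suc j) \<le> clock_in (k + j) * (1 + 6000 * (K * h))"
      using s by simp
  qed (use i P h h_le in auto)
  thus ?thesis by simp
qed

text \<open>If m <= 1 the outgoing phase suffices; otherwise the orbit runs to clock 1, switches
  clocks and continues inward. The error is the distance to the curve point with the clock of the
  orbit, plus the effect of the overshoot beyond m.\<close>

lemma (in euler_orbit) orbit_reaches_curve_point:
  assumes init: "X 0 = (curve_q p0)\<^sup>2" "Y 0 = curve_q p0 * curve_z p0" "Z 0 = curve_z p0"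
    and p0: "0 < p0" "p0 < 1" and m: "p0 \<le> m" "K * h * m\<^sup>2 \<le> 1/10^6"
  shows "\<exists>k. p0 * (1 + h/4) ^ k \<le> m * (1 + 20000 * (K * h)) \<and>
    curve_dist m (X k) (Y k) (Z k) \<le> 300000 * (K * h) * (1 + m)"
proof -
  have pp: "0 < 1 + p0\<^sup>2" by (simp add: add_pos_nonneg)
  have q0: "0 \<le> curve_q p0" using p0 pp by (simp add: curve_q_def abs_square_le_1)
  have z0: "0 < curve_z p0" using p0 pp by (simp add: curve_z_def)
  have "curve_z p0 = p0 * (1 + curve_q p0)" unfolding curve_q_def curve_z_def using pp by (simp add: field_simps)
  hence c0: "clock_out 0 = p0" unfolding clock_out_def init using q0 z0 by (simp add: divide_eq_eq)
  have o0: "outgoing 0" unfolding outgoing_def defect_def init using q0 z0 curve_bounds(4)[OF p0(1)] h_le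
    by (simp add: add.commute)
  show ?thesis
  proof (cases "m \<le> 1")
    case True
    obtain k where k: "outgoing k" "m \<le> clock_out k" "clock_out k \<le> m * (1 + h)" "p0 * (1 + h/4) ^ k \<le> clock_out k"
      using outgoing_passage[OF o0] c0 p0 m True by auto
    note od = outgoing_defect[OF k(1)]
    note cl = close_to_curve[OF sphere od(1) od(3) od(4) disjI1[OF refl] od(2), unfolded mult_1, OF clock_out_def]
    have m0: "0 < m" using p0 m by simp
    have mh: "m * h \<le> m * (K * h)" "m * h \<le> h" using m0 h_le h True by auto
    have "clock_out k \<le> 2" using k(3) mh h_le True by (simp add: algebra_simps)
    hence "50 * (480 * (K * h) * clock_out k) \<le> 50 * (480 * (K * h) * 2)"
      using h_le by (intro mult_left_mono) auto
    hence 1: "curve_dist (clock_out k) (X k) (Y k) (Z k) \<le> 48000 * (K * h)"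
      using cl(1) unfolding curve_dist_def by simp
    have "16 * \<bar>m - clock_out k\<bar> \<le> 16 * (K * h)" using k(2,3) mh h_le by (simp add: algebra_simps)
    with 1 curve_lipschitz[OF m0 cl(4)] curve_dist_triangle[of m "X k" "Y k" "Z k" "clock_out k"]
    have "curve_dist m (X k) (Y k) (Z k) \<le> 50000 * (K * h)" using h_le by linarith
    also have "\<dots> \<le> 300000 * (K * h) * (1 + m)"
      using mult_pos_pos[OF h_le(3) m0] h_le(3) unfolding distrib_left by linarith
    finally have "curve_dist m (X k) (Y k) (Z k) \<le> 300000 * (K * h) * (1 + m)" .
    moreover have "m * (1 + h) \<le> m * (1 + 20000 * (K * h))" using m0 h_le by (intro mult_left_mono) auto
    ultimately show ?thesis using k by (meson order_trans)
  next
    case False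
    obtain k where k: "outgoing k" "1 \<le> clock_out k" "clock_out k \<le> 1 + h" "p0 * (1 + h/4) ^ k \<le> clock_out k"
      using outgoing_passage[OF o0, of 1] c0 p0 by auto
    note t = turning_point[OF k(1-3)]
    have P: "9/10 \<le> clock_in k" using t(2) Kh by simp
    have m1: "1 \<le> m" "3840 * (K * h) * m\<^sup>2 \<le> 1/200" using False m by auto
    obtain j where j: "incoming (k + j)" "m \<le> clock_in (k + j)" "clock_in (k + j) \<le> m * (1 + 6000 * (K * h))"
      "clock_in k * (1 + h/4) ^ j \<le> clock_in (k + j)"
      using incoming_passage[OF t(1) P t(3) m1] by blast
    define \<kappa> where "\<kappa> = K * h"
    have \<kappa>: "0 < \<kappa>" "\<kappa> \<le> 1/10^8" "h \<le> \<kappa>" using h_le Kh by (auto simp: \<kappa>_def)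
    have \<kappa>\<kappa>: "\<kappa> * \<kappa> \<le> \<kappa> * (1/10^8)" "0 \<le> \<kappa> * \<kappa>" using \<kappa> by (auto intro: mult_left_mono)
    define P' where "P' = clock_in (k + j)"
    have P': "m \<le> P'" "P' \<le> m * (1 + 6000 * \<kappa>)" using j by (auto simp: P'_def \<kappa>_def)
    have "m * (1 + 6000 * \<kappa>) \<le> m * 1.01" using \<kappa> m1 by (intro mult_left_mono) auto
    hence P'': "P' \<le> m * 1.01" using P' by simp
    hence "P'\<^sup>2 \<le> (m * 1.01)\<^sup>2" using P' m1 by (intro power_mono) auto
    also have "\<dots> \<le> 2 * m\<^sup>2" by (simp add: power_mult_distrib power2_eq_square)
    finally have "3840 * (K * h) * P'\<^sup>2 \<le> 3840 * (K * h) * (2 * m\<^sup>2)" using h_le by (intro mult_left_mono) auto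
    hence b: "3840 * (K * h) * (clock_in (k + j))\<^sup>2 \<le> 1/100" using m1 unfolding P'_def by simp
    have 1: "curve_dist P' (X (k + j)) (Y (k + j)) (Z (k + j)) \<le> 192000 * \<kappa> * P'"
      using incoming_close(1)[OF j(1) b] by (simp add: P'_def \<kappa>_def)
    also have "\<dots> \<le> 192000 * \<kappa> * (m * 1.01)" using P'' \<kappa> by (intro mult_left_mono) auto
    finally have 1: "curve_dist P' (X (k + j)) (Y (k + j)) (Z (k + j)) \<le> 193920 * (\<kappa> * m)" by (simp add: algebra_simps)
    have "16 * \<bar>m - P'\<bar> \<le> 96000 * (\<kappa> * m)" using P' by (simp add: algebra_simps)
    with 1 curve_lipschitz[of m P'] curve_dist_triangle[of m "X (k + j)" "Y (k + j)" "Z (k + j)" P'] P' m1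
    have "curve_dist m (X (k + j)) (Y (k + j)) (Z (k + j)) \<le> 300000 * (\<kappa> * m)"
      using mult_pos_pos[of \<kappa> m] \<kappa> by linarith
    also have "\<dots> \<le> 300000 * \<kappa> * (1 + m)" using \<kappa> by (simp add: algebra_simps)
    finally have A: "curve_dist m (X (k + j)) (Y (k + j)) (Z (k + j)) \<le> 300000 * \<kappa> * (1 + m)" .
    define C where "C = clock_in k"
    have C: "1 - 5760 * \<kappa> \<le> C" "0 < C" using t(2) P by (auto simp: C_def \<kappa>_def)
    \<comment> \<open>The growth bounds of both phases are multiplied. The switch of clocks enters
      through C >= 1 - 5760 \<kappa>, and the constant 20000 pays for it together with both
      overshoots.\<close>
    have "(p0 * (1 + h/4) ^ k) * (C * (1 + h/4) ^ j) \<le> (1 + h) * (m * (1 + 6000 * \<kappa>))"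
      unfolding C_def \<kappa>_def
    proof (rule mult_mono[OF order_trans[OF k(4,3)] order_trans[OF j(4,3)]])
      show "0 \<le> clock_in k * (1 + h/4) ^ j" using C(2) h unfolding C_def by simp
    qed (use h in simp)
    also have "\<dots> = m * ((1 + h) * (1 + 6000 * \<kappa>))" by simp
    also have "\<dots> \<le> m * ((1 + 20000 * \<kappa>) * C)"
    proof (rule mult_left_mono)
      have "(1 + h) * (1 + 6000 * \<kappa>) \<le> (1 + \<kappa>) * (1 + 6000 * \<kappa>)" using \<kappa> by (intro mult_right_mono) auto
      also have "\<dots> = 1 + 6001 * \<kappa> + 6000 * (\<kappa> * \<kappa>)" by (simp add: algebra_simps)
      also have "\<dots> \<le> 1 + 14240 * \<kappa> - 115200000 * (\<kappa> * \<kappa>)" using \<kappa>\<kappa> \<kappa> by simp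
      also have "\<dots> = (1 + 20000 * \<kappa>) * (1 - 5760 * \<kappa>)" by (simp add: algebra_simps)
      also have "\<dots> \<le> (1 + 20000 * \<kappa>) * C" using \<kappa> C by (intro mult_left_mono) auto
      finally show "(1 + h) * (1 + 6000 * \<kappa>) \<le> (1 + 20000 * \<kappa>) * C" .
    qed (use m1 in simp)
    finally have "C * (p0 * (1 + h/4) ^ (k + j)) \<le> C * (m * (1 + 20000 * \<kappa>))"
      by (simp add: power_add algebra_simps)
    hence "p0 * (1 + h/4) ^ (k + j) \<le> m * (1 + 20000 * \<kappa>)" using C(2) by simp
    thus ?thesis using A unfolding \<kappa>_def by blast
  qed
qed

section \<open>Matrices\<close>

lemmas qmat_simps = vec_eq_iff forall_2 sum_2 matrix_matrix_mult_def mscale_def madj_def mat_def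

lemma pauli_nth [simp]:
  "pauli_X $ 1 $ 1 = 0" "pauli_X $ 1 $ 2 = 1" "pauli_X $ 2 $ 1 = 1" "pauli_X $ 2 $ 2 = 0"
  "pauli_Y $ 1 $ 1 = 0" "pauli_Y $ 1 $ 2 = - \<i>" "pauli_Y $ 2 $ 1 = \<i>" "pauli_Y $ 2 $ 2 = 0"
  "pauli_Z $ 1 $ 1 = 1" "pauli_Z $ 1 $ 2 = 0" "pauli_Z $ 2 $ 1 = 0" "pauli_Z $ 2 $ 2 = - 1"
  by (auto simp: pauli_X_def pauli_Y_def pauli_Z_def)

lemma madj_mult: "madj (A ** B) = madj B ** madj A" for A B :: qmat
  by (simp add: qmat_simps algebra_simps)

lemma madj_madj [simp]: "madj (madj A) = A" for A :: qmat
  by (simp add: qmat_simps)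

lemma madj_mat1 [simp]: "madj (mat 1) = (mat 1 :: qmat)"
  by (simp add: qmat_simps)

lemma unitary_mat_mult: "unitary_mat A \<Longrightarrow> unitary_mat B \<Longrightarrow> unitary_mat (A ** B)" for A B :: qmat
  unfolding unitary_mat_def madj_mult by (metis matrix_mul_assoc matrix_mul_lid)

lemma unitary_mat_madj: "unitary_mat A \<Longrightarrow> unitary_mat (madj A)" for A :: qmat
  by (auto simp: unitary_mat_def)

lemma unitary_mat1: "unitary_mat (mat 1 :: qmat)"
  by (simp add: unitary_mat_def)

lemma matrix_add_rdistrib: "(A + B) ** C = A ** C + B ** C" for A B C :: qmat
  by (simp add: qmat_simps algebra_simps)

lemma matrix_diff_distribs: "(A - B) ** C = A ** C - B ** C" "C ** (A - B) = C ** A - C ** B" for A B C :: qmat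
  by (simp_all add: qmat_simps algebra_simps)

lemma matrix_mscale: "(c *\<^sub>m A) ** (d *\<^sub>m B) = (c * d) *\<^sub>m (A ** B)" "(c *\<^sub>m A) ** B = c *\<^sub>m (A ** B)"
     "A ** (d *\<^sub>m B) = d *\<^sub>m (A ** B)" for c d and A B :: qmat
  by (simp_all add: qmat_simps algebra_simps)

lemma mscale_mscale: "c *\<^sub>m d *\<^sub>m A = (c * d) *\<^sub>m A"
  by (simp add: mscale_def vec_eq_iff)

lemma mscale_minus: "c *\<^sub>m (- A) = - (c *\<^sub>m A)"
  by (simp add: mscale_def vec_eq_iff)

lemma qmat_scaleR: "(c *\<^sub>R A) ** B = c *\<^sub>R (A ** B)" "A ** (c *\<^sub>R B) = c *\<^sub>R (A ** B)" for A B :: qmat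
  by (simp_all add: qmat_simps algebra_simps)

section \<open>Exponentials\<close>

lemma linear_mscale_left: "linear (\<lambda>c. c *\<^sub>m P)" for P :: qmat
  by (rule linearI) (auto simp: mscale_def vec_eq_iff algebra_simps)

text \<open>P and 1 - P annihilate each other, so powers act on the two coefficients separately and
  the matrix series splits into two scalar exponential series.\<close>

lemma mexp_projection:
  fixes P :: qmat
  assumes P: "P ** P = P"
  shows "mexp (a *\<^sub>m P + b *\<^sub>m (mat 1 - P)) = exp a *\<^sub>m P + exp b *\<^sub>m (mat 1 - P)"
proof -
  have PP: "(mat 1 - P) ** (mat 1 - P) = mat 1 - P" "P ** (mat 1 - P) = 0" "(mat 1 - P) ** P = 0"
    using P by (auto simp: matrix_diff_distribs)
  have pow: "mpow (a *\<^sub>m P + b *\<^sub>m (mat 1 - P)) n = (a ^ n) *\<^sub>m P + (b ^ n) *\<^sub>m (mat 1 - P)" for n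
  proof (induction n)
    case 0 show ?case by (simp add: qmat_simps)
  next
    case (Suc n)
    have z: "c *\<^sub>m (0 :: qmat) = 0" for c by (simp add: qmat_simps)
    show ?case by (simp add: Suc matrix_add_ldistrib matrix_add_rdistrib matrix_mscale mscale_mscale mult.commute P PP z)
  qed
  have s: "(\<lambda>k. (1 / fact k) *\<^sub>R ((c ^ k) *\<^sub>m Q)) sums (exp c *\<^sub>m Q)" for c and Q :: qmat
  proof -
    have "bounded_linear (\<lambda>c. c *\<^sub>m Q)" using linear_mscale_left by (simp add: linear_conv_bounded_linear)
    from bounded_linear.sums[OF this exp_converges[of c]]
    have "(\<lambda>k. (c ^ k /\<^sub>R fact k) *\<^sub>m Q) sums (exp c *\<^sub>m Q)" .
    moreover have "(c ^ k /\<^sub>R fact k) *\<^sub>m Q = (1 / fact k) *\<^sub>R ((c ^ k) *\<^sub>m Q)" for k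
      by (simp add: mscale_def vec_eq_iff divide_inverse)
    ultimately show ?thesis by simp
  qed
  have "(\<lambda>k. (1 / fact k) *\<^sub>R mpow (a *\<^sub>m P + b *\<^sub>m (mat 1 - P)) k) sums (exp a *\<^sub>m P + exp b *\<^sub>m (mat 1 - P))"
    unfolding pow scaleR_add_right by (intro sums_add s)
  thus ?thesis unfolding mexp_def by (rule sums_unique[symmetric])
qed

text \<open>For a projection P and |w| = 1 this is the unitary with phase w on the range of P and 1
  on its complement. It covers exp (i \<theta> P), with w = cis \<theta>, and the reflection, with w
  = - 1.\<close>

definition spin :: "complex \<Rightarrow> qmat \<Rightarrow> qmat" where
  "spin w P = mat 1 + (w - 1) *\<^sub>m P"

lemma mexp_spin:
  assumes "P ** P = P" shows "mexp ((\<i> * complex_of_real \<theta>) *\<^sub>m P) = spin (cis \<theta>) P"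
proof -
  have "(\<i> * complex_of_real \<theta>) *\<^sub>m P = (\<i> * complex_of_real \<theta>) *\<^sub>m P + 0 *\<^sub>m (mat 1 - P)"
    by (simp add: qmat_simps)
  from arg_cong[OF this, of mexp]
  have "mexp ((\<i> * complex_of_real \<theta>) *\<^sub>m P) = exp (\<i> * complex_of_real \<theta>) *\<^sub>m P + exp 0 *\<^sub>m (mat 1 - P)"
    unfolding mexp_projection[OF assms] .
  also have "\<dots> = spin (cis \<theta>) P"
    unfolding cis_conv_exp by (simp add: spin_def qmat_simps algebra_simps)
  finally show ?thesis .
qed

lemma reflection_spin: "reflection P = spin (- 1) P"
  by (simp add: reflection_def spin_def mscale_def vec_eq_iff scaleR_conv_of_real)

lemma unitary_spin:
  assumes P: "P ** P = P" "madj P = P" and w: "norm w = 1"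
  shows "unitary_mat (spin w P)"
proof -
  have a: "madj (spin w P) = spin (cnj w) P"
    using P(2) by (simp add: spin_def qmat_simps)
  have mul: "spin v P ** spin u P = spin (v * u) P" for v u
    unfolding spin_def by (simp add: matrix_add_ldistrib matrix_add_rdistrib matrix_mscale P) (simp add: qmat_simps algebra_simps)
  have "w * cnj w = 1" using w by (simp add: complex_norm_square[symmetric])
  moreover have "spin 1 P = mat 1" by (simp add: spin_def qmat_simps)
  ultimately show ?thesis unfolding unitary_mat_def a mul by (simp add: mult.commute)
qed

section \<open>Bloch vectors\<close>

definition pauli_vec :: "real^3 \<Rightarrow> qmat" where
  "pauli_vec v = (v $ 1) *\<^sub>R pauli_X + (v $ 2) *\<^sub>R pauli_Y + (v $ 3) *\<^sub>R pauli_Z"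

lemma pauli_vec_minus: "pauli_vec (- v) = - pauli_vec v"
  by (simp add: pauli_vec_def)

definition bloch :: "real^3 \<Rightarrow> qmat" where
  "bloch v = bloch_state (v $ 1) (v $ 2) (v $ 3)"

lemma bloch_pauli: "bloch v = (1/2) *\<^sub>R (mat 1 + pauli_vec v)"
  by (simp add: bloch_def bloch_state_def pauli_vec_def add.assoc)

lemma norm_3: "(norm v)\<^sup>2 = (v $ 1)\<^sup>2 + (v $ 2)\<^sup>2 + (v $ 3)\<^sup>2" for v :: "real^3"
  unfolding power2_norm_eq_inner by (simp add: inner_vec_def sum_3 power2_eq_square)

lemma pauli_vec_mult:
  "pauli_vec u ** pauli_vec v = complex_of_real (u \<bullet> v) *\<^sub>m mat 1 + \<i> *\<^sub>m pauli_vec (cross3 u v)"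
  by (simp add: qmat_simps pauli_vec_def inner_vec_def sum_3 cross3_def complex_eq_iff algebra_simps)

lemma bloch_projection:
  assumes "norm r = 1" shows "bloch r ** bloch r = bloch r" "madj (bloch r) = bloch r"
proof -
  have "r \<bullet> r = 1" using assms by (simp add: norm_eq_1)
  hence "pauli_vec r ** pauli_vec r = mat 1" by (simp add: pauli_vec_mult) (simp add: qmat_simps pauli_vec_def)
  thus "bloch r ** bloch r = bloch r"
    unfolding bloch_pauli
    by (simp add: matrix_add_ldistrib matrix_add_rdistrib qmat_scaleR)
       (metis add.commute scaleR_half_double scaleR_add_right)
  show "madj (bloch r) = bloch r" by (simp add: bloch_pauli pauli_vec_def qmat_simps)
qed

text \<open>Rodrigues' formula: for c = cos \<theta> and s = sin \<theta> this rotates v about the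
  unit vector n by the angle - \<theta>. The half turn is \<open>turn (- 1) 0\<close>.\<close>

definition turn :: "real \<Rightarrow> real \<Rightarrow> real^3 \<Rightarrow> real^3 \<Rightarrow> real^3" where
  "turn c s n v = c *\<^sub>R v - s *\<^sub>R cross3 n v + ((1 - c) * (n \<bullet> v)) *\<^sub>R n"

definition mconj :: "qmat \<Rightarrow> qmat \<Rightarrow> qmat" where
  "mconj U A = U ** A ** madj U"

lemma mconj_mult: "mconj (U ** W) A = mconj U (mconj W A)"
  by (simp add: mconj_def madj_mult matrix_mul_assoc)

text \<open>With P = \<open>bloch n\<close> and V = \<open>pauli_vec v\<close> the conjugation
  expands into V, P V, V P and P V P, and the last product collapses to (n . v) P.\<close>

lemma mconj_spin:
  assumes n: "norm n = 1" and w: "norm w = 1"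
  shows "mconj (spin w (bloch n)) (bloch v) = bloch (turn (Re w) (Im w) n v)"
proof -
  note bp = bloch_projection[OF n]
  have U: "unitary_mat (spin w (bloch n))" by (rule unitary_spin[OF bp w])
  have a: "madj (spin w (bloch n)) = spin (cnj w) (bloch n)"
    using bp(2) by (simp add: spin_def qmat_simps)
  let ?N = "pauli_vec n" and ?V = "pauli_vec v" and ?P = "bloch n"
  have nn: "(n$1)\<^sup>2 + (n$2)\<^sup>2 + (n$3)\<^sup>2 = 1" using n norm_3[of n] by simp
  have 1: "?P ** ?V = (1/2) *\<^sub>R (?V + complex_of_real (n \<bullet> v) *\<^sub>m mat 1 + \<i> *\<^sub>m pauli_vec (cross3 n v))"
    by (simp add: bloch_pauli matrix_add_ldistrib matrix_add_rdistrib qmat_scaleR pauli_vec_mult add.assoc)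
  have 2: "?V ** ?P = (1/2) *\<^sub>R (?V + complex_of_real (n \<bullet> v) *\<^sub>m mat 1 - \<i> *\<^sub>m pauli_vec (cross3 n v))"
    unfolding cross_skew[of n v]
    by (simp add: bloch_pauli matrix_add_ldistrib matrix_add_rdistrib qmat_scaleR pauli_vec_mult inner_commute
       pauli_vec_minus mscale_minus)
  have 3: "?P ** ?V ** ?P = complex_of_real (n \<bullet> v) *\<^sub>m ?P"
  proof -
    have "cross3 (cross3 n v) n = v - (n \<bullet> v) *\<^sub>R n"
      using nn by (simp add: vec_eq_iff forall_3 cross3_def inner_vec_def sum_3) algebra
    hence "pauli_vec (cross3 n v) ** ?N = \<i> *\<^sub>m pauli_vec (v - (n \<bullet> v) *\<^sub>R n)"
      by (simp add: pauli_vec_mult dot_cross_self) (simp add: qmat_simps)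
    note CN = this
    have VN: "?V ** ?N = complex_of_real (n \<bullet> v) *\<^sub>m mat 1 - \<i> *\<^sub>m pauli_vec (cross3 n v)"
      unfolding cross_skew[of n v] pauli_vec_mult by (simp add: inner_commute pauli_vec_minus mscale_minus)
    have "?P ** ?V ** ?P = (1/4) *\<^sub>R (?V + complex_of_real (n \<bullet> v) *\<^sub>m mat 1 + \<i> *\<^sub>m pauli_vec (cross3 n v)
        + (?V ** ?N + complex_of_real (n \<bullet> v) *\<^sub>m ?N + \<i> *\<^sub>m (pauli_vec (cross3 n v) ** ?N)))"
      unfolding 1
      by (simp add: bloch_pauli matrix_add_ldistrib matrix_add_rdistrib qmat_scaleR matrix_mscale scaleR_add_right add_ac)
    also have "\<dots> = complex_of_real (n \<bullet> v) *\<^sub>m ?P"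
      unfolding VN CN
      by (simp add: vec_eq_iff forall_2 mscale_def pauli_vec_def bloch_pauli complex_eq_iff algebra_simps)
    finally show ?thesis .
  qed
  have w2: "(w - 1) * (cnj w - 1) = complex_of_real (2 - 2 * Re w)"
  proof -
    have "w * cnj w = 1" using w by (simp add: complex_norm_square[symmetric])
    thus ?thesis by (simp add: complex_eq_iff algebra_simps)
  qed
  have "mconj (spin w ?P) ?V = ?V + (w - 1) *\<^sub>m (?P ** ?V) + (cnj w - 1) *\<^sub>m (?V ** ?P)
      + ((w - 1) * (cnj w - 1)) *\<^sub>m (?P ** ?V ** ?P)"
    unfolding mconj_def a unfolding spin_def
    by (simp add: matrix_add_ldistrib matrix_add_rdistrib matrix_mscale) (simp add: vec_eq_iff mscale_def algebra_simps)
  also have "\<dots> = pauli_vec (turn (Re w) (Im w) n v)"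
    unfolding w2 3 unfolding 1 2 unfolding turn_def bloch_pauli
    by (simp add: vec_eq_iff forall_2 mscale_def pauli_vec_def mat_def complex_eq_iff algebra_simps)
  finally have "mconj (spin w ?P) ?V = pauli_vec (turn (Re w) (Im w) n v)" .
  moreover have "mconj (spin w ?P) (mat 1) = mat 1" using U by (simp add: mconj_def unitary_mat_def)
  moreover have "mconj A (bloch v) = (1/2) *\<^sub>R (mconj A (mat 1) + mconj A ?V)" for A
    by (simp add: mconj_def bloch_pauli matrix_add_ldistrib matrix_add_rdistrib qmat_scaleR)
  ultimately show ?thesis by (simp add: bloch_pauli)
qed

section \<open>The one-step map on Bloch vectors\<close>

lemma norm_turn:
  assumes "c\<^sup>2 + s\<^sup>2 = 1" "norm n = 1"
  shows "norm (turn c s n v) = norm v"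
proof -
  define m where "m = n \<bullet> v"
  have nn: "n \<bullet> n = 1" using assms(2) by (simp add: norm_eq_1)
  have "(norm (cross3 n v))\<^sup>2 = v \<bullet> v - m\<^sup>2"
    using norm_cross_dot[of n v] assms(2) by (simp add: m_def power2_norm_eq_inner)
  hence x: "cross3 n v \<bullet> cross3 n v = v \<bullet> v - m\<^sup>2" by (simp add: power2_norm_eq_inner)
  have "turn c s n v \<bullet> turn c s n v = c\<^sup>2 * (v \<bullet> v) + s\<^sup>2 * (cross3 n v \<bullet> cross3 n v) + ((1 - c) * m)\<^sup>2 + 2 * c * ((1 - c) * m) * m"
    unfolding turn_def m_def[symmetric]
    by (simp add: inner_add_left inner_add_right inner_diff_left inner_diff_right dot_cross_self nn m_def inner_commute
        power2_eq_square algebra_simps)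
  also have "\<dots> = (c\<^sup>2 + s\<^sup>2) * (v \<bullet> v) + (1 - c\<^sup>2 - s\<^sup>2) * m\<^sup>2" unfolding x by (simp add: power2_eq_square algebra_simps)
  also have "\<dots> = v \<bullet> v" using assms(1) by simp
  finally show ?thesis by (simp add: norm_eq_sqrt_inner)
qed

text \<open>\<open>flip_xy\<close> is conjugation by Z. \<open>flip_yz\<close> is the symmetry that
  exchanges the two candidates, and it fixes \<open>e_x\<close>, the axis of the X rotation.\<close>

definition flip_xy :: "real^3 \<Rightarrow> real^3" where "flip_xy v = vector [- (v $ 1), - (v $ 2), v $ 3]"
definition flip_yz :: "real^3 \<Rightarrow> real^3" where "flip_yz v = vector [v $ 1, - (v $ 2), - (v $ 3)]"
definition e_x :: "real^3" where "e_x = vector [1, 0, 0]"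

lemma flip_nth [simp]:
  "flip_xy v $ 1 = - (v $ 1)" "flip_xy v $ 2 = - (v $ 2)" "flip_xy v $ 3 = v $ 3"
  "flip_yz v $ 1 = v $ 1" "flip_yz v $ 2 = - (v $ 2)" "flip_yz v $ 3 = - (v $ 3)"
  "e_x $ 1 = 1" "e_x $ 2 = 0" "e_x $ 3 = 0"
  by (simp_all add: flip_xy_def flip_yz_def e_x_def)

lemma norm_flip [simp]: "norm (flip_xy v) = norm v" "norm (flip_yz v) = norm v" "norm e_x = 1"
proof -
  have "(norm (flip_xy v))\<^sup>2 = (norm v)\<^sup>2" "(norm (flip_yz v))\<^sup>2 = (norm v)\<^sup>2" by (simp_all add: norm_3)
  thus "norm (flip_xy v) = norm v" "norm (flip_yz v) = norm v" by (auto simp: power2_eq_iff_nonneg)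
  show "norm e_x = 1" by (simp add: norm_eq_sqrt_inner inner_vec_def sum_3)
qed

lemma turn_flip: "turn c s (flip_xy n) (flip_xy v) = flip_xy (turn c s n v)"
  "turn c s (flip_yz n) (flip_yz v) = flip_yz (turn c s n v)"
  by (simp_all add: vec_eq_iff forall_3 turn_def cross3_def inner_vec_def sum_3 algebra_simps)

lemma flip_flip [simp]: "flip_xy (flip_xy v) = v" "flip_xy (flip_yz v) = flip_yz (flip_xy v)" "flip_yz e_x = e_x"
  by (simp_all add: vec_eq_iff forall_3)

lemma mconj_Z: "mconj pauli_Z (bloch v) = bloch (flip_xy v)"
  by (simp add: mconj_def bloch_pauli pauli_vec_def qmat_simps complex_eq_iff)

lemma bloch_e_x: "bloch e_x = (1/2) *\<^sub>R (mat 1 + pauli_X)"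
  by (simp add: bloch_pauli pauli_vec_def)

text \<open>X has eigenvalues 1 and - 1, so its exponential is a \<open>spin\<close> with doubled
  angle up to a global phase, which conjugation removes.\<close>

lemma mexp_X: "mexp ((\<i> * complex_of_real \<theta>) *\<^sub>m pauli_X) = cis (- \<theta>) *\<^sub>m spin (cis (2 * \<theta>)) (bloch e_x)"
proof -
  note P = bloch_projection(1)[of e_x, simplified]
  have "(\<i> * complex_of_real \<theta>) *\<^sub>m pauli_X =
    (\<i> * complex_of_real \<theta>) *\<^sub>m bloch e_x + (- (\<i> * complex_of_real \<theta>)) *\<^sub>m (mat 1 - bloch e_x)"
    by (simp add: bloch_e_x qmat_simps complex_eq_iff)
  from arg_cong[OF this, of mexp]
  have "mexp ((\<i> * complex_of_real \<theta>) *\<^sub>m pauli_X) =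
    exp (\<i> * complex_of_real \<theta>) *\<^sub>m bloch e_x + exp (- (\<i> * complex_of_real \<theta>)) *\<^sub>m (mat 1 - bloch e_x)"
    unfolding mexp_projection[OF P] .
  also have "\<dots> = cis \<theta> *\<^sub>m bloch e_x + cis (- \<theta>) *\<^sub>m (mat 1 - bloch e_x)" by (simp add: cis_conv_exp)
  also have "cis \<theta> = cis (- \<theta>) * cis (2 * \<theta>)" by (simp add: cis_mult)
  also have "(cis (- \<theta>) * cis (2 * \<theta>)) *\<^sub>m bloch e_x + cis (- \<theta>) *\<^sub>m (mat 1 - bloch e_x) =
      cis (- \<theta>) *\<^sub>m spin (cis (2 * \<theta>)) (bloch e_x)"
    by (simp add: spin_def mscale_def vec_eq_iff algebra_simps)
  finally show ?thesis .
qed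

lemma mconj_phase: "norm c = 1 \<Longrightarrow> mconj (c *\<^sub>m U) A = mconj U A"
proof -
  assume "norm c = 1"
  hence "c * cnj c = 1" by (simp add: complex_norm_square[symmetric])
  moreover have "madj (c *\<^sub>m U) = cnj c *\<^sub>m madj U" by (simp add: madj_def mscale_def vec_eq_iff)
  moreover have "1 *\<^sub>m B = B" for B :: qmat by (simp add: mscale_def vec_eq_iff)
  ultimately show ?thesis by (simp add: mconj_def matrix_mscale mscale_mscale mult.commute)
qed

text \<open>A \<rho>-exponential between two Z gates turns about the axis \<open>flip_xy r\<close>.
  All three turns share the angle g t / 2, because the angle g t / 4 in front of X is doubled on the
  Bloch sphere.\<close>

definition bloch_half :: "real \<Rightarrow> real \<Rightarrow> real^3 \<Rightarrow> real^3 \<Rightarrow> real^3" where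
  "bloch_half c s r v = turn c s e_x (turn c s r (turn c s (flip_xy r) v))"

definition bloch_step :: "real \<Rightarrow> real^3 \<Rightarrow> real^3" where
  "bloch_step h r = bloch_half (cos (h/4)) (- sin (h/4)) r (turn (- 1) 0 r
     (bloch_half (cos (h/4)) (sin (h/4)) r (turn (- 1) 0 r r)))"

lemma mconj_A_H:
  assumes r: "norm r = 1"
  shows "mconj (A_H g (bloch r) t) (bloch v) = bloch (bloch_half (cos (g * t / 2)) (sin (g * t / 2)) r v)"
proof -
  note P = bloch_projection(1)[OF r]
  have n: "norm e_x = 1" by simp
  have e: "2 * (g * t / 4) = g * t / 2" by simp
  have "turn c s r (flip_xy v) = flip_xy (turn c s (flip_xy r) v)" for c s v
    using turn_flip(1)[of c s "flip_xy r" v] by simp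
  thus ?thesis
    unfolding A_H_def mconj_mult mexp_X mexp_spin[OF P] e
    by (simp add: mconj_Z mconj_spin[OF r] mconj_spin[OF n] mconj_phase bloch_half_def)
qed

lemma mconj_reflection:
  assumes r: "norm r = 1"
  shows "mconj (reflection (bloch r)) (bloch v) = bloch (turn (- 1) 0 r v)"
  unfolding reflection_spin using mconj_spin[OF r, of "- 1"] by simp

lemma gp_map_bloch:
  assumes "norm r = 1" shows "gp_map g \<tau> (bloch r) = bloch (bloch_step (g * \<tau>) r)"
proof -
  have e: "g * (\<tau> / 2) / 2 = g * \<tau> / 4" "g * (- \<tau> / 2) / 2 = - (g * \<tau> / 4)" by simp_all
  have "gp_map g \<tau> (bloch r) = mconj (V_NLSE g (bloch r) \<tau>) (bloch r)" by (simp add: gp_map_def mconj_def)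
  thus ?thesis
    unfolding V_NLSE_def mconj_mult mconj_A_H[OF assms] mconj_reflection[OF assms] bloch_step_def e by simp
qed

lemma norm_bloch_step: "norm r = 1 \<Longrightarrow> norm (bloch_step h r) = 1"
  by (simp add: bloch_step_def bloch_half_def norm_turn)

text \<open>\<open>flip_yz\<close> is a proper rotation, hence compatible with cross products, and
  it fixes the X axis. The two candidates therefore have orbits that are images of each
  other.\<close>

lemma bloch_step_flip: "bloch_step h (flip_yz r) = flip_yz (bloch_step h r)"
proof -
  have e: "turn c s e_x (flip_yz v) = flip_yz (turn c s e_x v)" for c s v
    using turn_flip(2)[of c s e_x v] by simp
  show ?thesis by (simp add: bloch_step_def bloch_half_def turn_flip e)
qed

section \<open>Expansion of the step\<close>

text \<open>Parity under \<open>flip_yz\<close> makes \<open>x\<close>-components of the error even and the others odd in \<open>(y, z)\<close>.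
  The two size classes below record this: cross products map the first one to the second one.\<close>

definition odd_bound :: "real \<Rightarrow> real \<Rightarrow> real^3 \<Rightarrow> bool" where
  "odd_bound d b v \<longleftrightarrow> \<bar>v $ 1\<bar> \<le> b \<and> \<bar>v $ 2\<bar> \<le> b * d \<and> \<bar>v $ 3\<bar> \<le> b * d"

definition small_bound :: "real \<Rightarrow> real \<Rightarrow> real^3 \<Rightarrow> bool" where
  "small_bound d b v \<longleftrightarrow> \<bar>v $ 1\<bar> \<le> b * d\<^sup>2 \<and> \<bar>v $ 2\<bar> \<le> b * d \<and> \<bar>v $ 3\<bar> \<le> b * d"

lemma small_bound_cross:
  assumes "odd_bound d a n" "odd_bound d b v" "0 \<le> d"
  shows "small_bound d (2 * a * b) (cross3 n v)"
proof -
  have *: "\<bar>x * y - x' * y'\<bar> \<le> 2 * (p * q)" if "\<bar>x\<bar> * \<bar>y\<bar> \<le> p * q" "\<bar>x'\<bar> * \<bar>y'\<bar> \<le> p * q" for x y x' y' p q :: real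
    using that abs_triangle_ineq4[of "x * y" "x' * y'"] by (simp add: abs_mult)
  have a: "\<bar>n $ 1\<bar> \<le> a" "\<bar>n $ 2\<bar> \<le> a * d" "\<bar>n $ 3\<bar> \<le> a * d" and b: "\<bar>v $ 1\<bar> \<le> b" "\<bar>v $ 2\<bar> \<le> b * d" "\<bar>v $ 3\<bar> \<le> b * d"
    using assms by (auto simp: odd_bound_def)
  have ab: "0 \<le> a" "0 \<le> b" "0 \<le> a * d" "0 \<le> b * d" using a b assms(3) by (meson abs_ge_zero order_trans mult_nonneg_nonneg)+
  have 1: "\<bar>n $ 2\<bar> * \<bar>v $ 3\<bar> \<le> (a * d) * (b * d)" "\<bar>n $ 3\<bar> * \<bar>v $ 2\<bar> \<le> (a * d) * (b * d)"
    using a b ab by (auto intro!: mult_mono)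
  have 2: "\<bar>n $ 3\<bar> * \<bar>v $ 1\<bar> \<le> (a * d) * b" "\<bar>n $ 2\<bar> * \<bar>v $ 1\<bar> \<le> (a * d) * b"
    using a b ab by (auto intro!: mult_mono)
  have 3: "\<bar>n $ 1\<bar> * \<bar>v $ 2\<bar> \<le> (a * d) * b" "\<bar>n $ 1\<bar> * \<bar>v $ 3\<bar> \<le> (a * d) * b"
    using mult_mono[OF a(1) b(2)] mult_mono[OF a(1) b(3)] ab by (auto simp: ac_simps)
  have x: "cross3 n v $ 1 = n $ 2 * v $ 3 - n $ 3 * v $ 2" "cross3 n v $ 2 = n $ 3 * v $ 1 - n $ 1 * v $ 3"
    "cross3 n v $ 3 = n $ 1 * v $ 2 - n $ 2 * v $ 1" by (simp_all add: cross3_def)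
  show ?thesis unfolding small_bound_def x
    using *[OF 1(1) 1(2)] *[OF 2(1) 3(2)] *[OF 3(1) 2(2)] by (simp add: power2_eq_square ac_simps)
qed

lemma small_bound_add: "small_bound d a u \<Longrightarrow> small_bound d b v \<Longrightarrow> small_bound d (a + b) (u + v)"
  unfolding small_bound_def distrib_right vector_add_component by (meson abs_triangle_ineq add_mono order_trans)

lemma small_bound_scale: "small_bound d a u \<Longrightarrow> \<bar>c\<bar> \<le> k \<Longrightarrow> small_bound d (k * a) (c *\<^sub>R u)"
proof -
  assume u: "small_bound d a u" and c: "\<bar>c\<bar> \<le> k"
  have "\<bar>c\<bar> * x \<le> k * y" if "0 \<le> x" "x \<le> y" for x y using c that by (intro mult_mono) auto
  thus ?thesis using u by (simp add: small_bound_def abs_mult mult.assoc)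
qed

lemma small_bound_mono: "small_bound d a u \<Longrightarrow> a \<le> b \<Longrightarrow> 0 \<le> d \<Longrightarrow> small_bound d b u"
  unfolding small_bound_def by (meson mult_right_mono order_trans zero_le_power2)

lemma odd_bound_add: "odd_bound d a u \<Longrightarrow> odd_bound d b v \<Longrightarrow> odd_bound d (a + b) (u + v)"
  unfolding odd_bound_def distrib_right vector_add_component by (meson abs_triangle_ineq add_mono order_trans)

lemma small_imp_odd_bound: "small_bound d a u \<Longrightarrow> 0 \<le> a \<Longrightarrow> 0 \<le> d \<Longrightarrow> d \<le> 1 \<Longrightarrow> odd_bound d a u"
  unfolding small_bound_def odd_bound_def
  by (smt (verit, best) mult_left_le power_le_one)

section \<open>First-order expansion of products of turns\<close>

definition expands :: "real \<Rightarrow> real \<Rightarrow> real \<Rightarrow> real^3 \<Rightarrow> real^3 \<Rightarrow> real^3 \<Rightarrow> bool" where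
  "expands d \<alpha> b v r u \<longleftrightarrow> (\<exists>e. small_bound d b e \<and> v = r + \<alpha> *\<^sub>R u + \<alpha>\<^sup>2 *\<^sub>R e)"

text \<open>The axial term is rewritten as a double cross product, so that
  \<open>small_bound_cross\<close> controls both correction terms.\<close>

lemma turn_cross:
  assumes "norm n = 1" shows "turn c s n v = v - s *\<^sub>R cross3 n v + (1 - c) *\<^sub>R cross3 n (cross3 n v)"
proof -
  have nn: "(n$1)\<^sup>2 + (n$2)\<^sup>2 + (n$3)\<^sup>2 = 1" using assms norm_3[of n] by simp
  have cc: "cross3 n (cross3 n v) = (n \<bullet> v) *\<^sub>R n - v"
    using nn by (simp add: vec_eq_iff forall_3 cross3_def inner_vec_def sum_3) algebra
  show ?thesis unfolding turn_def cc by (simp add: algebra_simps)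
qed

text \<open>Each turn adds - \<sigma> n x r to the first-order part. The remainder collects the old
  e, the cross products of n with u, e and v, and the double cross product with v; their bounds sum
  to 9 b + 86.\<close>

lemma expands_turn:
  assumes n: "norm n = 1" "odd_bound d 1 n" and r: "odd_bound d 1 r" and u: "small_bound d 10 u"
    and d: "0 \<le> d" "d \<le> 1" and \<alpha>: "0 < \<alpha>" "\<alpha> \<le> 1" and \<sigma>: "\<bar>\<sigma>\<bar> = 1" and b: "0 \<le> b"
    and v: "expands d \<alpha> b v r u"
  shows "expands d \<alpha> (9 * b + 100) (turn (cos \<alpha>) (\<sigma> * sin \<alpha>) n v) r (u - \<sigma> *\<^sub>R cross3 n r)"
proof -
  obtain e where e: "small_bound d b e" "v = r + \<alpha> *\<^sub>R u + \<alpha>\<^sup>2 *\<^sub>R e" using v unfolding expands_def by blast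
  have a2: "\<alpha>\<^sup>2 \<le> 1" "0 < \<alpha>\<^sup>2" using \<alpha> by (auto simp: power_le_one)
  have v1: "odd_bound d (1 + 1 * 10 + 1 * b) v" unfolding e(2)
    using \<alpha> a2 b d by (intro odd_bound_add r small_imp_odd_bound small_bound_scale u e) auto
  have nv: "small_bound d (2 * 1 * (11 + b)) (cross3 n v)" using small_bound_cross[OF n(2) v1 d(1)] by simp
  hence "odd_bound d (2 * 1 * (11 + b)) (cross3 n v)" using b d by (intro small_imp_odd_bound) auto
  note nnv = small_bound_cross[OF n(2) this d(1)]
  have nu: "small_bound d (2 * 1 * 10) (cross3 n u)" using d by (intro small_bound_cross n small_imp_odd_bound u) auto
  have ne: "small_bound d (2 * 1 * b) (cross3 n e)" using d b by (intro small_bound_cross n small_imp_odd_bound e) auto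
  have "\<bar>sin \<alpha> - (\<Sum>m<2. sin_coeff m * \<alpha> ^ m)\<bar> \<le> inverse (fact 2) * \<bar>\<alpha>\<bar> ^ 2" by (rule Maclaurin_sin_bound)
  hence "\<bar>sin \<alpha> - \<alpha>\<bar> \<le> 1/2 * \<alpha>\<^sup>2" by (simp add: numeral_2_eq_2 sin_coeff_def)
  hence "\<bar>sin \<alpha> - \<alpha>\<bar> \<le> \<alpha>\<^sup>2" using a2 by linarith
  hence s: "\<bar>- (\<sigma> * (sin \<alpha> - \<alpha>) / \<alpha>\<^sup>2)\<bar> \<le> 1" using a2 \<sigma> by (simp add: abs_mult pos_divide_le_eq)
  have "1 - cos \<alpha> = 2 * (sin (\<alpha>/2))\<^sup>2" using cos_double_sin[of "\<alpha>/2"] by simp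
  moreover have "(sin (\<alpha>/2))\<^sup>2 \<le> (\<alpha>/2)\<^sup>2" using abs_sin_x_le_abs_x[of "\<alpha>/2"] by (simp add: abs_le_square_iff[symmetric])
  ultimately have c: "\<bar>(1 - cos \<alpha>) / \<alpha>\<^sup>2\<bar> \<le> 1" using a2 by (simp add: pos_divide_le_eq power2_eq_square)
  define e' where "e' = e + (- \<sigma>) *\<^sub>R cross3 n u + (- (\<sigma> * \<alpha>)) *\<^sub>R cross3 n e + (- (\<sigma> * (sin \<alpha> - \<alpha>) / \<alpha>\<^sup>2)) *\<^sub>R cross3 n v
    + ((1 - cos \<alpha>) / \<alpha>\<^sup>2) *\<^sub>R cross3 n (cross3 n v)"
  have sa: "\<bar>- \<sigma>\<bar> \<le> 1" "\<bar>- (\<sigma> * \<alpha>)\<bar> \<le> 1" using \<sigma> \<alpha> by (auto simp: abs_mult)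
  note add_small = small_bound_add[OF small_bound_add[OF small_bound_add[OF small_bound_add[OF e(1)
    small_bound_scale[OF nu sa(1)]] small_bound_scale[OF ne sa(2)]] small_bound_scale[OF nv s]] small_bound_scale[OF nnv c]]
  have "small_bound d (9 * b + 100) e'"
    unfolding e'_def by (rule small_bound_mono[OF add_small]) (use b d in auto)
  moreover have "turn (cos \<alpha>) (\<sigma> * sin \<alpha>) n v = r + \<alpha> *\<^sub>R (u - \<sigma> *\<^sub>R cross3 n r) + \<alpha>\<^sup>2 *\<^sub>R e'"
  proof -
    have "\<alpha>\<^sup>2 *\<^sub>R e' = \<alpha>\<^sup>2 *\<^sub>R e - (\<alpha>\<^sup>2 * \<sigma>) *\<^sub>R cross3 n u - (\<alpha>\<^sup>2 * \<sigma> * \<alpha>) *\<^sub>R cross3 n e - (\<sigma> * (sin \<alpha> - \<alpha>)) *\<^sub>R cross3 n v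
      + (1 - cos \<alpha>) *\<^sub>R cross3 n (cross3 n v)"
      unfolding e'_def using a2 by (simp add: scaleR_add_right scaleR_diff_right mult.assoc)
    moreover have "cross3 n v = cross3 n r + \<alpha> *\<^sub>R cross3 n u + \<alpha>\<^sup>2 *\<^sub>R cross3 n e"
      by (simp add: e(2) cross_add_right cross_mult_right)
    hence "(\<sigma> * \<alpha>) *\<^sub>R cross3 n v = (\<alpha> * \<sigma>) *\<^sub>R cross3 n r + (\<alpha>\<^sup>2 * \<sigma>) *\<^sub>R cross3 n u + (\<alpha>\<^sup>2 * \<sigma> * \<alpha>) *\<^sub>R cross3 n e"
      by (simp add: scaleR_add_right power2_eq_square ac_simps)
    ultimately show ?thesis unfolding turn_cross[OF n(1)]
      by (simp add: e(2)[symmetric] algebra_simps) (simp add: e(2))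
  qed
  ultimately show ?thesis unfolding expands_def by blast
qed

text \<open>The half turn maps v to - v + 2 (r . v) r. It fixes r and negates u, which is orthogonal
  to r; the remainder is at most b + 2 (3 b).\<close>

lemma expands_half_turn:
  assumes r: "norm r = 1" "odd_bound d 1 r" and u: "r \<bullet> u = 0"
    and d: "0 \<le> d" "d \<le> 1" and b: "0 \<le> b" and v: "expands d \<alpha> b v r u"
  shows "expands d \<alpha> (7 * b) (turn (- 1) 0 r v) r (- u)"
proof -
  obtain e where e: "small_bound d b e" "v = r + \<alpha> *\<^sub>R u + \<alpha>\<^sup>2 *\<^sub>R e" using v unfolding expands_def by blast
  have rr: "r \<bullet> r = 1" using r by (simp add: norm_eq_1)
  define k where "k = r \<bullet> e"
  have "\<bar>k\<bar> \<le> \<bar>r $ 1 * e $ 1\<bar> + \<bar>r $ 2 * e $ 2\<bar> + \<bar>r $ 3 * e $ 3\<bar>"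
    unfolding k_def inner_vec_def sum_3 by simp
  also have "\<dots> \<le> 1 * (b * d\<^sup>2) + d * (b * d) + d * (b * d)"
    unfolding abs_mult using r e d by (intro add_mono mult_mono) (auto simp: odd_bound_def small_bound_def)
  finally have k: "\<bar>k\<bar> \<le> 3 * (b * d\<^sup>2)" by (simp add: power2_eq_square algebra_simps)
  have bd: "0 \<le> b * d\<^sup>2" "0 \<le> b * d" using b d by auto
  have "\<bar>k * r $ 1\<bar> \<le> 3 * (b * d\<^sup>2) * 1" unfolding abs_mult using k r bd by (intro mult_mono) (auto simp: odd_bound_def)
  moreover have "\<bar>k * r $ i\<bar> \<le> 3 * (b * d) * 1" if "\<bar>r $ i\<bar> \<le> d" for i
  proof -
    have "b * d\<^sup>2 = (b * d) * d" by (simp add: power2_eq_square)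
    also have "\<dots> \<le> (b * d) * 1" using d bd by (intro mult_left_mono) auto
    finally have "\<bar>k\<bar> \<le> 3 * (b * d)" using k by simp
    thus ?thesis unfolding abs_mult using that d bd by (intro mult_mono) auto
  qed
  ultimately have s: "small_bound d (3 * b) (k *\<^sub>R r)"
    using r by (auto simp: small_bound_def odd_bound_def mult.assoc)
  have "small_bound d (1 * b + 2 * (3 * b)) ((- 1) *\<^sub>R e + 2 *\<^sub>R (k *\<^sub>R r))"
    by (intro small_bound_add small_bound_scale e s) auto
  hence "small_bound d (7 * b) ((2 * k) *\<^sub>R r - e)" by (simp add: algebra_simps)
  moreover have "turn (- 1) 0 r v = r + \<alpha> *\<^sub>R (- u) + \<alpha>\<^sup>2 *\<^sub>R ((2 * k) *\<^sub>R r - e)"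
    unfolding turn_def e(2) k_def by (simp add: inner_add_right rr u algebra_simps)
       (simp add: scaleR_2 mult_2_right)
  ultimately show ?thesis unfolding expands_def by blast
qed

text \<open>The first A_H contributes - p - q to first order, the following reflection turns this
  into p + q, and A_H with reversed time adds p + q again; turns about r itself contribute nothing.
  The sum 2 \<alpha> (p + q) with \<alpha> = h / 4 is the Euler increment of the Gross--Pitaevskii
  field.\<close>

lemma bloch_step_expansion:
  fixes r :: "real^3"
  assumes r: "norm r = 1" and h: "0 < h" "h \<le> 1"
  defines "d \<equiv> sqrt ((r $ 2)\<^sup>2 + (r $ 3)\<^sup>2)"
  shows "\<bar>bloch_step h r $ 1 - (r $ 1 - h * (r $ 2 * r $ 3))\<bar> \<le> 10^8 * h\<^sup>2 * d\<^sup>2"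
    "\<bar>bloch_step h r $ 2 - (r $ 2 + h * (r $ 3 * (r $ 1 - 1/2)))\<bar> \<le> 10^8 * h\<^sup>2 * d"
    "\<bar>bloch_step h r $ 3 - (r $ 3 + h * (r $ 2 / 2))\<bar> \<le> 10^8 * h\<^sup>2 * d"
proof -
  define \<alpha> where "\<alpha> = h / 4"
  have \<alpha>: "0 < \<alpha>" "\<alpha> \<le> 1" using h by (auto simp: \<alpha>_def)
  have rr: "(r $ 1)\<^sup>2 + (r $ 2)\<^sup>2 + (r $ 3)\<^sup>2 = 1" using r norm_3[of r] by simp
  have r1: "(r $ 1)\<^sup>2 \<le> 1" and r23: "(r $ 2)\<^sup>2 + (r $ 3)\<^sup>2 \<le> 1" using rr zero_le_power2[of "r $ 1"] zero_le_power2[of "r $ 2"] zero_le_power2[of "r $ 3"] by linarith+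
  have d: "0 \<le> d" "d \<le> 1" using r23 by (auto simp: d_def)
  have "\<bar>r $ 1\<bar> \<le> 1" using r1 by (simp add: abs_square_le_1)
  moreover have "\<bar>r $ 2\<bar> \<le> d" "\<bar>r $ 3\<bar> \<le> d" by (auto simp: d_def real_le_rsqrt)
  ultimately have ro: "odd_bound d 1 r" and fo: "odd_bound d 1 (flip_xy r)" by (auto simp: odd_bound_def)
  have eo: "odd_bound d 1 e_x" using d by (simp add: odd_bound_def)
  have fn: "norm (flip_xy r) = 1" and en: "norm e_x = 1" using r by auto
  define p q where "p = cross3 (flip_xy r) r" and "q = cross3 e_x r"
  have pq: "small_bound d 2 p" "small_bound d 2 q"
    using small_bound_cross[OF fo ro d(1)] small_bound_cross[OF eo ro d(1)] by (auto simp: p_def q_def)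
  have m: "small_bound d 10 (a *\<^sub>R p + b *\<^sub>R q)" if "\<bar>a\<bar> \<le> 2" "\<bar>b\<bar> \<le> 2" for a b
    by (rule small_bound_mono[OF small_bound_add[OF small_bound_scale[OF pq(1) that(1)] small_bound_scale[OF pq(2) that(2)]]])
       (use d in auto)
  have dots: "r \<bullet> p = 0" "r \<bullet> q = 0" unfolding p_def q_def by (simp_all add: dot_cross_self)
  note T = expands_turn[OF _ _ ro _ d \<alpha>]
  have "turn (- 1) 0 r r = r" unfolding turn_def using r by (simp add: norm_eq_1 algebra_simps) (simp add: scaleR_2 mult_2_right)
  moreover have "small_bound d 0 (0 :: real^3)" by (simp add: small_bound_def)
  ultimately have 0: "expands d \<alpha> 0 (turn (- 1) 0 r r) r (0 *\<^sub>R p + 0 *\<^sub>R q)"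
    unfolding expands_def by (intro exI[of _ 0]) simp
  \<comment> \<open>The constants follow b -> 9 b + 100 for a turn and b -> 7 b for the half turn,
    starting from 0 since the first reflection fixes r.\<close>
  have 1: "expands d \<alpha> 100 (turn (cos \<alpha>) (sin \<alpha>) (flip_xy r) (turn (- 1) 0 r r)) r ((- 1) *\<^sub>R p + 0 *\<^sub>R q)"
    using T[OF fn fo m _ _ 0, of 1] by (simp add: p_def)
  have 2: "expands d \<alpha> 1000 (turn (cos \<alpha>) (sin \<alpha>) r (turn (cos \<alpha>) (sin \<alpha>) (flip_xy r) (turn (- 1) 0 r r))) r ((- 1) *\<^sub>R p + 0 *\<^sub>R q)"
    using T[OF r ro m _ _ 1, of 1] by simp
  have 3: "expands d \<alpha> 9100 (bloch_half (cos \<alpha>) (sin \<alpha>) r (turn (- 1) 0 r r)) r ((- 1) *\<^sub>R p + (- 1) *\<^sub>R q)"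
    using T[OF en eo m _ _ 2, of 1] by (simp add: bloch_half_def q_def)
  have 4: "expands d \<alpha> 63700 (turn (- 1) 0 r (bloch_half (cos \<alpha>) (sin \<alpha>) r (turn (- 1) 0 r r))) r (1 *\<^sub>R p + 1 *\<^sub>R q)"
    using expands_half_turn[OF r ro _ d _ 3] dots by (simp add: inner_diff_right add.commute)
  have 5: "expands d \<alpha> 573400 (turn (cos \<alpha>) (- sin \<alpha>) (flip_xy r)
      (turn (- 1) 0 r (bloch_half (cos \<alpha>) (sin \<alpha>) r (turn (- 1) 0 r r)))) r (2 *\<^sub>R p + 1 *\<^sub>R q)"
    using T[OF fn fo m _ _ 4, of "- 1"] by (simp add: p_def scaleR_2 add.assoc add.commute add.left_commute)
  have 6: "expands d \<alpha> 5160700 (turn (cos \<alpha>) (- sin \<alpha>) r (turn (cos \<alpha>) (- sin \<alpha>) (flip_xy r)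
      (turn (- 1) 0 r (bloch_half (cos \<alpha>) (sin \<alpha>) r (turn (- 1) 0 r r))))) r (2 *\<^sub>R p + 1 *\<^sub>R q)"
    using T[OF r ro m _ _ 5, of "- 1"] by simp
  have "expands d \<alpha> 46446400 (bloch_step h r) r (2 *\<^sub>R p + 2 *\<^sub>R q)"
    using T[OF en eo m _ _ 6, of "- 1"]
    by (simp add: bloch_step_def bloch_half_def \<alpha>_def q_def scaleR_2 add.assoc)
  then obtain e where e: "small_bound d 46446400 e" "bloch_step h r = r + \<alpha> *\<^sub>R (2 *\<^sub>R p + 2 *\<^sub>R q) + \<alpha>\<^sup>2 *\<^sub>R e"
    unfolding expands_def by blast
  have c: "\<bar>\<alpha>\<^sup>2 * t\<bar> \<le> 10^8 * h\<^sup>2 * y" if "\<bar>t\<bar> \<le> 46446400 * y" for t y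
  proof -
    have "\<bar>\<alpha>\<^sup>2 * t\<bar> \<le> h\<^sup>2 * (46446400 * y)" unfolding abs_mult using that by (intro mult_mono) (auto simp: \<alpha>_def power_divide)
    also have "\<dots> \<le> h\<^sup>2 * (10^8 * y)" using that by (intro mult_left_mono) auto
    finally show ?thesis by simp
  qed
  have x: "bloch_step h r $ 1 - (r $ 1 - h * (r $ 2 * r $ 3)) = \<alpha>\<^sup>2 * e $ 1"
    "bloch_step h r $ 2 - (r $ 2 + h * (r $ 3 * (r $ 1 - 1/2))) = \<alpha>\<^sup>2 * e $ 2"
    "bloch_step h r $ 3 - (r $ 3 + h * (r $ 2 / 2)) = \<alpha>\<^sup>2 * e $ 3"
    unfolding e(2) by (simp_all add: p_def q_def cross3_def \<alpha>_def field_simps)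
  show "\<bar>bloch_step h r $ 1 - (r $ 1 - h * (r $ 2 * r $ 3))\<bar> \<le> 10^8 * h\<^sup>2 * d\<^sup>2"
    "\<bar>bloch_step h r $ 2 - (r $ 2 + h * (r $ 3 * (r $ 1 - 1/2)))\<bar> \<le> 10^8 * h\<^sup>2 * d"
    "\<bar>bloch_step h r $ 3 - (r $ 3 + h * (r $ 2 / 2))\<bar> \<le> 10^8 * h\<^sup>2 * d"
    unfolding x using e(1) by (auto simp only: small_bound_def intro!: c)
qed

section \<open>Circuits\<close>

lemma circuit_op_after_gate: "circuit_op (after_gate V C) U = circuit_op C U ** V"
  by (cases C) (simp_all add: matrix_mul_assoc)

lemma circuit_op_seq: "circuit_op (C \<then> D) U = circuit_op D U ** circuit_op C U"
  by (induction C) (simp_all add: circuit_op_after_gate matrix_mul_assoc)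

lemma query_op_flip: "query_op U (flip_query d) = madj (query_op U d)"
  by (cases d) simp_all

lemma circuit_op_inv: "circuit_op (circuit_inv C) U = madj (circuit_op C U)"
  by (induction C) (simp_all add: circuit_op_seq query_op_flip madj_mult matrix_mul_assoc)

lemma unitary_gates_after_gate: "unitary_mat V \<Longrightarrow> unitary_gates C \<Longrightarrow> unitary_gates (after_gate V C)"
  by (cases C) (simp_all add: unitary_mat_mult)

lemma unitary_gates_seq: "unitary_gates C \<Longrightarrow> unitary_gates D \<Longrightarrow> unitary_gates (C \<then> D)"
  by (induction C) (simp_all add: unitary_gates_after_gate)

lemma unitary_gates_inv: "unitary_gates C \<Longrightarrow> unitary_gates (circuit_inv C)"
  by (induction C) (simp_all add: unitary_gates_seq unitary_mat_madj unitary_mat1)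

lemma query_count_after_gate: "query_count (after_gate V C) = query_count C"
  by (cases C) simp_all

lemma query_count_seq: "query_count (C \<then> D) = query_count C + query_count D"
  by (induction C) (simp_all add: query_count_after_gate)

lemma query_count_inv: "query_count (circuit_inv C) = query_count C"
  by (induction C) (simp_all add: query_count_seq)

section \<open>Correctness of the recursive circuits\<close>

lemma prepared_state_mconj: "prepared_state U = mconj U (dyad ket0)"
  by (simp add: prepared_state_def mconj_def)

lemma dyad_ket0: "dyad ket0 ** dyad ket0 = dyad ket0" "madj (dyad ket0) = dyad ket0"
  by (simp_all add: qmat_simps dyad_def ket0_def)

lemma circuit_op_conj: "circuit_op (conj_circuit G C) U = mconj (circuit_op C U) G"
  by (simp add: conj_circuit_def circuit_op_seq circuit_op_inv circuit_op_after_gate mconj_def matrix_mul_assoc)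

text \<open>This is why conjugating a fixed gate by the current circuit yields the exponential or
  reflection of the state which that circuit prepares.\<close>

lemma mconj_unitary_spin:
  assumes "unitary_mat U" shows "mconj U (spin w P) = spin w (mconj U P)"
  using assms by (simp add: mconj_def spin_def unitary_mat_def matrix_add_ldistrib matrix_add_rdistrib matrix_mscale)

lemma mconj_projection:
  assumes U: "unitary_mat U" and P: "P ** P = P" shows "mconj U P ** mconj U P = mconj U P"
proof -
  have "mconj U P ** mconj U P = U ** (P ** (madj U ** U) ** P) ** madj U"
    by (simp add: mconj_def matrix_mul_assoc)
  thus ?thesis using U P by (simp add: unitary_mat_def mconj_def)
qed

lemma circuit_op_exp:
  assumes "unitary_mat (circuit_op C U)"
  shows "circuit_op (exp_circuit \<theta> C) U = mexp ((\<i> * complex_of_real \<theta>) *\<^sub>m prepared_state (circuit_op C U))"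
  unfolding exp_circuit_def circuit_op_conj prepared_state_mconj mexp_spin[OF dyad_ket0(1)]
    mexp_spin[OF mconj_projection[OF assms dyad_ket0(1)]] mconj_unitary_spin[OF assms] ..

lemma circuit_op_reflection:
  assumes "unitary_mat (circuit_op C U)"
  shows "circuit_op (reflection_circuit C) U = reflection (prepared_state (circuit_op C U))"
  unfolding reflection_circuit_def circuit_op_conj prepared_state_mconj reflection_spin mconj_unitary_spin[OF assms] ..

lemma circuit_op_A_H:
  assumes "unitary_mat (circuit_op C U)"
  shows "circuit_op (A_H_circuit g t C) U = A_H g (prepared_state (circuit_op C U)) t"
  by (simp add: A_H_circuit_def A_H_def circuit_op_seq circuit_op_after_gate circuit_op_exp[OF assms] matrix_mul_assoc)

lemma circuit_op_gp_step:
  assumes "unitary_mat (circuit_op C U)"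
  shows "circuit_op (gp_step_circuit g \<tau> C) U = V_NLSE g (prepared_state (circuit_op C U)) \<tau> ** circuit_op C U"
  by (simp add: gp_step_circuit_def V_NLSE_def circuit_op_seq circuit_op_reflection[OF assms] circuit_op_A_H[OF assms] matrix_mul_assoc)

lemma unitary_circuit_op: "unitary_gates C \<Longrightarrow> unitary_mat U \<Longrightarrow> unitary_mat (circuit_op C U)"
proof (induction C)
  case (Call W d C)
  have "unitary_mat (query_op U d)" using Call by (cases d) (simp_all add: unitary_mat_madj)
  thus ?case using Call by (simp add: unitary_mat_mult)
qed simp

lemma unitary_mat_mscale: "norm c = 1 \<Longrightarrow> unitary_mat U \<Longrightarrow> unitary_mat (c *\<^sub>m U)" for U :: qmat
proof -
  assume "norm c = 1" and U: "unitary_mat U"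
  hence "c * cnj c = 1" by (simp add: complex_norm_square[symmetric])
  moreover have "madj (c *\<^sub>m U) = cnj c *\<^sub>m madj U" by (simp add: madj_def mscale_def vec_eq_iff)
  moreover have "1 *\<^sub>m B = B" for B :: qmat by (simp add: mscale_def vec_eq_iff)
  ultimately show ?thesis using U by (simp add: unitary_mat_def matrix_mscale mscale_mscale mult.commute)
qed

lemma unitary_gates_gp_step:
  assumes C: "unitary_gates C" shows "unitary_gates (gp_step_circuit g \<tau> C)"
proof -
  have conj: "unitary_gates (conj_circuit G C)" if "unitary_mat G" for G
    using C that by (simp add: conj_circuit_def unitary_gates_seq unitary_gates_inv unitary_gates_after_gate)
  have e: "unitary_gates (exp_circuit \<theta> C)" for \<theta>
    unfolding exp_circuit_def mexp_spin[OF dyad_ket0(1)] by (intro conj unitary_spin dyad_ket0) simp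
  have r: "unitary_gates (reflection_circuit C)"
    unfolding reflection_circuit_def reflection_spin by (intro conj unitary_spin dyad_ket0) simp
  have "unitary_mat (mexp ((\<i> * complex_of_real \<theta>) *\<^sub>m pauli_X))" for \<theta>
    unfolding mexp_X by (intro unitary_mat_mscale unitary_spin bloch_projection) simp_all
  moreover have "unitary_mat pauli_Z" by (simp add: unitary_mat_def qmat_simps)
  ultimately have a: "unitary_gates (A_H_circuit g t C)" for t
    unfolding A_H_circuit_def by (intro unitary_gates_seq e) (simp_all only: unitary_gates.simps)
  show ?thesis unfolding gp_step_circuit_def by (intro unitary_gates_seq C r a)
qed

text \<open>One step runs the circuit once to prepare the state, twice for each of two reflections
  and twice for each of four exponentials: 1 + 4 + 8 = 13.\<close>

lemma query_count_gp_step: "query_count (gp_step_circuit g \<tau> C) = 13 * query_count C"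
  by (simp add: gp_step_circuit_def A_H_circuit_def reflection_circuit_def exp_circuit_def conj_circuit_def
      query_count_seq query_count_inv query_count_after_gate)

lemma query_count_gp_circuit: "query_count (gp_circuit g \<tau> n) = 13 ^ n"
  by (induction n) (simp_all add: gp_circuit_def query_count_gp_step)

lemma unitary_gates_gp_circuit: "unitary_gates (gp_circuit g \<tau> n)"
  by (induction n) (simp_all add: gp_circuit_def unitary_gates_gp_step unitary_mat1)

lemma implements_gp_circuit: "implements_gp_iteration g \<tau> n (gp_circuit g \<tau> n)"
  unfolding implements_gp_iteration_def
proof (intro conjI refl allI impI)
  fix U :: qmat assume U: "unitary_mat U"
  have un: "unitary_mat (circuit_op (gp_circuit g \<tau> k) U)" for k
    by (intro unitary_circuit_op unitary_gates_gp_circuit U)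
  have s: "gp_circuit g \<tau> (Suc k) = gp_step_circuit g \<tau> (gp_circuit g \<tau> k)" for k by (simp add: gp_circuit_def)
  show op: "circuit_op (gp_circuit g \<tau> n) U = gp_unitary g \<tau> U n"
  proof (induction n)
    case 0 show ?case by (simp add: gp_circuit_def)
  next
    case (Suc n) thus ?case unfolding s circuit_op_gp_step[OF un] by simp
  qed
  have "prepared_state (gp_unitary g \<tau> U n) = (gp_map g \<tau> ^^ n) (prepared_state U)"
    by (induction n) (simp_all add: prepared_state_mconj mconj_mult gp_map_def mconj_def[symmetric])
  thus "prepared_state (circuit_op (gp_circuit g \<tau> n) U) = (gp_map g \<tau> ^^ n) (prepared_state U)" by (simp only: op)
qed

section \<open>Trace distance\<close>

text \<open>The point is uniqueness, as \<open>msqrt\<close> is a definite description. If B is a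
  positive root of k^2, then w = B v - k v satisfies B w = - k w, and positivity forces w = 0 when k
  > 0. For k = 0 the diagonal of B B = 0 kills every entry of the Hermitian B.\<close>

lemma msqrt_scalar:
  assumes k: "0 \<le> k" shows "msqrt (complex_of_real (k\<^sup>2) *\<^sub>m (mat 1 :: qmat)) = complex_of_real k *\<^sub>m mat 1"
proof -
  have kI: "(complex_of_real c *\<^sub>m mat 1 :: qmat) *v v = complex_of_real c *s v" for c v
    by (simp add: mscale_def mat_def matrix_vector_mult_def vec_eq_iff forall_2 sum_2)
  show ?thesis unfolding msqrt_def
  proof (rule the_equality)
    show "psd_mat (complex_of_real k *\<^sub>m mat 1 :: qmat) \<and>
        (complex_of_real k *\<^sub>m mat 1 :: qmat) ** complex_of_real k *\<^sub>m mat 1 = complex_of_real (k\<^sup>2) *\<^sub>m mat 1"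
    proof
      have "Re (\<Sum>i\<in>UNIV. cnj (v $ i) * (complex_of_real k *\<^sub>m mat 1 *v v) $ i) = k * ((cmod (v $ 1))\<^sup>2 + (cmod (v $ 2))\<^sup>2)" for v :: qvec
        unfolding kI sum_2 cmod_power2 by (simp add: power2_eq_square algebra_simps)
      thus "psd_mat (complex_of_real k *\<^sub>m mat 1 :: qmat)"
        unfolding psd_mat_def using k by (simp add: qmat_simps)
    qed (simp add: matrix_mscale mscale_mscale power2_eq_square)
  next
    fix B :: qmat assume B: "psd_mat B \<and> B ** B = complex_of_real (k\<^sup>2) *\<^sub>m mat 1"
    have h: "madj B = B" and pos: "0 \<le> Re (\<Sum>i\<in>UNIV. cnj (v $ i) * (B *v v) $ i)" for v
      using B by (auto simp: psd_mat_def)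
    show "B = complex_of_real k *\<^sub>m mat 1"
    proof (cases "k = 0")
      case True
      have "(B ** B) $ i $ i = complex_of_real ((cmod (B $ i $ 1))\<^sup>2 + (cmod (B $ i $ 2))\<^sup>2)" for i
      proof -
        have "B $ 1 $ i = cnj (B $ i $ 1)" "B $ 2 $ i = cnj (B $ i $ 2)"
          using arg_cong[OF h, of "\<lambda>A. A $ 1 $ i"] arg_cong[OF h, of "\<lambda>A. A $ 2 $ i"] by (simp_all add: madj_def)
        thus ?thesis by (simp add: matrix_matrix_mult_def sum_2 complex_norm_square[symmetric])
      qed
      moreover have "(B ** B) $ i $ i = 0" for i using B True by (simp add: mscale_def)
      ultimately have "(cmod (B $ i $ 1))\<^sup>2 + (cmod (B $ i $ 2))\<^sup>2 = 0" for i by (metis of_real_eq_0_iff)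
      hence "B $ i $ 1 = 0 \<and> B $ i $ 2 = 0" for i by (simp add: sum_power2_eq_zero_iff)
      thus ?thesis using True by (simp add: vec_eq_iff forall_2 mscale_def)
    next
      case False
      have "B *v v = (complex_of_real k *\<^sub>m mat 1) *v v" for v
      proof -
        define w where "w = B *v v - complex_of_real k *s v"
        have BB: "B *v (B *v v) = complex_of_real (k\<^sup>2) *s v"
          using B by (simp add: matrix_vector_mul_assoc kI del: of_real_power)
        have "B *v w = B *v (B *v v) - complex_of_real k *s (B *v v)"
          by (simp add: w_def matrix_vector_mult_def vec_eq_iff sum_2 algebra_simps)
        hence Bw: "B *v w = (- complex_of_real k) *s w" unfolding BB
          by (simp add: w_def vec_eq_iff power2_eq_square algebra_simps)
        have "Re (\<Sum>i\<in>UNIV. cnj (w $ i) * (B *v w) $ i) = - k * ((cmod (w $ 1))\<^sup>2 + (cmod (w $ 2))\<^sup>2)"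
          unfolding Bw sum_2 cmod_power2 by (simp add: power2_eq_square algebra_simps)
        hence "k * ((cmod (w $ 1))\<^sup>2 + (cmod (w $ 2))\<^sup>2) \<le> 0" using pos[of w] by simp
        hence "(cmod (w $ 1))\<^sup>2 + (cmod (w $ 2))\<^sup>2 \<le> 0" using k False by (simp add: mult_le_0_iff)
        hence "w = 0" by (simp add: sum_power2_le_zero_iff vec_eq_iff forall_2)
        thus ?thesis by (simp add: w_def kI)
      qed
      thus ?thesis by (simp add: matrix_eq)
    qed
  qed
qed

text \<open>A difference of Bloch states is half of a \<open>pauli_vec\<close>, whose square is a
  scalar matrix, so \<open>msqrt_scalar\<close> applies.\<close>

lemma trace_norm_bloch: "trace_norm (bloch u - bloch v) = norm (u - v)"
proof -
  define w where "w = u - v"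
  have A: "bloch u - bloch v = (1/2) *\<^sub>R pauli_vec w"
    by (simp add: bloch_pauli w_def pauli_vec_def algebra_simps)
  have "madj ((1/2) *\<^sub>R pauli_vec w) = (1/2) *\<^sub>R pauli_vec w" by (simp add: pauli_vec_def qmat_simps)
  hence "madj (bloch u - bloch v) ** (bloch u - bloch v) = (1/4) *\<^sub>R (pauli_vec w ** pauli_vec w)"
    unfolding A by (simp add: qmat_scaleR)
  also have "\<dots> = complex_of_real ((norm w / 2)\<^sup>2) *\<^sub>m mat 1"
    unfolding pauli_vec_mult by (simp add: power_divide power2_norm_eq_inner) (simp add: qmat_simps pauli_vec_def complex_eq_iff)
  finally show ?thesis unfolding trace_norm_def
    by (simp add: msqrt_scalar del: of_real_power) (simp add: trace_def sum_2 mscale_def mat_def w_def)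
qed

section \<open>The exact solution\<close>

text \<open>A Gronwall argument for the squared distance E. In its derivative the cubic terms and
  the linear part of the field cancel, leaving products of two differences weighted by X or Y, so E'
  <= 2 g E follows from the bounds on the reference solution.\<close>

lemma bloch_ode_unique:
  fixes x y z X Y Z :: "real \<Rightarrow> real"
  assumes T: "0 < T" and g: "0 < g"
    and d: "\<And>t. t \<in> {0..T} \<Longrightarrow> (x has_real_derivative - g * (z t * y t)) (at t within {0..T})"
      "\<And>t. t \<in> {0..T} \<Longrightarrow> (y has_real_derivative g * (z t * (x t - 1/2))) (at t within {0..T})"
      "\<And>t. t \<in> {0..T} \<Longrightarrow> (z has_real_derivative g * (y t / 2)) (at t within {0..T})"
    and D: "\<And>t. t \<in> {0..T} \<Longrightarrow> (X has_real_derivative - g * (Z t * Y t)) (at t within {0..T})"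
      "\<And>t. t \<in> {0..T} \<Longrightarrow> (Y has_real_derivative g * (Z t * (X t - 1/2))) (at t within {0..T})"
      "\<And>t. t \<in> {0..T} \<Longrightarrow> (Z has_real_derivative g * (Y t / 2)) (at t within {0..T})"
    and b: "\<And>t. \<bar>X t\<bar> \<le> 1" "\<And>t. \<bar>Y t\<bar> \<le> 1"
    and i: "x 0 = X 0" "y 0 = Y 0" "z 0 = Z 0"
  shows "x T = X T" "y T = Y T" "z T = Z T"
proof -
  define E where "E t = (x t - X t)\<^sup>2 + (y t - Y t)\<^sup>2 + (z t - Z t)\<^sup>2" for t
  define E' where "E' t = 2 * g * (X t * ((y t - Y t) * (z t - Z t)) - Y t * ((x t - X t) * (z t - Z t)))" for t
  have dE: "(E has_real_derivative E' t) (at t within {0..T})" if t: "t \<in> {0..T}" for t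
    unfolding E_def E'_def by (rule derivative_eq_intros d[OF t] D[OF t] refl)+ (simp add: algebra_simps add_divide_distrib diff_divide_distrib)
  have E': "E' t \<le> 2 * g * E t" for t
  proof -
    have y: "\<bar>p * (q * r)\<bar> \<le> q\<^sup>2 / 2 + r\<^sup>2 / 2" if "\<bar>p\<bar> \<le> 1" for p q r :: real
    proof -
      have "\<bar>p * (q * r)\<bar> \<le> 1 * \<bar>q * r\<bar>" unfolding abs_mult[of p] using that by (intro mult_right_mono) auto
      also have "\<dots> \<le> q\<^sup>2 / 2 + r\<^sup>2 / 2"
        using zero_le_power2[of "\<bar>q\<bar> - \<bar>r\<bar>"] by (simp add: abs_mult power2_eq_square algebra_simps)
      finally show ?thesis .
    qed
    have *: "p - q \<le> k + l + m" if "\<bar>p\<bar> \<le> l / 2 + m / 2" "\<bar>q\<bar> \<le> k / 2 + m / 2" "0 \<le> k" "0 \<le> l" for p q k l m :: real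
      using that by linarith
    have "X t * ((y t - Y t) * (z t - Z t)) - Y t * ((x t - X t) * (z t - Z t)) \<le> E t"
      unfolding E_def by (rule *[OF y[OF b(1)] y[OF b(2)]]) auto
    thus ?thesis unfolding E'_def using g by (intro mult_left_mono) auto
  qed
  define F where "F t = exp (- (2 * g * t)) * E t" for t
  have "(F has_real_derivative exp (- (2 * g * t)) * (E' t - 2 * g * E t)) (at t within {0..T})" if t: "t \<in> {0..T}" for t
    unfolding F_def by (rule derivative_eq_intros dE[OF t] refl)+ (simp add: algebra_simps)
  hence "\<And>t. 0 \<le> t \<Longrightarrow> t \<le> T \<Longrightarrow> (F has_derivative (\<lambda>v. (exp (- (2 * g * t)) * (E' t - 2 * g * E t)) * v)) (at t within {0..T})"
    by (simp add: has_field_derivative_def)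
  from mvt_simple[OF T this] obtain t where "F T - F 0 = (exp (- (2 * g * t)) * (E' t - 2 * g * E t)) * (T - 0)" by auto
  moreover have "(exp (- (2 * g * t)) * (E' t - 2 * g * E t)) * (T - 0) \<le> 0"
    using E'[of t] T by (intro mult_nonpos_nonneg mult_nonneg_nonpos) auto
  moreover have "F 0 = 0" using i by (simp add: F_def E_def)
  ultimately have "F T \<le> 0" by linarith
  hence "E T \<le> 0" by (simp add: F_def mult_le_0_iff)
  hence "(x T - X T)\<^sup>2 \<le> 0" "(y T - Y T)\<^sup>2 \<le> 0" "(z T - Z T)\<^sup>2 \<le> 0"
    unfolding E_def using zero_le_power2[of "x T - X T"] zero_le_power2[of "y T - Y T"] zero_le_power2[of "z T - Z T"]
    by linarith+
  thus "x T = X T" "y T = Y T" "z T = Z T" by simp_all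
qed

lemma curve_derivatives:
  fixes g p0 :: real
  defines "P \<equiv> \<lambda>t. p0 * exp (g * t / 2)"
  shows "((\<lambda>t. curve_z (P t)) has_real_derivative g / 2 * (curve_q (P t) * curve_z (P t))) (at t within S)"
    "((\<lambda>t. curve_q (P t)) has_real_derivative - (g / 2) * (curve_z (P t))\<^sup>2) (at t within S)"
proof -
  have pp: "1 + p\<^sup>2 \<noteq> 0" for p :: real by (metis add_pos_nonneg less_irrefl zero_le_power2 zero_less_one)
  have z: "(curve_z has_real_derivative 2 * (1 - p\<^sup>2) / (1 + p\<^sup>2)\<^sup>2) (at p)" for p
    unfolding curve_z_def using pp[of p]
    by (auto intro!: derivative_eq_intros simp: power2_eq_square algebra_simps)
  have q: "(curve_q has_real_derivative - (4 * p) / (1 + p\<^sup>2)\<^sup>2) (at p)" for p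
    unfolding curve_q_def using pp[of p]
    by (auto intro!: derivative_eq_intros simp: power2_eq_square algebra_simps)
  have P: "(P has_real_derivative g / 2 * P t) (at t within S)"
    unfolding P_def by (auto intro!: derivative_eq_intros)
  show "((\<lambda>t. curve_z (P t)) has_real_derivative g / 2 * (curve_q (P t) * curve_z (P t))) (at t within S)"
    using DERIV_chain2[OF z P] by (rule DERIV_cong)
      (use pp[of "P t"] in \<open>simp add: curve_q_def curve_z_def power2_eq_square field_simps\<close>)
  show "((\<lambda>t. curve_q (P t)) has_real_derivative - (g / 2) * (curve_z (P t))\<^sup>2) (at t within S)"
    using DERIV_chain2[OF q P] by (rule DERIV_cong) (simp add: curve_z_def power2_eq_square)
qed

definition curve_point :: "real \<Rightarrow> real \<Rightarrow> real^3" where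
  "curve_point s p = vector [(curve_q p)\<^sup>2, s * (curve_q p * curve_z p), s * curve_z p]"

lemma gp_solution_bloch:
  assumes sol: "gp_solution g T \<psi>" and T: "0 < T" and g: "0 < g" and p0: "0 < p0" and s: "s = 1 \<or> s = - 1"
    and init: "dyad (\<psi> 0) = bloch (curve_point s p0)"
  shows "dyad (\<psi> T) = bloch (curve_point s (p0 * exp (g * T / 2)))"
proof -
  define a b c e where "a t = Re (\<psi> t $ 1)" and "b t = Im (\<psi> t $ 1)" and "c t = Re (\<psi> t $ 2)" and "e t = Im (\<psi> t $ 2)" for t
  define n1 n2 where "n1 t = (a t)\<^sup>2 + (b t)\<^sup>2" and "n2 t = (c t)\<^sup>2 + (e t)\<^sup>2" for t
  have der: "(a has_real_derivative g * n1 t * b t + g / 4 * e t) (at t within {0..T})"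
    "(b has_real_derivative - (g * n1 t * a t + g / 4 * c t)) (at t within {0..T})"
    "(c has_real_derivative g * n2 t * e t + g / 4 * b t) (at t within {0..T})"
    "(e has_real_derivative - (g * n2 t * c t + g / 4 * a t)) (at t within {0..T})" if t: "t \<in> {0..T}" for t
  proof -
    obtain D where D: "(\<psi> has_vector_derivative D) (at t within {0..T})" "\<i> *s D = gp_hamiltonian g (dyad (\<psi> t)) *v \<psi> t"
      using sol t unfolding gp_solution_def by blast
    \<comment> \<open>The nonlinear term is diagonal: \<rho> + Z \<rho> Z is twice the diagonal part
      of \<rho>, so each amplitude sees its own squared modulus.\<close>
    have "(gp_hamiltonian g (dyad (\<psi> t)) *v \<psi> t) $ 1 = complex_of_real (g * n1 t) * \<psi> t $ 1 + complex_of_real (g/4) * \<psi> t $ 2"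
      "(gp_hamiltonian g (dyad (\<psi> t)) *v \<psi> t) $ 2 = complex_of_real (g * n2 t) * \<psi> t $ 2 + complex_of_real (g/4) * \<psi> t $ 1"
      by (simp_all add: gp_hamiltonian_def dyad_def matrix_vector_mult_def sum_2 matrix_matrix_mult_def complex_eq_iff
          n1_def n2_def a_def b_def c_def e_def power2_eq_square algebra_simps)
    hence h: "\<i> * D $ 1 = complex_of_real (g * n1 t) * \<psi> t $ 1 + complex_of_real (g/4) * \<psi> t $ 2"
      "\<i> * D $ 2 = complex_of_real (g * n2 t) * \<psi> t $ 2 + complex_of_real (g/4) * \<psi> t $ 1"
      using D(2) by (metis vector_smult_component)+
    have v: "Re (D $ 1) = g * n1 t * b t + g / 4 * e t" "Im (D $ 1) = - (g * n1 t * a t + g / 4 * c t)"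
      "Re (D $ 2) = g * n2 t * e t + g / 4 * b t" "Im (D $ 2) = - (g * n2 t * c t + g / 4 * a t)"
      using h unfolding complex_eq_iff by (simp_all add: a_def b_def c_def e_def)
    have comp: "((\<lambda>t. \<psi> t $ i) has_vector_derivative D $ i) (at t within {0..T})" for i
      by (rule bounded_linear.has_vector_derivative[OF bounded_linear_vec_nth D(1)])
    have "((\<lambda>t. Re (\<psi> t $ i)) has_real_derivative Re (D $ i)) (at t within {0..T})"
      "((\<lambda>t. Im (\<psi> t $ i)) has_real_derivative Im (D $ i)) (at t within {0..T})" for i
      unfolding has_real_derivative_iff_has_vector_derivative
      by (rule bounded_linear.has_vector_derivative[OF bounded_linear_Re comp],
          rule bounded_linear.has_vector_derivative[OF bounded_linear_Im comp])
    note R = this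
    have f: "a = (\<lambda>t. Re (\<psi> t $ 1))" "b = (\<lambda>t. Im (\<psi> t $ 1))" "c = (\<lambda>t. Re (\<psi> t $ 2))" "e = (\<lambda>t. Im (\<psi> t $ 2))"
      by (auto simp: a_def b_def c_def e_def)
    show "(a has_real_derivative g * n1 t * b t + g / 4 * e t) (at t within {0..T})"
      "(b has_real_derivative - (g * n1 t * a t + g / 4 * c t)) (at t within {0..T})"
      "(c has_real_derivative g * n2 t * e t + g / 4 * b t) (at t within {0..T})"
      "(e has_real_derivative - (g * n2 t * c t + g / 4 * a t)) (at t within {0..T})"
      using R[of 1] R[of 2] unfolding v f[symmetric] by blast+
  qed
  \<comment> \<open>The squared norm n is tracked separately: the dyad equals a Bloch state only if
    n = 1, and the equations for x, y, z do not involve n.\<close>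
  define x y z n where "x t = 2 * (a t * c t + b t * e t)" and "y t = 2 * (a t * e t - b t * c t)"
    and "z t = n1 t - n2 t" and "n t = n1 t + n2 t" for t
  have dn: "(n has_real_derivative 0) (at t within {0..T})" if t: "t \<in> {0..T}" for t
    unfolding n_def n1_def n2_def by (rule derivative_eq_intros der[OF t] refl)+ (simp add: algebra_simps)
  have dx: "(x has_real_derivative - g * (z t * y t)) (at t within {0..T})" if t: "t \<in> {0..T}" for t
    unfolding x_def by (rule derivative_eq_intros der[OF t] refl)+ (simp add: y_def z_def algebra_simps)
  have dy: "(y has_real_derivative g * (z t * (x t - 1/2))) (at t within {0..T})" if t: "t \<in> {0..T}" for t
    unfolding y_def by (rule derivative_eq_intros der[OF t] refl)+ (simp add: x_def z_def n1_def n2_def power2_eq_square algebra_simps)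
  have dz: "(z has_real_derivative g * (y t / 2)) (at t within {0..T})" if t: "t \<in> {0..T}" for t
    unfolding z_def n1_def n2_def by (rule derivative_eq_intros der[OF t] refl)+ (simp add: y_def n1_def n2_def algebra_simps)
  have dyad_n: "dyad (\<psi> t) = bloch r \<longleftrightarrow> n t = 1 \<and> x t = r $ 1 \<and> y t = r $ 2 \<and> z t = r $ 3" for t r
    unfolding bloch_pauli pauli_vec_def
    by (auto simp: vec_eq_iff forall_2 dyad_def mat_def complex_eq_iff n_def x_def y_def z_def n1_def n2_def
        a_def b_def c_def e_def power2_eq_square algebra_simps)
  have c3: "curve_point s p $ 1 = (curve_q p)\<^sup>2" "curve_point s p $ 2 = s * (curve_q p * curve_z p)"
    "curve_point s p $ 3 = s * curve_z p" for p by (simp_all add: curve_point_def)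
  define P where "P t = p0 * exp (g * t / 2)" for t
  have P: "0 < P t" for t using p0 by (simp add: P_def)
  define X Y Z where "X t = (curve_q (P t))\<^sup>2" and "Y t = s * (curve_q (P t) * curve_z (P t))" and "Z t = s * curve_z (P t)" for t
  note cd = curve_derivatives[where g=g and ?p0.0=p0, folded P_def]
  have ss: "s * s = 1" using s by auto
  have DX: "(X has_real_derivative - g * (Z t * Y t)) (at t within {0..T})" for t
    unfolding X_def by (rule derivative_eq_intros cd refl)+ (use ss in \<open>simp add: Y_def Z_def power2_eq_square ac_simps\<close>)
  have DY: "(Y has_real_derivative g * (Z t * (X t - 1/2))) (at t within {0..T})" for t
  proof -
    have "(curve_z (P t))\<^sup>2 = 1 - (curve_q (P t))\<^sup>2" using curve_bounds(4)[OF P[of t]] by simp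
    hence e: "- (g/2) * (curve_z (P t))\<^sup>2 + g/2 * (curve_q (P t))\<^sup>2 = g * ((curve_q (P t))\<^sup>2 - 1/2)"
      by (simp only:) (simp add: algebra_simps)
    show ?thesis unfolding Y_def
    proof (rule DERIV_cong[OF DERIV_cmult[OF DERIV_mult[OF cd(2) cd(1)], of s]])
      have "s * (- (g/2) * (curve_z (P t))\<^sup>2 * curve_z (P t) + g/2 * (curve_q (P t) * curve_z (P t)) * curve_q (P t))
        = s * curve_z (P t) * (- (g/2) * (curve_z (P t))\<^sup>2 + g/2 * (curve_q (P t))\<^sup>2)"
        by (simp add: power2_eq_square algebra_simps)
      thus "s * (- (g/2) * (curve_z (P t))\<^sup>2 * curve_z (P t) + g/2 * (curve_q (P t) * curve_z (P t)) * curve_q (P t))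
        = g * (Z t * (X t - 1/2))" unfolding e by (simp only: X_def Z_def ac_simps)
    qed
  qed
  have DZ: "(Z has_real_derivative g * (Y t / 2)) (at t within {0..T})" for t
    unfolding Z_def by (rule derivative_eq_intros cd refl)+ (simp add: Y_def)
  have b: "\<bar>X t\<bar> \<le> 1" "\<bar>Y t\<bar> \<le> 1" for t
  proof -
    note cb = curve_bounds[OF P[of t]]
    show "\<bar>X t\<bar> \<le> 1" using cb(1) by (simp add: X_def abs_square_le_1)
    have "\<bar>curve_q (P t)\<bar> * \<bar>curve_z (P t)\<bar> \<le> 1 * 1" using cb by (intro mult_mono) auto
    thus "\<bar>Y t\<bar> \<le> 1" using s by (auto simp: Y_def abs_mult)
  qed
  have i: "n 0 = 1" "x 0 = X 0" "y 0 = Y 0" "z 0 = Z 0"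
    using init unfolding dyad_n c3 by (auto simp: X_def Y_def Z_def P_def)
  note U = bloch_ode_unique[OF T g dx dy dz DX DY DZ b i(2-4)]
  have "\<And>t. 0 \<le> t \<Longrightarrow> t \<le> T \<Longrightarrow> (n has_derivative ((*) 0)) (at t within {0..T})"
    using dn by (simp add: has_field_derivative_def)
  from mvt_simple[OF T this] have "n T = 1" using i(1) by auto
  thus ?thesis unfolding dyad_n c3 using U by (simp add: X_def Y_def Z_def P_def)
qed

section \<open>The algorithm\<close>

text \<open>This is z / (1 + q) for z = sqrt \<xi> and q = sqrt (1 - \<xi>). It lies below 1, so
  every run begins in the outgoing phase.\<close>

definition initial_clock :: "real \<Rightarrow> real" where "initial_clock \<xi> = sqrt \<xi> / (1 + sqrt (1 - \<xi>))"

lemma initial_clock: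
  assumes "0 < \<xi>" "\<xi> < 1"
  shows "0 < initial_clock \<xi>" "initial_clock \<xi> < 1" "initial_state \<xi> s = bloch (curve_point s (initial_clock \<xi>))"
proof -
  define q z where "q = sqrt (1 - \<xi>)" and "z = sqrt \<xi>"
  have q: "0 < q" "q\<^sup>2 = 1 - \<xi>" and z: "0 < z" "z\<^sup>2 = \<xi>" using assms by (auto simp: q_def z_def)
  have p: "initial_clock \<xi> = z / (1 + q)" by (simp add: initial_clock_def q_def z_def)
  show "0 < initial_clock \<xi>" unfolding p using q z by simp
  have "z < 1" using assms by (simp add: z_def)
  thus "initial_clock \<xi> < 1" unfolding p using q by (simp add: divide_less_eq)
  have "z\<^sup>2 = (1 - q) * (1 + q)" using q z by (simp add: power2_eq_square algebra_simps)
  hence p2: "(initial_clock \<xi>)\<^sup>2 = (1 - q) / (1 + q)" unfolding p power_divide using q by (simp add: power2_eq_square)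
  hence a: "1 + (initial_clock \<xi>)\<^sup>2 = 2 / (1 + q)" "1 - (initial_clock \<xi>)\<^sup>2 = 2 * q / (1 + q)" using q by (auto simp: field_simps)
  have "curve_q (initial_clock \<xi>) = q" "curve_z (initial_clock \<xi>) = z"
    unfolding curve_q_def curve_z_def a using q by (auto simp: p)
  thus "initial_state \<xi> s = bloch (curve_point s (initial_clock \<xi>))"
    by (simp add: initial_state_def bloch_def curve_point_def q real_sqrt_mult) (simp add: q_def z_def mult.commute)
qed

lemma gp_map_power_bloch:
  assumes "norm r = 1" shows "(gp_map g \<tau> ^^ k) (bloch r) = bloch ((bloch_step (g * \<tau>) ^^ k) r) \<and> norm ((bloch_step (g * \<tau>) ^^ k) r) = 1"
  by (induction k) (simp_all add: assms gp_map_bloch norm_bloch_step)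

lemma bloch_step_power_flip: "(bloch_step h ^^ k) (flip_yz r) = flip_yz ((bloch_step h ^^ k) r)"
  by (induction k) (simp_all add: bloch_step_flip)

lemma norm_curve_point: "0 < p \<Longrightarrow> norm (curve_point 1 p) = 1"
proof -
  assume "0 < p"
  define q z where "q = curve_q p" and "z = curve_z p"
  have "q\<^sup>2 + z\<^sup>2 = 1" using curve_bounds(4)[OF \<open>0 < p\<close>] by (simp add: q_def z_def)
  hence "(q\<^sup>2)\<^sup>2 + (q * z)\<^sup>2 + z\<^sup>2 = 1" by algebra
  hence "(norm (curve_point 1 p))\<^sup>2 = 1\<^sup>2" by (simp add: norm_3 curve_point_def q_def z_def)
  thus ?thesis using norm_ge_zero[of "curve_point 1 p"] unfolding power2_eq_iff by linarith
qed

lemma prepared_state_dyad: "prepared_state U = dyad (U *v ket0)"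
  by (simp add: prepared_state_def dyad_def ket0_def qmat_simps matrix_vector_mult_def)

text \<open>The trace norm is the Euclidean distance of Bloch vectors, hence at most the l1 distance
  \<open>curve_dist\<close>. The flip symmetry reduces the second candidate to the first, so one
  index k serves both.\<close>

lemma solves_from_orbit:
  fixes g \<xi> T \<epsilon> h :: real and k :: nat
  defines "p \<equiv> initial_clock \<xi> * exp (g * T / 2)"
  defines "r \<equiv> (bloch_step h ^^ k) (curve_point 1 (initial_clock \<xi>))"
  assumes g: "0 < g" and T: "0 < T" and \<xi>: "0 < \<xi>" "\<xi> < 1"
    and close: "curve_dist p (r $ 1) (r $ 2) (r $ 3) \<le> \<epsilon>"
  shows "solves_gp_problem g \<xi> T \<epsilon> (gp_circuit g (h / g) k)"
  unfolding solves_gp_problem_def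
proof (intro allI ballI impI)
  fix U :: qmat and s :: real and \<psi>
  assume s: "s \<in> {1, - 1}" and a: "unitary_mat U \<and> dyad (U *v ket0) = initial_state \<xi> s \<and> gp_solution g T \<psi> \<and> \<psi> 0 = U *v ket0"
  note ic = initial_clock[OF \<xi>]
  have hg: "g * (h / g) = h" using g by simp
  have cp: "curve_point s q = (if s = 1 then curve_point 1 q else flip_yz (curve_point 1 q))" for q
    using s by (auto simp: curve_point_def vec_eq_iff forall_3)
  have n: "norm (curve_point s (initial_clock \<xi>)) = 1" unfolding cp using norm_curve_point[OF ic(1)] by simp
  have iter: "prepared_state (circuit_op (gp_circuit g (h / g) k) U) = (gp_map g (h / g) ^^ k) (prepared_state U)"
    using implements_gp_circuit[of g "h / g" k] a unfolding implements_gp_iteration_def by blast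
  have "prepared_state U = bloch (curve_point s (initial_clock \<xi>))"
    using a ic(3) by (simp add: prepared_state_dyad)
  hence "prepared_state (circuit_op (gp_circuit g (h / g) k) U) = bloch ((bloch_step h ^^ k) (curve_point s (initial_clock \<xi>)))"
    using gp_map_power_bloch[OF n, where g=g and \<tau>="h / g" and k=k] unfolding iter hg by simp
  moreover have "dyad (\<psi> T) = bloch (curve_point s p)"
    unfolding p_def by (rule gp_solution_bloch[OF _ T g ic(1)]) (use a s ic(3) in auto)
  ultimately have "trace_norm (prepared_state (circuit_op (gp_circuit g (h / g) k) U) - dyad (\<psi> T)) =
      norm ((bloch_step h ^^ k) (curve_point s (initial_clock \<xi>)) - curve_point s p)"
    by (simp add: trace_norm_bloch)
  also have "\<dots> = norm (r - curve_point 1 p)"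
  proof -
    have "flip_yz u - flip_yz v = flip_yz (u - v)" for u v by (simp add: vec_eq_iff forall_3)
    thus ?thesis unfolding cp r_def by (auto simp: bloch_step_power_flip)
  qed
  also have "\<dots> \<le> (\<Sum>i\<in>UNIV. \<bar>(r - curve_point 1 p) $ i\<bar>)" by (rule norm_le_l1_cart)
  also have "\<dots> = curve_dist p (r $ 1) (r $ 2) (r $ 3)"
    by (simp add: sum_3 curve_dist_def curve_point_def)
  finally show "trace_norm (prepared_state (circuit_op (gp_circuit g (h / g) k) U) - dyad (\<psi> T)) \<le> \<epsilon>"
    using close by linarith
qed

section \<open>Choice of the step size and the number of steps\<close>

lemma power_le_exp_imp:
  fixes h B :: real
  assumes "0 < h" "h \<le> 1" "(1 + h/4) ^ k \<le> exp B"
  shows "real k * h \<le> 8 * B"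
proof -
  \<comment> \<open>The inequality exp (h/8) <= 1 + h/4 turns the bound on the clock into a bound on
    k h.\<close>
  have "exp (h/8) ^ k \<le> (1 + h/4) ^ k"
  proof (rule power_mono)
    have "exp (h/8) \<le> 1 + h/8 + (h/8)\<^sup>2" using assms by (intro exp_bound) auto
    also have "(h/8)\<^sup>2 \<le> h/8 * 1" unfolding power2_eq_square using assms by (intro mult_left_mono) auto
    finally show "exp (h/8) \<le> 1 + h/4" by simp
  qed simp
  hence "exp (real k * (h/8)) \<le> exp B" using assms(3) unfolding exp_of_nat_mult by linarith
  thus ?thesis by simp
qed

lemma enough_steps:
  fixes g \<xi> T \<epsilon> :: real
  assumes g: "0 < g" and \<xi>: "0 < \<xi>" "\<xi> < 1" and T: "0 < T" and \<epsilon>: "0 < \<epsilon>" "\<epsilon> < 1"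
  shows "\<exists>\<tau> k. 0 < \<tau> \<and> solves_gp_problem g \<xi> T \<epsilon> (gp_circuit g \<tau> k) \<and>
    real k \<le> 10^18 * (1 + g * T + (g * T)\<^sup>2 / \<epsilon>\<^sup>2)"
proof -
  note ic = initial_clock[OF \<xi>]
  define S where "S = g * T"
  have S: "0 < S" using g T by (simp add: S_def)
  define p0 where "p0 = initial_clock \<xi>"
  have p0: "0 < p0" "p0 < 1" using ic by (auto simp: p0_def)
  define p where "p = p0 * exp (S / 2)"
  have "p0 * 1 \<le> p" unfolding p_def using p0 S by (intro mult_left_mono) auto
  hence p: "p0 \<le> p" by simp
  \<comment> \<open>The target is the exact clock at time T, capped at 24 / \<epsilon>, where
    \<open>curve_dist_far\<close> yields 12 / m = \<epsilon> / 2.\<close>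
  define m where "m = min p (24 / \<epsilon>)"
  have "1 \<le> 24 / \<epsilon>" using \<epsilon> by simp
  hence "p0 \<le> 24 / \<epsilon>" using p0 by linarith
  hence m: "p0 \<le> m" "m \<le> p" "m \<le> 24 / \<epsilon>" "0 < m" using p p0 \<epsilon> by (auto simp: m_def)
  \<comment> \<open>\<kappa> is the product K h. Accuracy asks for \<kappa> m = O(\<epsilon>), and
    the inward phase for a small \<kappa> m^2. With m up to 24 / \<epsilon> this leads to
    \<epsilon>^2; for g T < 1 the clock is at most 3 and \<epsilon> is enough.\<close>
  define \<kappa> where "\<kappa> = (if 1 \<le> S then \<epsilon>\<^sup>2 else \<epsilon>) / 10^9"
  have \<epsilon>2: "\<epsilon>\<^sup>2 \<le> \<epsilon>" "0 < \<epsilon>\<^sup>2" using \<epsilon> by (auto simp: power2_eq_square mult_le_cancel_left1)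
  have \<kappa>: "0 < \<kappa>" "\<kappa> \<le> 1/10^8" "\<kappa> \<le> \<epsilon> / 10^9" using \<epsilon> \<epsilon>2(1) by (auto simp: \<kappa>_def)
  have mk: "\<kappa> * m \<le> \<epsilon> * 24 / 10^9 \<and> \<kappa> * m\<^sup>2 \<le> 1/10^6"
  proof (cases "1 \<le> S")
    case True
    have me: "m * \<epsilon> \<le> 24" "0 \<le> m * \<epsilon>" using m \<epsilon> by (auto simp: pos_le_divide_eq)
    have "\<kappa> * m = \<epsilon> * (m * \<epsilon>) / 10^9" using True by (simp add: \<kappa>_def power2_eq_square)
    also have "\<dots> \<le> \<epsilon> * 24 / 10^9" using me \<epsilon> by (intro divide_right_mono mult_left_mono) auto
    finally have 1: "\<kappa> * m \<le> \<epsilon> * 24 / 10^9" .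
    have "(m * \<epsilon>)\<^sup>2 \<le> 24\<^sup>2" using me by (intro power_mono) auto
    moreover have "\<kappa> * m\<^sup>2 = (m * \<epsilon>)\<^sup>2 / 10^9" using True by (simp add: \<kappa>_def power_mult_distrib mult.commute)
    ultimately show ?thesis using 1 by simp
  next
    case False
    have "exp (S/2) \<le> 1 + S/2 + (S/2)\<^sup>2" using False S by (intro exp_bound) auto
    moreover have "(S/2)\<^sup>2 \<le> 1" using False S by (intro power_le_one) auto
    ultimately have "exp (S/2) \<le> 3" using False by simp
    hence "p \<le> 1 * 3" unfolding p_def using p0 by (intro mult_mono) auto
    hence m3: "m \<le> 3" using m by simp
    have "\<kappa> * m \<le> \<epsilon> / 10^9 * 3" using \<kappa> m3 m \<epsilon> by (intro mult_mono) auto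
    moreover have "\<kappa> * m\<^sup>2 \<le> 1/10^8 * 3\<^sup>2" using \<kappa> m3 m by (intro mult_mono power_mono) auto
    ultimately show ?thesis using \<epsilon> by simp
  qed
  \<comment> \<open>10^8 is the constant K supplied by \<open>bloch_step_expansion\<close>.\<close>
  define h where "h = \<kappa> / 10^8"
  have hb: "0 < h" "h \<le> 1" "10^8 * h = \<kappa>" using \<kappa> by (auto simp: h_def)
  define r where "r k = (bloch_step h ^^ k) (curve_point 1 p0)" for k
  have nr: "norm (r k) = 1" for k
    unfolding r_def by (induction k) (simp_all add: norm_curve_point p0 norm_bloch_step)
  interpret euler_orbit "10^8" h "\<lambda>k. r k $ 1" "\<lambda>k. r k $ 2" "\<lambda>k. r k $ 3"
  proof
    show "(r k $ 1)\<^sup>2 + (r k $ 2)\<^sup>2 + (r k $ 3)\<^sup>2 = 1" for k using nr[of k] norm_3[of "r k"] by simp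
    have rS: "r (Suc k) = bloch_step h (r k)" for k by (simp add: r_def)
    show "euler_step (10^8) h (r k $ 1) (r k $ 2) (r k $ 3) (r (Suc k) $ 1) (r (Suc k) $ 2) (r (Suc k) $ 3)" for k
      unfolding euler_step_def rS using bloch_step_expansion[OF nr[of k] hb(1,2)] by simp
  qed (use hb \<kappa> in auto)
  have "\<exists>k. p0 * (1 + h/4) ^ k \<le> m * (1 + 20000 * (10^8 * h)) \<and>
      curve_dist m (r k $ 1) (r k $ 2) (r k $ 3) \<le> 300000 * (10^8 * h) * (1 + m)"
    by (rule orbit_reaches_curve_point) (use p0 m mk hb(3) in \<open>auto simp: r_def curve_point_def\<close>)
  then obtain k where k: "p0 * (1 + h/4) ^ k \<le> m * (1 + 20000 * \<kappa>)"
      "curve_dist m (r k $ 1) (r k $ 2) (r k $ 3) \<le> 300000 * \<kappa> * (1 + m)" unfolding hb(3) by blast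
  have "300000 * \<kappa> * (1 + m) = 300000 * \<kappa> + 300000 * (\<kappa> * m)" by (simp add: algebra_simps)
  hence d1: "curve_dist m (r k $ 1) (r k $ 2) (r k $ 3) \<le> \<epsilon> / 2" using k(2) mk \<kappa> \<epsilon> by simp
  have d2: "curve_dist p ((curve_q m)\<^sup>2) (curve_q m * curve_z m) (curve_z m) \<le> \<epsilon> / 2"
  proof (cases "p \<le> 24 / \<epsilon>")
    case True
    thus ?thesis using \<epsilon> by (simp add: m_def curve_dist_def)
  next
    case False
    hence "m = 24 / \<epsilon>" by (simp add: m_def)
    thus ?thesis using curve_dist_far[of m p m] m by simp
  qed
  have "curve_dist p (r k $ 1) (r k $ 2) (r k $ 3) \<le> \<epsilon>"
    using d1 d2 curve_dist_triangle[of p "r k $ 1" "r k $ 2" "r k $ 3" m] by linarith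
  hence sol: "solves_gp_problem g \<xi> T \<epsilon> (gp_circuit g (h / g) k)"
    unfolding p_def S_def p0_def r_def by (intro solves_from_orbit g T \<xi>) simp
  have "p0 * (1 + h/4) ^ k \<le> p * (1 + 20000 * \<kappa>)"
    using k(1) m \<kappa> by (smt (verit) mult_right_mono)
  \<comment> \<open>Here \<xi> drops out: p is p0 exp (g T / 2), so dividing by p0 bounds the number
    of steps independently of the initial state.\<close>
  hence "p0 * (1 + h/4) ^ k \<le> p0 * (exp (S/2) * (1 + 20000 * \<kappa>))" by (simp add: p_def ac_simps)
  hence "(1 + h/4) ^ k \<le> exp (S/2) * (1 + 20000 * \<kappa>)" using p0 by simp
  also have "\<dots> \<le> exp (S/2) * exp (20000 * \<kappa>)" using exp_ge_add_one_self[of "20000 * \<kappa>"] by (intro mult_left_mono) auto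
  also have "\<dots> = exp (S/2 + 20000 * \<kappa>)" by (simp add: exp_add)
  finally have "real k * h \<le> 8 * (S/2 + 20000 * \<kappa>)" by (rule power_le_exp_imp[OF hb(1,2)])
  hence "real k \<le> (4 * S + 160000 * \<kappa>) / h" using hb by (simp add: pos_le_divide_eq)
  also have "\<dots> = 4 * S / h + 160000 * 10^8" using hb(1) by (simp add: add_divide_distrib hb(3)[symmetric])
  \<comment> \<open>Both regimes fit one expression: S / \<epsilon>^2 <= S^2 / \<epsilon>^2 for S >=
    1, and S / \<epsilon> <= 1 + (S / \<epsilon>)^2 for S < 1.\<close>
  also have "4 * S / h \<le> 4 * 10^17 * (1 + S\<^sup>2 / \<epsilon>\<^sup>2)"
  proof (cases "1 \<le> S")
    case True
    have "4 * S / h = 4 * 10^17 * (S / \<epsilon>\<^sup>2)" using True by (simp add: h_def \<kappa>_def)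
    also have "\<dots> \<le> 4 * 10^17 * (1 + S\<^sup>2 / \<epsilon>\<^sup>2)"
    proof (rule mult_left_mono)
      have "S * 1 \<le> S\<^sup>2" unfolding power2_eq_square using True by (intro mult_left_mono) auto
      hence "S / \<epsilon>\<^sup>2 \<le> S\<^sup>2 / \<epsilon>\<^sup>2" by (intro divide_right_mono) auto
      thus "S / \<epsilon>\<^sup>2 \<le> 1 + S\<^sup>2 / \<epsilon>\<^sup>2" by linarith
    qed simp
    finally show ?thesis .
  next
    case False
    have "4 * S / h = 4 * 10^17 * (S / \<epsilon>)" using False by (simp add: h_def \<kappa>_def)
    also have "\<dots> \<le> 4 * 10^17 * (1 + (S / \<epsilon>)\<^sup>2)"
    proof (rule mult_left_mono)
      show "S / \<epsilon> \<le> 1 + (S / \<epsilon>)\<^sup>2" using sum_squares_bound[of "S / \<epsilon>" "1/2"] by (simp add: power2_eq_square)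
    qed simp
    finally show ?thesis by (simp add: power_divide)
  qed
  finally have "real k \<le> 4 * 10^17 * (1 + S\<^sup>2 / \<epsilon>\<^sup>2) + 160000 * 10^8" by simp
  also have "\<dots> \<le> 10^18 * (1 + S + S\<^sup>2 / \<epsilon>\<^sup>2)"
  proof -
    have *: "4 * 10^17 * (1 + a) + 160000 * 10^8 \<le> 10^18 * (1 + S + a)" if "0 \<le> a" for a
      using that S by simp
    show ?thesis by (rule *) simp
  qed
  finally show ?thesis using sol hb g unfolding S_def by (intro exI[of _ "h / g"] exI[of _ k]) simp
qed

theorem theorem10:
  shows "\<exists>(\<A> :: algorithm)
           (\<tau> :: real \<Rightarrow> real \<Rightarrow> real \<Rightarrow> real \<Rightarrow> real)
           (N :: real \<Rightarrow> real \<Rightarrow> real \<Rightarrow> real \<Rightarrow> nat).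
    (\<forall>g \<xi> T \<epsilon>. 0 < g \<and> 0 < \<xi> \<and> \<xi> < 1 \<and> 0 < T \<and> 0 < \<epsilon> \<and> \<epsilon> < 1 \<longrightarrow>
       unitary_gates (\<A> g \<xi> T \<epsilon>) \<and>
       0 < \<tau> g \<xi> T \<epsilon> \<and>
       implements_gp_iteration g (\<tau> g \<xi> T \<epsilon>) (N g \<xi> T \<epsilon>) (\<A> g \<xi> T \<epsilon>) \<and>
       solves_gp_problem g \<xi> T \<epsilon> (\<A> g \<xi> T \<epsilon>)) \<and>
    (\<exists>C::real. \<forall>g T \<epsilon>. 0 < g \<and> 0 < T \<and> 0 < \<epsilon> \<and> \<epsilon> < 1 \<longrightarrow>
       worst_case_queries \<A> g T \<epsilon>
         \<le> ereal (exp (C * (1 + g * T + (g * T)\<^sup>2 / \<epsilon>\<^sup>2))))"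
proof -
  \<comment> \<open>Step size and step count are chosen as a pair from the four parameters only, so
    one circuit serves every oracle and both candidates.\<close>
  define good where "good g \<xi> T \<epsilon> w \<longleftrightarrow> 0 < fst w \<and> solves_gp_problem g \<xi> T \<epsilon> (gp_circuit g (fst w) (snd w)) \<and>
    real (snd w) \<le> 10^18 * (1 + g * T + (g * T)\<^sup>2 / \<epsilon>\<^sup>2)" for g \<xi> T \<epsilon> and w :: "real \<times> nat"
  define w where "w g \<xi> T \<epsilon> = (SOME w. good g \<xi> T \<epsilon> w)" for g \<xi> T \<epsilon>
  have w: "good g \<xi> T \<epsilon> (w g \<xi> T \<epsilon>)" if "0 < g" "0 < \<xi>" "\<xi> < 1" "0 < T" "0 < \<epsilon>" "\<epsilon> < 1" for g \<xi> T \<epsilon>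
    unfolding w_def using enough_steps[OF that] by (intro someI_ex[of "good g \<xi> T \<epsilon>"]) (auto simp: good_def)
  define \<A> where "\<A> g \<xi> T \<epsilon> = gp_circuit g (fst (w g \<xi> T \<epsilon>)) (snd (w g \<xi> T \<epsilon>))" for g \<xi> T \<epsilon>
  show ?thesis
  proof (rule exI[of _ \<A>], rule exI[of _ "\<lambda>g \<xi> T \<epsilon>. fst (w g \<xi> T \<epsilon>)"], rule exI[of _ "\<lambda>g \<xi> T \<epsilon>. snd (w g \<xi> T \<epsilon>)"],
      intro conjI exI[of _ "ln 13 * 10^18"] allI impI)
    fix g T \<epsilon> :: real
    assume a: "0 < g \<and> 0 < T \<and> 0 < \<epsilon> \<and> \<epsilon> < 1"
    show "worst_case_queries \<A> g T \<epsilon> \<le> ereal (exp (ln 13 * 10^18 * (1 + g * T + (g * T)\<^sup>2 / \<epsilon>\<^sup>2)))"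
      unfolding worst_case_queries_def
    proof (rule SUP_least)
      fix \<xi> :: real assume "\<xi> \<in> {0<..<1}"
      hence b: "real (snd (w g \<xi> T \<epsilon>)) \<le> 10^18 * (1 + g * T + (g * T)\<^sup>2 / \<epsilon>\<^sup>2)" using w[of g \<xi> T \<epsilon>] a by (simp add: good_def)
      \<comment> \<open>The query count is 13^k, so its logarithm is ln 13 times the number of
        steps; this gives the constant ln 13 * 10^18.\<close>
      have "real (query_count (\<A> g \<xi> T \<epsilon>)) = 13 ^ snd (w g \<xi> T \<epsilon>)" by (simp add: \<A>_def query_count_gp_circuit)
      also have "\<dots> = exp (ln 13 * real (snd (w g \<xi> T \<epsilon>)))" by (simp add: exp_of_nat2_mult)
      also have "\<dots> \<le> exp (ln 13 * (10^18 * (1 + g * T + (g * T)\<^sup>2 / \<epsilon>\<^sup>2)))"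
        unfolding exp_le_cancel_iff using b by (intro mult_left_mono) auto
      finally show "ereal (real (query_count (\<A> g \<xi> T \<epsilon>))) \<le> ereal (exp (ln 13 * 10^18 * (1 + g * T + (g * T)\<^sup>2 / \<epsilon>\<^sup>2)))"
        by (simp add: mult.assoc)
    qed
  qed (use w in \<open>auto simp: \<A>_def good_def unitary_gates_gp_circuit implements_gp_circuit\<close>)
qed

end
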